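(* Let $\mathcal A$ be a unital $A_\infty$-category. If $S:\mathcal A\to\mathcal A$ is a (right) Serre $A_\infty$-functor, then $\mathsf kS:\mathsf k\mathcal A\to\mathsf k\mathcal A$ is a (right) Serre $\mathcal K$-functor.
   Context: Conventions. $\Bbbk$ is a commutative ring with unity; graded means $\mathbb Z$-graded. Maps act on the right and composition is written left to right ($fg=f\cdot g$: first $f$, then $g$). Koszul signs: $(x\otimes y)(f\otimes g)=(-1)^{\deg y\deg f}xf\otimes yg$; $c$ is the signed flip. $sM=M[1]$, $M[n]^k=M^{k+n}$, $s^n:M\to M[n]$ is the identity map, of degree $-n$. For homogeneous $f:M\to N$, $f^{[n]}=(-1)^{n\deg f}s^{-n}fs^n:M[n]\to N[n]$. $\underline{\mathsf C}_{\Bbbk}$ is the dg category of complexes: $\underline{\mathsf C}_{\Bbbk}(M,N)^n=\prod_i\mathrm{Hom}_{\Bbbk}(M^i,N^{i+n})$, differential $f\mapsto fd_N-(-1)^{\deg f}d_Mf$, composition $f\otimes g\mapsto fg$. $\mathcal K$ is the homotopy category of complexes of $\Bbbk$-modules, closed symmetric monoidal with unit $\Bbbk$ and inner hom $\underline{\mathcal K}(M,N)=\underline{\mathsf C}_{\Bbbk}(M,N)$. $A_\infty$-categories. A graded quiver $\mathcal A$ is a set of objects with graded modules $\mathcal A(X,Y)$. $Ts\mathcal A=\bigoplus_{n\ge0}T^ns\mathcal A$, $T^ns\mathcal A(X,Y)=\bigoplus s\mathcal A(X,X_1)\otimes\dots\otimes s\mathcal A(X_{n-1},Y)$, $T^0s\mathcal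 A(X,X)=\Bbbk$, $T^0s\mathcal A(X,Y)=0$ for $X\ne Y$, with the cut comultiplication. An $A_\infty$-category is a graded quiver with degree 1 maps $b_n:T^ns\mathcal A(X,Y)\to s\mathcal A(X,Y)$, $n\ge1$, such that the coderivation $b=\sum1^{\otimes r}\otimes b_n\otimes1^{\otimes t}$ of $Ts\mathcal A$ satisfies $b^2=0$. $m_1=sb_1s^{-1}$, $m_2=(s\otimes s)b_2s^{-1}$; a dg category is an $A_\infty$-category with these $m_1,m_2$ and $b_n=0$ for $n>2$. An $A_\infty$-functor $f:(\mathcal A_i)_{i=1}^n\to\mathcal B$ is a map on objects and a degree 0 coalgebra homomorphism $\boxtimes_iTs\mathcal A_i\to Ts\mathcal B$ commuting with $b$, whose components $f_{k_1\dots k_n}:\bigotimes_iT^{k_i}s\mathcal A_i(X_i,Y_i)\to s\mathcal B((X_i)_if,(Y_i)_if)$ satisfy $f_{0\dots0}=0$; composition is composition of coalgebra maps. Elements of $s\underline{\mathsf A}_\infty((\mathcal A_i);\mathcal B)(f,g)$ are $(f,g)$-coderivations $r$ ($r\Delta_0=\Delta_0(f\otimes r+r\otimes g)$), with $rB_1=rb-(-1)^{\deg r}br$. A natural $A_\infty$-transformation $r:f\to g$ is such $r$ of degree $-1$ with $rB_1=0$; for unital $\mathcal B$, $f,g$ are isomorphic if there is a natural $r:f\to g$ whose components $r_{0\dots0}s^{-1}$ are invertible modulo boundaries (isomorphisms in $H^0(\mathcal B)$). Unitality. $\mathcal A$ is unital if for each $X$ there is $\mathbf i_X\in s\mathcal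 A(X,X)$ of degree $-1$ with $\mathbf i_Xb_1=0$ and $(1\otimes\mathbf i_Y)b_2$, $-(\mathbf i_X\otimes1)b_2:s\mathcal A(X,Y)\to s\mathcal A(X,Y)$ homotopic to the identity. $\mathsf k\mathcal A$ is the $\mathcal K$-category with complexes $(\mathcal A(X,Y),m_1)$, composition the class of $m_2$, units $\mathbf i_Xs^{-1}$. For an $A_\infty$-functor $f:\mathcal A\to\mathcal B$, $\mathsf kf$ acts as $f$ on objects and by the class of $sf_1s^{-1}$ on morphisms; $f$ is unital if $\mathsf kf$ preserves units. $f$ is an $A_\infty$-equivalence if it is unital and invertible up to isomorphism of $A_\infty$-functors. A right Serre $\mathcal K$-functor of a $\mathcal K$-category $\mathcal C$ is a $\mathcal K$-functor $S:\mathcal C\to\mathcal C$ for which there are isomorphisms $\psi_{X,Y}:\mathcal C(X,YS)\to\underline{\mathcal K}(\mathcal C(Y,X),\Bbbk)$ in $\mathcal K$, $\mathcal K$-natural in $X$ and $Y$. It is a Serre functor if moreover it is a self-equivalence. Serre $A_\infty$-functors. $\mathcal A^{\mathrm{op}}(X,Y)=\mathcal A(Y,X)$ with $b^{\mathrm{op}}=\gamma b\gamma$, where $\gamma:Ts\mathcal A^{\mathrm{op}}\leftrightarrow Ts\mathcal A$ is on $T^k$ the Koszul-signed reversal of factors times $(-1)^k$; $f^{\mathrm{op}}=(\boxtimes\gamma)f\gamma$. $\mathrm{Hom}_{\mathcal A}:\mathcal A^{\mathrm{op}},\mathcal A\to\underline{\mathsf C}_{\Bbbk}$ sends $(X,Z)$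 to $(\mathcal A(X,Z),m_1)$; its component $T^ks\mathcal A^{\mathrm{op}}(X,Y)\otimes T^ns\mathcal A(Z,W)\to s\underline{\mathsf C}_{\Bbbk}(\mathcal A(X,Z),\mathcal A(Y,W))$, $(k,n)\ne(0,0)$, sends $x\otimes z$ to $h^{[-1]}s$ with $h:s\mathcal A(X,Z)\to s\mathcal A(Y,W)$, $p\mapsto(p\otimes x\gamma\otimes z)(c\otimes1)b_{k+1+n}$. $D:\underline{\mathsf C}_{\Bbbk}^{\mathrm{op}}\to\underline{\mathsf C}_{\Bbbk}$ sends $M$ to $\underline{\mathsf C}_{\Bbbk}(M,\Bbbk)$, has $D_k=0$ for $k>1$, and $sD_1s^{-1}:\underline{\mathsf C}_{\Bbbk}(N,M)\to\underline{\mathsf C}_{\Bbbk}(\underline{\mathsf C}_{\Bbbk}(M,\Bbbk),\underline{\mathsf C}_{\Bbbk}(N,\Bbbk))$ is $f\mapsto(g\mapsto(-1)^{\deg f\deg g}fg)$. A right Serre $A_\infty$-functor of a unital $\mathcal A$ is an $A_\infty$-functor $S:\mathcal A\to\mathcal A$ such that the $A_\infty$-functors $(1,S)\cdot\mathrm{Hom}_{\mathcal A}$ and $\mathrm{Hom}_{\mathcal A^{\mathrm{op}}}^{\mathrm{op}}\cdot D$ from $\mathcal A^{\mathrm{op}},\mathcal A$ to $\underline{\mathsf C}_{\Bbbk}$ are isomorphic (such $S$ is automatically unital); it is a Serre $A_\infty$-functor if moreover $S$ is an $A_\infty$-equivalence. The statement is asserted both for "right Serre" and for "Serre". *)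

theory Defs
  imports "HOL-Algebra.Module"
begin

section \<open>Signs, linear maps, complexes\<close>

text \<open>The ground ring is a \<^const>\<open>cring\<close> in the sense of HOL-Algebra (the zero ring is allowed), and a
  graded module is a family of HOL-Algebra modules indexed by \<^typ>\<open>int\<close>; only homogeneous elements
  are ever mentioned. Maps out of a tensor product are represented by multilinear functions.\<close>

definition sg :: "'k ring \<Rightarrow> int \<Rightarrow> 'k" where
  "sg R e = (if even e then \<one>\<^bsub>R\<^esub> else \<ominus>\<^bsub>R\<^esub> \<one>\<^bsub>R\<^esub>)"

definition sgm :: "('k, 'm) module \<Rightarrow> int \<Rightarrow> 'm \<Rightarrow> 'm" where
  "sgm M e x = (if even e then x else \<ominus>\<^bsub>M\<^esub> x)"

definition lsum :: "('k, 'm) module \<Rightarrow> 'm list \<Rightarrow> 'm" where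
  "lsum M xs = foldr (\<lambda>x y. x \<oplus>\<^bsub>M\<^esub> y) xs \<zero>\<^bsub>M\<^esub>"

definition linear_map :: "'k ring \<Rightarrow> ('k, 'm) module \<Rightarrow> ('k, 'n) module \<Rightarrow> ('m \<Rightarrow> 'n) \<Rightarrow> bool" where
  "linear_map R M N f \<longleftrightarrow>
     f \<in> carrier M \<rightarrow> carrier N \<and>
     (\<forall>x\<in>carrier M. \<forall>y\<in>carrier M. f (x \<oplus>\<^bsub>M\<^esub> y) = f x \<oplus>\<^bsub>N\<^esub> f y) \<and>
     (\<forall>a\<in>carrier R. \<forall>x\<in>carrier M. f (a \<odot>\<^bsub>M\<^esub> x) = a \<odot>\<^bsub>N\<^esub> f x)"

record ('k, 'm) cpx =
  gr :: "int \<Rightarrow> ('k, 'm) module"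
  dif :: "int \<Rightarrow> 'm \<Rightarrow> 'm"

definition is_complex :: "'k ring \<Rightarrow> ('k, 'm) cpx \<Rightarrow> bool" where
  "is_complex R M \<longleftrightarrow>
     (\<forall>n. module R (gr M n)) \<and>
     (\<forall>n. linear_map R (gr M n) (gr M (n + 1)) (dif M n)) \<and>
     (\<forall>n. \<forall>x\<in>carrier (gr M n). dif M (n + 1) (dif M n x) = \<zero>\<^bsub>gr M (n + 2)\<^esub>)"

definition unit_cpx :: "'k ring \<Rightarrow> ('k, 'k) cpx" where
  "unit_cpx R =
     \<lparr>gr = (\<lambda>n. \<lparr>carrier = (if n = 0 then carrier R else {\<zero>\<^bsub>R\<^esub>}),
                 monoid.mult = monoid.mult R, one = one R, zero = zero R, add = add R,
                 smult = monoid.mult R\<rparr>),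
      dif = (\<lambda>n x. \<zero>\<^bsub>R\<^esub>)\<rparr>"

text \<open>The complex of homogeneous maps: a map of degree \<open>n\<close> is a family of linear maps from
  degree \<open>i\<close> to degree \<open>i + n\<close>, made unique by requiring extensionality outside the carriers.\<close>

definition inner_hom :: "'k ring \<Rightarrow> ('k, 'm) cpx \<Rightarrow> ('k, 'n) cpx \<Rightarrow> ('k, int \<Rightarrow> 'm \<Rightarrow> 'n) cpx" where
  "inner_hom R M N =
     \<lparr>gr = (\<lambda>n.
        \<lparr>carrier = {f. \<forall>i. f i \<in> extensional (carrier (gr M i)) \<and>
                            linear_map R (gr M i) (gr N (i + n)) (f i)},
         monoid.mult = undefined, one = undefined,
         zero = (\<lambda>i. \<lambda>x\<in>carrier (gr M i). \<zero>\<^bsub>gr N (i + n)\<^esub>),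
         add = (\<lambda>f g i. \<lambda>x\<in>carrier (gr M i). f i x \<oplus>\<^bsub>gr N (i + n)\<^esub> g i x),
         smult = (\<lambda>a f i. \<lambda>x\<in>carrier (gr M i). a \<odot>\<^bsub>gr N (i + n)\<^esub> f i x)\<rparr>),
      dif = (\<lambda>n f i. \<lambda>x\<in>carrier (gr M i).
        dif N (i + n) (f i x) \<ominus>\<^bsub>gr N (i + n + 1)\<^esub>
          sgm (gr N (i + n + 1)) n (f (i + 1) (dif M i x)))\<rparr>"

text \<open>First \<open>f\<close>, of degree \<open>m\<close> and with source \<open>M\<close>, then \<open>g\<close>.\<close>

definition hcomp :: "('k, 'm) cpx \<Rightarrow> (int \<Rightarrow> 'm \<Rightarrow> 'n) \<Rightarrow> int \<Rightarrow> (int \<Rightarrow> 'n \<Rightarrow> 'p) \<Rightarrow> int \<Rightarrow> 'm \<Rightarrow> 'p" where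
  "hcomp M f m g = (\<lambda>i. \<lambda>x\<in>carrier (gr M i). g (i + m) (f i x))"


section \<open>The homotopy category of complexes\<close>

text \<open>A morphism from the tensor product of the complexes in the list \<open>Ms\<close> to \<open>P\<close> in the homotopy
  category is represented by a multilinear chain map. Its arguments are lists of homogeneous
  elements, each paired with its degree. Operators act on the right, so the differential
  applied in position \<open>i\<close> passes the arguments in the later positions.\<close>

type_synonym 'm hel = "int \<times> 'm"

definition hdeg :: "'m hel list \<Rightarrow> int" where
  "hdeg xs = (\<Sum>x\<leftarrow>xs. fst x)"

definition args_in :: "('k, 'm) cpx list \<Rightarrow> 'm hel list \<Rightarrow> bool" where
  "args_in Ms xs \<longleftrightarrow> list_all2 (\<lambda>M x. snd x \<in> carrier (gr M (fst x))) Ms xs"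

definition multilinear ::
  "'k ring \<Rightarrow> ('k, 'm) cpx list \<Rightarrow> ('k, 'p) cpx \<Rightarrow> int \<Rightarrow> ('m hel list \<Rightarrow> 'p) \<Rightarrow> bool" where
  "multilinear R Ms P e F \<longleftrightarrow>
     (\<forall>xs. args_in Ms xs \<longrightarrow>
        F xs \<in> carrier (gr P (hdeg xs + e)) \<and>
        (\<forall>i<length Ms. linear_map R (gr (Ms ! i) (fst (xs ! i))) (gr P (hdeg xs + e))
                         (\<lambda>x. F (xs[i := (fst (xs ! i), x)]))))"

definition after_dif ::
  "('k, 'm) cpx list \<Rightarrow> ('k, 'p) module \<Rightarrow> ('m hel list \<Rightarrow> 'p) \<Rightarrow> 'm hel list \<Rightarrow> 'p" where
  "after_dif Ms N F xs =
     lsum N (map (\<lambda>i. sgm N (hdeg (drop (Suc i) xs))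
                        (F (xs[i := (fst (xs ! i) + 1, dif (Ms ! i) (fst (xs ! i)) (snd (xs ! i)))])))
                 [0..<length Ms])"

definition K_mor ::
  "'k ring \<Rightarrow> ('k, 'm) cpx list \<Rightarrow> ('k, 'p) cpx \<Rightarrow> ('m hel list \<Rightarrow> 'p) \<Rightarrow> bool" where
  "K_mor R Ms P F \<longleftrightarrow>
     multilinear R Ms P 0 F \<and>
     (\<forall>xs. args_in Ms xs \<longrightarrow>
        dif P (hdeg xs) (F xs) = after_dif Ms (gr P (hdeg xs + 1)) F xs)"

definition K_eq ::
  "'k ring \<Rightarrow> ('k, 'm) cpx list \<Rightarrow> ('k, 'p) cpx \<Rightarrow> ('m hel list \<Rightarrow> 'p) \<Rightarrow> ('m hel list \<Rightarrow> 'p) \<Rightarrow> bool" where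
  "K_eq R Ms P F G \<longleftrightarrow>
     (\<exists>H. multilinear R Ms P (-1) H \<and>
        (\<forall>xs. args_in Ms xs \<longrightarrow>
           F xs \<ominus>\<^bsub>gr P (hdeg xs)\<^esub> G xs =
             dif P (hdeg xs - 1) (H xs) \<oplus>\<^bsub>gr P (hdeg xs)\<^esub> after_dif Ms (gr P (hdeg xs)) H xs))"

definition K_iso :: "'k ring \<Rightarrow> ('k, 'm) cpx \<Rightarrow> ('k, 'n) cpx \<Rightarrow> ('m hel \<Rightarrow> 'n) \<Rightarrow> bool" where
  "K_iso R M N F \<longleftrightarrow>
     K_mor R [M] N (\<lambda>xs. F (xs ! 0)) \<and>
     (\<exists>G. K_mor R [N] M (\<lambda>ys. G (ys ! 0)) \<and>
        K_eq R [M] M (\<lambda>xs. G (fst (xs ! 0), F (xs ! 0))) (\<lambda>xs. snd (xs ! 0)) \<and>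
        K_eq R [N] N (\<lambda>ys. F (fst (ys ! 0), G (ys ! 0))) (\<lambda>ys. snd (ys ! 0)))"

definition cycle :: "('k, 'm) cpx \<Rightarrow> int \<Rightarrow> 'm \<Rightarrow> bool" where
  "cycle M n x \<longleftrightarrow> x \<in> carrier (gr M n) \<and> dif M n x = \<zero>\<^bsub>gr M (n + 1)\<^esub>"

definition homologous :: "('k, 'm) cpx \<Rightarrow> int \<Rightarrow> 'm \<Rightarrow> 'm \<Rightarrow> bool" where
  "homologous M n x y \<longleftrightarrow> (\<exists>z\<in>carrier (gr M (n - 1)). x \<ominus>\<^bsub>gr M n\<^esub> y = dif M (n - 1) z)"


section \<open>Categories enriched in the homotopy category\<close>

text \<open>Compositions and actions on morphisms are stored as representatives of their homotopy
  classes. A morphism from the unit complex is determined up to homotopy by the homology class of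
  the image of \<open>1\<close>, so units (and components of natural transformations) are given by cycles
  of degree \<open>0\<close>.\<close>

record ('k, 'o, 'h) Kcat =
  Kobj :: "'o set"
  Khom :: "'o \<Rightarrow> 'o \<Rightarrow> ('k, 'h) cpx"
  Kcomp :: "'o \<Rightarrow> 'o \<Rightarrow> 'o \<Rightarrow> 'h hel \<Rightarrow> 'h hel \<Rightarrow> 'h"
  Kunit :: "'o \<Rightarrow> 'h"

definition K_category :: "'k ring \<Rightarrow> ('k, 'o, 'h) Kcat \<Rightarrow> bool" where
  "K_category R C \<longleftrightarrow>
     (\<forall>X\<in>Kobj C. \<forall>Y\<in>Kobj C. is_complex R (Khom C X Y)) \<and>
     (\<forall>X\<in>Kobj C. cycle (Khom C X X) 0 (Kunit C X)) \<and>
     (\<forall>X\<in>Kobj C. \<forall>Y\<in>Kobj C. \<forall>Z\<in>Kobj C.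
        K_mor R [Khom C X Y, Khom C Y Z] (Khom C X Z) (\<lambda>xs. Kcomp C X Y Z (xs ! 0) (xs ! 1))) \<and>
     (\<forall>X\<in>Kobj C. \<forall>Y\<in>Kobj C. \<forall>Z\<in>Kobj C. \<forall>W\<in>Kobj C.
        K_eq R [Khom C X Y, Khom C Y Z, Khom C Z W] (Khom C X W)
          (\<lambda>xs. Kcomp C X Z W (fst (xs ! 0) + fst (xs ! 1), Kcomp C X Y Z (xs ! 0) (xs ! 1)) (xs ! 2))
          (\<lambda>xs. Kcomp C X Y W (xs ! 0) (fst (xs ! 1) + fst (xs ! 2), Kcomp C Y Z W (xs ! 1) (xs ! 2)))) \<and>
     (\<forall>X\<in>Kobj C. \<forall>Y\<in>Kobj C.
        K_eq R [Khom C X Y] (Khom C X Y) (\<lambda>xs. Kcomp C X X Y (0, Kunit C X) (xs ! 0)) (\<lambda>xs. snd (xs ! 0)) \<and>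
        K_eq R [Khom C X Y] (Khom C X Y) (\<lambda>xs. Kcomp C X Y Y (xs ! 0) (0, Kunit C Y)) (\<lambda>xs. snd (xs ! 0)))"

record ('o, 'h, 'p, 'g) Kfun =
  Kob :: "'o \<Rightarrow> 'p"
  Kmap :: "'o \<Rightarrow> 'o \<Rightarrow> 'h hel \<Rightarrow> 'g"

definition K_functor ::
  "'k ring \<Rightarrow> ('k, 'o, 'h) Kcat \<Rightarrow> ('k, 'p, 'g) Kcat \<Rightarrow> ('o, 'h, 'p, 'g) Kfun \<Rightarrow> bool" where
  "K_functor R C E F \<longleftrightarrow>
     K_category R C \<and> K_category R E \<and>
     (\<forall>X\<in>Kobj C. Kob F X \<in> Kobj E) \<and>
     (\<forall>X\<in>Kobj C. \<forall>Y\<in>Kobj C.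
        K_mor R [Khom C X Y] (Khom E (Kob F X) (Kob F Y)) (\<lambda>xs. Kmap F X Y (xs ! 0))) \<and>
     (\<forall>X\<in>Kobj C. \<forall>Y\<in>Kobj C. \<forall>Z\<in>Kobj C.
        K_eq R [Khom C X Y, Khom C Y Z] (Khom E (Kob F X) (Kob F Z))
          (\<lambda>xs. Kmap F X Z (fst (xs ! 0) + fst (xs ! 1), Kcomp C X Y Z (xs ! 0) (xs ! 1)))
          (\<lambda>xs. Kcomp E (Kob F X) (Kob F Y) (Kob F Z)
                  (fst (xs ! 0), Kmap F X Y (xs ! 0)) (fst (xs ! 1), Kmap F Y Z (xs ! 1)))) \<and>
     (\<forall>X\<in>Kobj C. homologous (Khom E (Kob F X) (Kob F X)) 0
                    (Kmap F X X (0, Kunit C X)) (Kunit E (Kob F X)))"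

definition K_id :: "('o, 'h, 'o, 'h) Kfun" where
  "K_id = \<lparr>Kob = (\<lambda>X. X), Kmap = (\<lambda>X Y x. snd x)\<rparr>"

definition K_fcomp :: "('o, 'h, 'p, 'g) Kfun \<Rightarrow> ('p, 'g, 'q, 'l) Kfun \<Rightarrow> ('o, 'h, 'q, 'l) Kfun" where
  "K_fcomp F G =
     \<lparr>Kob = (\<lambda>X. Kob G (Kob F X)),
      Kmap = (\<lambda>X Y x. Kmap G (Kob F X) (Kob F Y) (fst x, Kmap F X Y x))\<rparr>"

definition K_invertible :: "('k, 'o, 'h) Kcat \<Rightarrow> 'o \<Rightarrow> 'o \<Rightarrow> 'h \<Rightarrow> bool" where
  "K_invertible C X Y t \<longleftrightarrow>
     cycle (Khom C X Y) 0 t \<and>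
     (\<exists>u. cycle (Khom C Y X) 0 u \<and>
        homologous (Khom C X X) 0 (Kcomp C X Y X (0, t) (0, u)) (Kunit C X) \<and>
        homologous (Khom C Y Y) 0 (Kcomp C Y X Y (0, u) (0, t)) (Kunit C Y))"

definition K_functor_iso ::
  "'k ring \<Rightarrow> ('k, 'o, 'h) Kcat \<Rightarrow> ('k, 'p, 'g) Kcat \<Rightarrow>
   ('o, 'h, 'p, 'g) Kfun \<Rightarrow> ('o, 'h, 'p, 'g) Kfun \<Rightarrow> bool" where
  "K_functor_iso R C E F G \<longleftrightarrow>
     (\<exists>t. (\<forall>X\<in>Kobj C. K_invertible E (Kob F X) (Kob G X) (t X)) \<and>
        (\<forall>X\<in>Kobj C. \<forall>Y\<in>Kobj C.
           K_eq R [Khom C X Y] (Khom E (Kob F X) (Kob G Y))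
             (\<lambda>xs. Kcomp E (Kob F X) (Kob F Y) (Kob G Y) (fst (xs ! 0), Kmap F X Y (xs ! 0)) (0, t Y))
             (\<lambda>xs. Kcomp E (Kob F X) (Kob G X) (Kob G Y) (0, t X) (fst (xs ! 0), Kmap G X Y (xs ! 0)))))"

definition K_equivalence ::
  "'k ring \<Rightarrow> ('k, 'o, 'h) Kcat \<Rightarrow> ('k, 'p, 'g) Kcat \<Rightarrow> ('o, 'h, 'p, 'g) Kfun \<Rightarrow> bool" where
  "K_equivalence R C E F \<longleftrightarrow>
     K_functor R C E F \<and>
     (\<exists>G. K_functor R E C G \<and>
        K_functor_iso R C C (K_fcomp F G) K_id \<and>
        K_functor_iso R E E (K_fcomp G F) K_id)"

abbreviation dual :: "'k ring \<Rightarrow> ('k, 'm) cpx \<Rightarrow> ('k, int \<Rightarrow> 'm \<Rightarrow> 'k) cpx" where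
  "dual R M \<equiv> inner_hom R M (unit_cpx R)"

text \<open>The actions of \<open>u : X' \<rightarrow> X\<close> and \<open>v : Y \<rightarrow> Z\<close> on \<open>\<phi> \<in> dual (C(Y,X))\<close>. The first is adjoint
  to \<open>p \<otimes> u \<otimes> \<phi> \<mapsto> (pu)\<phi>\<close> for \<open>p \<in> C(Y,X')\<close>. The second is adjoint to
  \<open>p \<otimes> \<phi> \<otimes> v \<mapsto> (vp)\<phi>\<close> for \<open>p \<in> C(Z,X)\<close>, where \<open>v\<close> is moved to the front past \<open>p\<close> and \<open>\<phi>\<close>.\<close>

definition dual_act_X ::
  "('k, 'o, 'h) Kcat \<Rightarrow> 'o \<Rightarrow> 'o \<Rightarrow> 'o \<Rightarrow> 'h hel \<Rightarrow> (int \<Rightarrow> 'h \<Rightarrow> 'k) hel \<Rightarrow> int \<Rightarrow> 'h \<Rightarrow> 'k" where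
  "dual_act_X C Y X' X u \<phi> =
     (\<lambda>i. \<lambda>p\<in>carrier (gr (Khom C Y X') i). snd \<phi> (i + fst u) (Kcomp C Y X' X (i, p) u))"

definition dual_act_Y ::
  "'k ring \<Rightarrow> ('k, 'o, 'h) Kcat \<Rightarrow> 'o \<Rightarrow> 'o \<Rightarrow> 'o \<Rightarrow> (int \<Rightarrow> 'h \<Rightarrow> 'k) hel \<Rightarrow> 'h hel \<Rightarrow> int \<Rightarrow> 'h \<Rightarrow> 'k" where
  "dual_act_Y R C X Y Z \<phi> v =
     (\<lambda>i. \<lambda>p\<in>carrier (gr (Khom C Z X) i).
        sg R (fst v * (i + fst \<phi>)) \<otimes>\<^bsub>R\<^esub> snd \<phi> (i + fst v) (Kcomp C Y Z X v (i, p)))"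

definition right_Serre_K_functor ::
  "'k ring \<Rightarrow> ('k, 'o, 'h) Kcat \<Rightarrow> ('o, 'h, 'o, 'h) Kfun \<Rightarrow> bool" where
  "right_Serre_K_functor R C S \<longleftrightarrow>
     K_functor R C C S \<and>
     (\<exists>\<psi>.
        (\<forall>X\<in>Kobj C. \<forall>Y\<in>Kobj C. K_iso R (Khom C X (Kob S Y)) (dual R (Khom C Y X)) (\<psi> X Y)) \<and>
        (\<forall>X'\<in>Kobj C. \<forall>X\<in>Kobj C. \<forall>Y\<in>Kobj C.
           K_eq R [Khom C X' X, Khom C X (Kob S Y)] (dual R (Khom C Y X'))
             (\<lambda>xs. \<psi> X' Y (fst (xs ! 0) + fst (xs ! 1), Kcomp C X' X (Kob S Y) (xs ! 0) (xs ! 1)))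
             (\<lambda>xs. dual_act_X C Y X' X (xs ! 0) (fst (xs ! 1), \<psi> X Y (xs ! 1)))) \<and>
        (\<forall>X\<in>Kobj C. \<forall>Y\<in>Kobj C. \<forall>Z\<in>Kobj C.
           K_eq R [Khom C X (Kob S Y), Khom C Y Z] (dual R (Khom C Z X))
             (\<lambda>xs. \<psi> X Z (fst (xs ! 0) + fst (xs ! 1),
                      Kcomp C X (Kob S Y) (Kob S Z) (xs ! 0) (fst (xs ! 1), Kmap S Y Z (xs ! 1))))
             (\<lambda>xs. dual_act_Y R C X Y Z (fst (xs ! 0), \<psi> X Y (xs ! 0)) (xs ! 1))))"

definition Serre_K_functor ::
  "'k ring \<Rightarrow> ('k, 'o, 'h) Kcat \<Rightarrow> ('o, 'h, 'o, 'h) Kfun \<Rightarrow> bool" where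
  "Serre_K_functor R C S \<longleftrightarrow> right_Serre_K_functor R C S \<and> K_equivalence R C C S"


section \<open>The tensor coalgebra of a graded quiver\<close>

text \<open>A path \<open>(X\<^sub>0, [(X\<^sub>1, d\<^sub>1, x\<^sub>1), \<dots>, (X\<^sub>n, d\<^sub>n, x\<^sub>n)])\<close> stands for the element
  \<open>x\<^sub>1 \<otimes> \<dots> \<otimes> x\<^sub>n\<close> of \<open>T\<^sup>n s\<A>(X\<^sub>0, X\<^sub>n)\<close>, where \<open>x\<^sub>i \<in> s\<A>(X\<^bsub>i-1\<^esub>, X\<^sub>i)\<close> has degree \<open>d\<^sub>i\<close>, that is,
  \<open>x\<^sub>i\<close> lies in degree \<open>d\<^sub>i + 1\<close> of \<open>\<A>(X\<^bsub>i-1\<^esub>, X\<^sub>i)\<close>. All degrees in paths are degrees in \<open>s\<A>\<close>, and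
  \<open>s\<close> is the identity on elements. A list of paths stands for an element of the external tensor
  product of several tensor coalgebras.\<close>

type_synonym ('o, 'h) path = "'o \<times> ('o \<times> int \<times> 'h) list"

record ('k, 'o, 'h) ainf =
  obj :: "'o set"
  mor :: "'o \<Rightarrow> 'o \<Rightarrow> int \<Rightarrow> ('k, 'h) module"
  bmap :: "('o, 'h) path \<Rightarrow> 'h"

fun end_of :: "'o \<Rightarrow> ('o \<times> int \<times> 'h) list \<Rightarrow> 'o" where
  "end_of X [] = X"
| "end_of X ((Y, d, x) # w) = end_of Y w"

definition ptgt :: "('o, 'h) path \<Rightarrow> 'o" where
  "ptgt p = end_of (fst p) (snd p)"

definition wdeg :: "('o \<times> int \<times> 'h) list \<Rightarrow> int" where
  "wdeg w = (\<Sum>l\<leftarrow>w. fst (snd l))"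

definition pdeg :: "('o, 'h) path \<Rightarrow> int" where
  "pdeg p = wdeg (snd p)"

definition tdeg :: "('o, 'h) path list \<Rightarrow> int" where
  "tdeg ws = (\<Sum>p\<leftarrow>ws. pdeg p)"

definition tlen :: "('o, 'h) path list \<Rightarrow> nat" where
  "tlen ws = (\<Sum>p\<leftarrow>ws. length (snd p))"

fun composable :: "('k, 'o, 'h) ainf \<Rightarrow> 'o \<Rightarrow> ('o \<times> int \<times> 'h) list \<Rightarrow> bool" where
  "composable A X [] \<longleftrightarrow> X \<in> obj A"
| "composable A X ((Y, d, x) # w) \<longleftrightarrow>
     X \<in> obj A \<and> x \<in> carrier (mor A X Y (d + 1)) \<and> composable A Y w"

definition is_path :: "('k, 'o, 'h) ainf \<Rightarrow> ('o, 'h) path \<Rightarrow> bool" where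
  "is_path A p \<longleftrightarrow> composable A (fst p) (snd p)"

definition is_tuple :: "('k, 'o, 'h) ainf list \<Rightarrow> ('o, 'h) path list \<Rightarrow> bool" where
  "is_tuple As ws \<longleftrightarrow> list_all2 is_path As ws"

text \<open>Elements of the tensor coalgebra are represented by formal linear combinations of paths.
  Two of them represent the same element iff they are related by the congruence generated by
  the module axioms for the coefficients and multilinearity of the tensor product.\<close>

type_synonym ('k, 'o, 'h) fsum = "('k \<times> ('o, 'h) path) list"

definition is_fsum :: "'k ring \<Rightarrow> ('k, 'o, 'h) ainf \<Rightarrow> ('k, 'o, 'h) fsum \<Rightarrow> bool" where
  "is_fsum R A L \<longleftrightarrow> (\<forall>(c, p)\<in>set L. c \<in> carrier R \<and> is_path A p)"

inductive tensor_eq ::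
  "'k ring \<Rightarrow> ('k, 'o, 'h) ainf \<Rightarrow> ('k, 'o, 'h) fsum \<Rightarrow> ('k, 'o, 'h) fsum \<Rightarrow> bool"
  for R A where
  refl: "is_fsum R A L \<Longrightarrow> tensor_eq R A L L"
| sym: "tensor_eq R A L M \<Longrightarrow> tensor_eq R A M L"
| trans: "tensor_eq R A L M \<Longrightarrow> tensor_eq R A M N \<Longrightarrow> tensor_eq R A L N"
| append: "tensor_eq R A L L' \<Longrightarrow> tensor_eq R A M M' \<Longrightarrow> tensor_eq R A (L @ M) (L' @ M')"
| commute: "is_fsum R A L \<Longrightarrow> is_fsum R A M \<Longrightarrow> tensor_eq R A (L @ M) (M @ L)"
| coeff_zero: "is_path A p \<Longrightarrow> tensor_eq R A [(\<zero>\<^bsub>R\<^esub>, p)] []"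
| coeff_add: "c \<in> carrier R \<Longrightarrow> d \<in> carrier R \<Longrightarrow> is_path A p \<Longrightarrow>
    tensor_eq R A [(c \<oplus>\<^bsub>R\<^esub> d, p)] [(c, p), (d, p)]"
| add: "c \<in> carrier R \<Longrightarrow>
    is_path A (X, u @ (Y, d, x) # v) \<Longrightarrow> is_path A (X, u @ (Y, d, y) # v) \<Longrightarrow>
    tensor_eq R A [(c, (X, u @ (Y, d, x \<oplus>\<^bsub>mor A (end_of X u) Y (d + 1)\<^esub> y) # v))]
      [(c, (X, u @ (Y, d, x) # v)), (c, (X, u @ (Y, d, y) # v))]"
| smult: "c \<in> carrier R \<Longrightarrow> a \<in> carrier R \<Longrightarrow> is_path A (X, u @ (Y, d, x) # v) \<Longrightarrow>
    tensor_eq R A [(c, (X, u @ (Y, d, a \<odot>\<^bsub>mor A (end_of X u) Y (d + 1)\<^esub> x) # v))]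
      [(c \<otimes>\<^bsub>R\<^esub> a, (X, u @ (Y, d, x) # v))]"

definition lin_ext :: "'k ring \<Rightarrow> ('a \<Rightarrow> ('k \<times> 'b) list) \<Rightarrow> ('k \<times> 'a) list \<Rightarrow> ('k \<times> 'b) list" where
  "lin_ext R F L = [(c \<otimes>\<^bsub>R\<^esub> c', q). (c, p) \<leftarrow> L, (c', q) \<leftarrow> F p]"

text \<open>The cut comultiplication of the external tensor product of tensor coalgebras: the second
  half of each factor passes the first halves of all later factors. The integer is the
  exponent of the sign. \<open>tblocks m\<close> is the \<open>m\<close>-fold iterate.\<close>

definition pcuts :: "('o, 'h) path \<Rightarrow> (('o, 'h) path \<times> ('o, 'h) path) list" where
  "pcuts p = map (\<lambda>k. ((fst p, take k (snd p)), (end_of (fst p) (take k (snd p)), drop k (snd p))))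
                 [0..<Suc (length (snd p))]"

fun tcuts :: "('o, 'h) path list \<Rightarrow> (int \<times> ('o, 'h) path list \<times> ('o, 'h) path list) list" where
  "tcuts [] = [(0, [], [])]"
| "tcuts (w # ws) =
     [(e + pdeg v * tdeg us, u # us, v # vs). (u, v) \<leftarrow> pcuts w, (e, us, vs) \<leftarrow> tcuts ws]"

fun tblocks :: "nat \<Rightarrow> ('o, 'h) path list \<Rightarrow> (int \<times> ('o, 'h) path list list) list" where
  "tblocks 0 ws = (if tlen ws = 0 then [(0, [])] else [])"
| "tblocks (Suc m) ws = [(e + e', us # bs). (e, us, vs) \<leftarrow> tcuts ws, (e', bs) \<leftarrow> tblocks m vs]"


section \<open>A-infinity categories\<close>

text \<open>A family of multilinear maps of degree \<open>e\<close> from the components of the external tensor product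
  of the tensor coalgebras of \<open>As\<close> to \<open>s\<B>\<close>, over the object maps \<open>\<phi>\<close> (sources) and \<open>\<chi>\<close> (targets).\<close>

definition components ::
  "'k ring \<Rightarrow> ('k, 'o, 'h) ainf list \<Rightarrow> ('k, 'p, 'g) ainf \<Rightarrow> ('o list \<Rightarrow> 'p) \<Rightarrow> ('o list \<Rightarrow> 'p) \<Rightarrow>
   int \<Rightarrow> (('o, 'h) path list \<Rightarrow> 'g) \<Rightarrow> bool" where
  "components R As B \<phi> \<chi> e F \<longleftrightarrow>
     (\<forall>ws. is_tuple As ws \<longrightarrow>
        F ws \<in> carrier (mor B (\<phi> (map fst ws)) (\<chi> (map ptgt ws)) (tdeg ws + e + 1)) \<and>
        (\<forall>i X u Y d x v. i < length ws \<longrightarrow> ws ! i = (X, u @ (Y, d, x) # v) \<longrightarrow>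
           linear_map R (mor (As ! i) (end_of X u) Y (d + 1))
             (mor B (\<phi> (map fst ws)) (\<chi> (map ptgt ws)) (tdeg ws + e + 1))
             (\<lambda>y. F (ws[i := (X, u @ (Y, d, y) # v)]))))"

text \<open>The coderivation induced by the \<open>b\<^sub>n\<close>, i.e. the sum of all \<open>1\<^sup>r \<otimes> b\<^sub>n \<otimes> 1\<^sup>t\<close> with \<open>n \<ge> 1\<close>, and the
  differential which it induces on an external tensor product.\<close>

definition bhat :: "'k ring \<Rightarrow> ('k, 'o, 'h) ainf \<Rightarrow> ('o, 'h) path \<Rightarrow> ('k, 'o, 'h) fsum" where
  "bhat R A p =
     (let X = fst p; w = snd p in
      [(sg R (wdeg (drop (r + n) w)),
        (X, take r w @
            (end_of X (take (r + n) w), wdeg (take n (drop r w)) + 1,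
             bmap A (end_of X (take r w), take n (drop r w))) #
            drop (r + n) w)).
       r \<leftarrow> [0..<length w], n \<leftarrow> [1..<Suc (length w - r)]])"

definition tbhat ::
  "'k ring \<Rightarrow> ('k, 'o, 'h) ainf list \<Rightarrow> ('o, 'h) path list \<Rightarrow> ('k \<times> ('o, 'h) path list) list" where
  "tbhat R As ws =
     [(sg R (tdeg (drop (Suc i) ws)) \<otimes>\<^bsub>R\<^esub> c, ws[i := p]).
      i \<leftarrow> [0..<length ws], (c, p) \<leftarrow> bhat R (As ! i) (ws ! i)]"

text \<open>There is no \<open>b\<^sub>0\<close>; by convention \<open>bmap\<close> is zero on paths of length zero.\<close>

definition ainf_category :: "'k ring \<Rightarrow> ('k, 'o, 'h) ainf \<Rightarrow> bool" where
  "ainf_category R A \<longleftrightarrow>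
     (\<forall>X\<in>obj A. \<forall>Y\<in>obj A. \<forall>n. module R (mor A X Y n)) \<and>
     components R [A] A hd hd 1 (\<lambda>ws. bmap A (hd ws)) \<and>
     (\<forall>X\<in>obj A. bmap A (X, []) = \<zero>\<^bsub>mor A X X 2\<^esub>) \<and>
     (\<forall>p. is_path A p \<longrightarrow> tensor_eq R A (lin_ext R (bhat R A) (bhat R A p)) [])"

text \<open>The complex \<open>(\<A>(X,Y), m\<^sub>1)\<close>; since \<open>m\<^sub>1 = s b\<^sub>1 s\<^sup>-\<^sup>1\<close>, no sign occurs.\<close>

definition mor_cpx :: "('k, 'o, 'h) ainf \<Rightarrow> 'o \<Rightarrow> 'o \<Rightarrow> ('k, 'h) cpx" where
  "mor_cpx A X Y = \<lparr>gr = mor A X Y, dif = (\<lambda>n x. bmap A (X, [(Y, n - 1, x)]))\<rparr>"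

text \<open>By the sign rule \<open>m\<^sub>2 = (s \<otimes> s) b\<^sub>2 s\<^sup>-\<^sup>1\<close> sends \<open>x \<otimes> y\<close> to \<open>b\<^sub>2(x, y)\<close> times the sign of the
  degree of \<open>y\<close> in \<open>\<A>\<close>.\<close>

definition m2 :: "('k, 'o, 'h) ainf \<Rightarrow> 'o \<Rightarrow> 'o \<Rightarrow> 'o \<Rightarrow> 'h hel \<Rightarrow> 'h hel \<Rightarrow> 'h" where
  "m2 A X Y Z x y =
     sgm (mor A X Z (fst x + fst y)) (fst y)
       (bmap A (X, [(Y, fst x - 1, snd x), (Z, fst y - 1, snd y)]))"

text \<open>Applied to an element \<open>x\<close> of degree \<open>d\<close> in \<open>s\<A>\<close>, the map \<open>\<i> \<otimes> 1\<close> yields \<open>\<i> \<otimes> x\<close> with the sign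
  of \<open>d\<close>. Here \<open>n = d + 1\<close> is the degree in \<open>\<A>\<close>; homotopies of maps of \<open>(s\<A>(X,Y), b\<^sub>1)\<close> and of
  \<open>(\<A>(X,Y), m\<^sub>1)\<close> are the same.\<close>

definition is_unit :: "'k ring \<Rightarrow> ('k, 'o, 'h) ainf \<Rightarrow> 'o \<Rightarrow> 'h \<Rightarrow> bool" where
  "is_unit R A X \<i> \<longleftrightarrow>
     \<i> \<in> carrier (mor A X X 0) \<and>
     bmap A (X, [(X, -1, \<i>)]) = \<zero>\<^bsub>mor A X X 1\<^esub> \<and>
     (\<forall>W\<in>obj A.
        K_eq R [mor_cpx A W X] (mor_cpx A W X)
          (\<lambda>xs. bmap A (W, [(X, fst (xs ! 0) - 1, snd (xs ! 0)), (X, -1, \<i>)]))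
          (\<lambda>xs. snd (xs ! 0))) \<and>
     (\<forall>Y\<in>obj A.
        K_eq R [mor_cpx A X Y] (mor_cpx A X Y)
          (\<lambda>xs. \<ominus>\<^bsub>mor A X Y (fst (xs ! 0))\<^esub>
                  sgm (mor A X Y (fst (xs ! 0))) (fst (xs ! 0) - 1)
                    (bmap A (X, [(X, -1, \<i>), (Y, fst (xs ! 0) - 1, snd (xs ! 0))])))
          (\<lambda>xs. snd (xs ! 0)))"

definition unital :: "'k ring \<Rightarrow> ('k, 'o, 'h) ainf \<Rightarrow> bool" where
  "unital R A \<longleftrightarrow> ainf_category R A \<and> (\<forall>X\<in>obj A. \<exists>\<i>. is_unit R A X \<i>)"

text \<open>A unit is unique up to a boundary, so the choice made here is immaterial.\<close>

definition kcat :: "'k ring \<Rightarrow> ('k, 'o, 'h) ainf \<Rightarrow> ('k, 'o, 'h) Kcat" where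
  "kcat R A =
     \<lparr>Kobj = obj A, Khom = mor_cpx A, Kcomp = m2 A, Kunit = (\<lambda>X. SOME \<i>. is_unit R A X \<i>)\<rparr>"


section \<open>A-infinity functors and transformations\<close>

text \<open>A coalgebra homomorphism \<open>f\<close> with \<open>f\<^bsub>0\<dots>0\<^esub> = 0\<close> is determined by its components, and every
  family of components of degree \<open>0\<close> arises: \<open>fhat\<close> is the homomorphism, the sum over \<open>m\<close> of the
  \<open>m\<close>-fold iterated comultiplication followed by the \<open>m\<close>-th tensor power of the components.
  Similarly, an \<open>(f,g)\<close>-coderivation \<open>r\<close> of degree \<open>e\<close> is determined by its components, being the
  twofold comultiplication followed by \<open>f \<otimes> r \<otimes> g\<close>, where \<open>r\<close> on the right-hand side denotes
  the components.\<close>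

record ('o, 'h, 'p, 'g) afun =
  fob :: "'o list \<Rightarrow> 'p"
  fcomp :: "('o, 'h) path list \<Rightarrow> 'g"

definition fhat ::
  "'k ring \<Rightarrow> ('o, 'h, 'p, 'g) afun \<Rightarrow> ('o, 'h) path list \<Rightarrow> ('k, 'p, 'g) fsum" where
  "fhat R f ws =
     [(sg R e, (fob f (map fst ws), map (\<lambda>vs. (fob f (map ptgt vs), tdeg vs, fcomp f vs)) bs)).
      m \<leftarrow> [0..<Suc (tlen ws)], (e, bs) \<leftarrow> tblocks m ws, list_all (\<lambda>vs. tlen vs \<noteq> 0) bs]"

definition rhat ::
  "'k ring \<Rightarrow> ('o, 'h, 'p, 'g) afun \<Rightarrow> ('o, 'h, 'p, 'g) afun \<Rightarrow> int \<Rightarrow> (('o, 'h) path list \<Rightarrow> 'g) \<Rightarrow>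
   ('o, 'h) path list \<Rightarrow> ('k, 'p, 'g) fsum" where
  "rhat R f g e r ws =
     [(sg R (e1 + e2 + e * tdeg zs) \<otimes>\<^bsub>R\<^esub> (c \<otimes>\<^bsub>R\<^esub> c'),
       (fst p, snd p @ (fob g (map ptgt vs), tdeg vs + e, r vs) # snd q)).
      (e1, us, ts) \<leftarrow> tcuts ws, (e2, vs, zs) \<leftarrow> tcuts ts,
      (c, p) \<leftarrow> fhat R f us, (c', q) \<leftarrow> fhat R g zs]"

definition is_objs :: "('k, 'o, 'h) ainf list \<Rightarrow> 'o list \<Rightarrow> bool" where
  "is_objs As Xs \<longleftrightarrow> list_all2 (\<lambda>A X. X \<in> obj A) As Xs"

definition ainf_functor ::
  "'k ring \<Rightarrow> ('k, 'o, 'h) ainf list \<Rightarrow> ('k, 'p, 'g) ainf \<Rightarrow> ('o, 'h, 'p, 'g) afun \<Rightarrow> bool" where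
  "ainf_functor R As B f \<longleftrightarrow>
     (\<forall>Xs. is_objs As Xs \<longrightarrow> fob f Xs \<in> obj B) \<and>
     components R As B (fob f) (fob f) 0 (fcomp f) \<and>
     (\<forall>Xs. is_objs As Xs \<longrightarrow>
        fcomp f (map (\<lambda>X. (X, [])) Xs) = \<zero>\<^bsub>mor B (fob f Xs) (fob f Xs) 1\<^esub>) \<and>
     (\<forall>ws. is_tuple As ws \<longrightarrow>
        tensor_eq R B (lin_ext R (bhat R B) (fhat R f ws)) (lin_ext R (fhat R f) (tbhat R As ws)))"

text \<open>The value of \<open>r B\<^sub>1 = r b - (-1)\<^sup>e b r\<close>, where \<open>e\<close> is the degree of \<open>r\<close>.\<close>

definition B1 ::
  "'k ring \<Rightarrow> ('k, 'o, 'h) ainf list \<Rightarrow> ('k, 'p, 'g) ainf \<Rightarrow> ('o, 'h, 'p, 'g) afun \<Rightarrow>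
   ('o, 'h, 'p, 'g) afun \<Rightarrow> int \<Rightarrow> (('o, 'h) path list \<Rightarrow> 'g) \<Rightarrow> ('o, 'h) path list \<Rightarrow>
   ('k, 'p, 'g) fsum" where
  "B1 R As B f g e r ws =
     lin_ext R (bhat R B) (rhat R f g e r ws) @
     [(sg R (e + 1) \<otimes>\<^bsub>R\<^esub> c, p). (c, p) \<leftarrow> lin_ext R (rhat R f g e r) (tbhat R As ws)]"

definition natural_transformation ::
  "'k ring \<Rightarrow> ('k, 'o, 'h) ainf list \<Rightarrow> ('k, 'p, 'g) ainf \<Rightarrow> ('o, 'h, 'p, 'g) afun \<Rightarrow>
   ('o, 'h, 'p, 'g) afun \<Rightarrow> (('o, 'h) path list \<Rightarrow> 'g) \<Rightarrow> bool" where
  "natural_transformation R As B f g r \<longleftrightarrow>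
     components R As B (fob f) (fob g) (-1) r \<and>
     (\<forall>ws. is_tuple As ws \<longrightarrow> tensor_eq R B (B1 R As B f g (-1) r ws) [])"

definition isomorphic ::
  "'k ring \<Rightarrow> ('k, 'o, 'h) ainf list \<Rightarrow> ('k, 'p, 'g) ainf \<Rightarrow> ('o, 'h, 'p, 'g) afun \<Rightarrow>
   ('o, 'h, 'p, 'g) afun \<Rightarrow> bool" where
  "isomorphic R As B f g \<longleftrightarrow>
     (\<exists>r. natural_transformation R As B f g r \<and>
        (\<forall>Xs. is_objs As Xs \<longrightarrow>
           K_invertible (kcat R B) (fob f Xs) (fob g Xs) (r (map (\<lambda>X. (X, [])) Xs))))"

definition afun_id :: "('k, 'o, 'h) ainf \<Rightarrow> ('o, 'h, 'o, 'h) afun" where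
  "afun_id A =
     \<lparr>fob = hd,
      fcomp = (\<lambda>ws. case ws of
          [(X, [(Y, d, x)])] \<Rightarrow> x
        | _ \<Rightarrow> \<zero>\<^bsub>mor A (hd (map fst ws)) (hd (map ptgt ws)) (tdeg ws + 1)\<^esub>)\<rparr>"

text \<open>Components of the composites \<open>f \<cdot> g : (A\<^sub>i) \<rightarrow> B \<rightarrow> C\<close> and \<open>(f\<^sub>1, \<dots>, f\<^sub>n) \<cdot> g : (A\<^sub>i) \<rightarrow> (B\<^sub>i) \<rightarrow> C\<close>
  of coalgebra homomorphisms.\<close>

definition afun_comp ::
  "'k ring \<Rightarrow> ('k, 'q, 'l) ainf \<Rightarrow> ('o, 'h, 'p, 'g) afun \<Rightarrow> ('p, 'g, 'q, 'l) afun \<Rightarrow>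
   ('o, 'h, 'q, 'l) afun" where
  "afun_comp R C f g =
     (let ob = (\<lambda>Xs. fob g [fob f Xs]) in
      \<lparr>fob = ob,
       fcomp = (\<lambda>ws. let M = mor C (ob (map fst ws)) (ob (map ptgt ws)) (tdeg ws + 1) in
                 lsum M [c \<odot>\<^bsub>M\<^esub> fcomp g [p]. (c, p) \<leftarrow> fhat R f ws])\<rparr>)"

definition afun_tuple_comp ::
  "'k ring \<Rightarrow> ('k, 'q, 'l) ainf \<Rightarrow> ('o, 'h, 'p, 'g) afun list \<Rightarrow> ('p, 'g, 'q, 'l) afun \<Rightarrow>
   ('o, 'h, 'q, 'l) afun" where
  "afun_tuple_comp R C fs g =
     (let ob = (\<lambda>Xs. fob g (map2 (\<lambda>f X. fob f [X]) fs Xs)) in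
      \<lparr>fob = ob,
       fcomp = (\<lambda>ws. let M = mor C (ob (map fst ws)) (ob (map ptgt ws)) (tdeg ws + 1) in
                 lsum M [foldr (\<lambda>t a. fst t \<otimes>\<^bsub>R\<^esub> a) ts \<one>\<^bsub>R\<^esub> \<odot>\<^bsub>M\<^esub> fcomp g (map snd ts).
                         ts \<leftarrow> product_lists (map2 (\<lambda>f w. fhat R f [w]) fs ws)])\<rparr>)"

text \<open>\<open>s f\<^sub>1 s\<^sup>-\<^sup>1\<close> carries no sign because \<open>f\<^sub>1\<close> has degree \<open>0\<close>.\<close>

definition kfun :: "('o, 'h, 'p, 'g) afun \<Rightarrow> ('o, 'h, 'p, 'g) Kfun" where
  "kfun f =
     \<lparr>Kob = (\<lambda>X. fob f [X]), Kmap = (\<lambda>X Y x. fcomp f [(X, [(Y, fst x - 1, snd x)])])\<rparr>"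

definition unital_functor ::
  "'k ring \<Rightarrow> ('k, 'o, 'h) ainf \<Rightarrow> ('k, 'p, 'g) ainf \<Rightarrow> ('o, 'h, 'p, 'g) afun \<Rightarrow> bool" where
  "unital_functor R A B f \<longleftrightarrow>
     ainf_functor R [A] B f \<and>
     (\<forall>X\<in>obj A. homologous (mor_cpx B (fob f [X]) (fob f [X])) 0
                   (Kmap (kfun f) X X (0, Kunit (kcat R A) X)) (Kunit (kcat R B) (fob f [X])))"

definition ainf_equivalence ::
  "'k ring \<Rightarrow> ('k, 'o, 'h) ainf \<Rightarrow> ('k, 'p, 'g) ainf \<Rightarrow> ('o, 'h, 'p, 'g) afun \<Rightarrow> bool" where
  "ainf_equivalence R A B f \<longleftrightarrow>
     unital_functor R A B f \<and>
     (\<exists>g. ainf_functor R [B] A g \<and>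
        isomorphic R [A] A (afun_comp R A f g) (afun_id A) \<and>
        isomorphic R [B] B (afun_comp R B g f) (afun_id B))"


section \<open>Opposites\<close>

text \<open>\<open>\<gamma>\<close> sends the path \<open>p\<close> to \<open>rev_path p\<close> with the sign of exponent \<open>gamma_exp p\<close>.\<close>

fun rev_word :: "'o \<Rightarrow> ('o \<times> int \<times> 'h) list \<Rightarrow> ('o \<times> int \<times> 'h) list" where
  "rev_word X [] = []"
| "rev_word X ((Y, d, x) # w) = rev_word Y w @ [(X, d, x)]"

definition rev_path :: "('o, 'h) path \<Rightarrow> ('o, 'h) path" where
  "rev_path p = (ptgt p, rev_word (fst p) (snd p))"

fun koszul_rev :: "('o \<times> int \<times> 'h) list \<Rightarrow> int" where
  "koszul_rev [] = 0"
| "koszul_rev ((Y, d, x) # w) = d * wdeg w + koszul_rev w"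

definition gamma_exp :: "('o, 'h) path \<Rightarrow> int" where
  "gamma_exp p = int (length (snd p)) + koszul_rev (snd p)"

text \<open>The summand \<open>1\<close> in the next two sign exponents comes from \<open>\<gamma>\<close> on \<open>T\<^sup>1\<close>.\<close>

definition ainf_op :: "('k, 'o, 'h) ainf \<Rightarrow> ('k, 'o, 'h) ainf" where
  "ainf_op A =
     \<lparr>obj = obj A,
      mor = (\<lambda>X Y. mor A Y X),
      bmap = (\<lambda>p. sgm (mor A (ptgt p) (fst p) (pdeg p + 2)) (gamma_exp p + 1) (bmap A (rev_path p)))\<rparr>"

definition afun_op :: "('k, 'p, 'g) ainf \<Rightarrow> ('o, 'h, 'p, 'g) afun \<Rightarrow> ('o, 'h, 'p, 'g) afun" where
  "afun_op B f =
     \<lparr>fob = fob f,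
      fcomp = (\<lambda>ws. sgm (mor B (fob f (map ptgt ws)) (fob f (map fst ws)) (tdeg ws + 1))
                       ((\<Sum>w\<leftarrow>ws. gamma_exp w) + 1) (fcomp f (map rev_path ws)))\<rparr>"


section \<open>The dg category of complexes, the Hom-functor and the duality functor\<close>

text \<open>HOL has no universe of modules, so the dg category of complexes depends on the type in which
  the elements of the complexes live. It is turned into an \<open>A\<^sub>\<infinity>\<close>-category by
  \<open>m\<^sub>1 = s b\<^sub>1 s\<^sup>-\<^sup>1\<close> and \<open>m\<^sub>2 = (s \<otimes> s) b\<^sub>2 s\<^sup>-\<^sup>1\<close>.\<close>

definition Cdg :: "'k ring \<Rightarrow> ('k, ('k, 'v) cpx, int \<Rightarrow> 'v \<Rightarrow> 'v) ainf" where
  "Cdg R =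
     \<lparr>obj = {M. is_complex R M},
      mor = (\<lambda>M N. gr (inner_hom R M N)),
      bmap = (\<lambda>p. case p of
          (M, [(N, d, f)]) \<Rightarrow> dif (inner_hom R M N) (d + 1) f
        | (M, [(N, d, f), (P, e, g)]) \<Rightarrow>
            sgm (gr (inner_hom R M P) (d + e + 2)) (e + 1) (hcomp M f (d + 1) g)
        | _ \<Rightarrow> \<zero>\<^bsub>gr (inner_hom R (fst p) (ptgt p)) (pdeg p + 2)\<^esub>)\<rparr>"

text \<open>In degree \<open>i\<close>, an element \<open>p\<close> of \<open>\<A>(X,Z)\<close> has degree \<open>i - 1\<close> in \<open>s\<A>(X,Z)\<close>. The exponent below
  collects the degree \<open>tdeg ws + 1\<close> of \<open>h\<close> (from the shift \<open>h\<^bsup>[-1]\<^esup>\<close>), the flip of \<open>p\<close> and \<open>x\<gamma>\<close>, and \<open>\<gamma>\<close>.\<close>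

definition Hom_functor :: "'k ring \<Rightarrow> ('k, 'o, 'h) ainf \<Rightarrow> ('o, 'h, ('k, 'h) cpx, int \<Rightarrow> 'h \<Rightarrow> 'h) afun" where
  "Hom_functor R A =
     \<lparr>fob = (\<lambda>Xs. mor_cpx A (Xs ! 0) (Xs ! 1)),
      fcomp = (\<lambda>ws.
        let x = ws ! 0; z = ws ! 1; X = fst x; Y = ptgt x; Z = fst z; W = ptgt z in
        if tlen ws = 0 then \<zero>\<^bsub>gr (inner_hom R (mor_cpx A X Z) (mor_cpx A Y W)) 1\<^esub>
        else (\<lambda>i. \<lambda>p\<in>carrier (mor A X Z i).
          sgm (mor A Y W (i + tdeg ws + 1))
            ((tdeg ws + 1) + (i - 1) * pdeg x + gamma_exp x)
            (bmap A (Y, snd (rev_path x) @ (Z, i - 1, p) # snd z))))\<rparr>"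

definition D_functor ::
  "'k ring \<Rightarrow> (('k, 'v) cpx, int \<Rightarrow> 'v \<Rightarrow> 'v, ('k, int \<Rightarrow> 'v \<Rightarrow> 'k) cpx,
      int \<Rightarrow> (int \<Rightarrow> 'v \<Rightarrow> 'k) \<Rightarrow> (int \<Rightarrow> 'v \<Rightarrow> 'k)) afun" where
  "D_functor R =
     \<lparr>fob = (\<lambda>Ms. dual R (hd Ms)),
      fcomp = (\<lambda>ws. case ws of
          [(M, [(N, d, f)])] \<Rightarrow>
            (\<lambda>j. \<lambda>g\<in>carrier (gr (dual R M) j).
               sgm (gr (dual R N) (j + (d + 1))) ((d + 1) * j) (hcomp N f (d + 1) g))
        | _ \<Rightarrow> \<zero>\<^bsub>gr (inner_hom R (dual R (hd (map fst ws))) (dual R (hd (map ptgt ws)))) (tdeg ws + 1)\<^esub>)\<rparr>"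

text \<open>Relabelling the elements of complexes along an injection \<open>\<epsilon>\<close> identifies \<open>Cdg\<close> over one type
  with a full dg subcategory of \<open>Cdg\<close> over another. This serves to regard functors with values in
  complexes over two different types as functors to the same dg category of complexes.\<close>

definition relabel_cpx :: "('v \<Rightarrow> 'w) \<Rightarrow> ('k, 'v) cpx \<Rightarrow> ('k, 'w) cpx" where
  "relabel_cpx \<epsilon> M =
     (let \<delta> = inv_into UNIV \<epsilon> in
      \<lparr>gr = (\<lambda>n. \<lparr>carrier = \<epsilon> ` carrier (gr M n), monoid.mult = undefined, one = undefined,
                  zero = \<epsilon> \<zero>\<^bsub>gr M n\<^esub>,
                  add = (\<lambda>x y. \<epsilon> (\<delta> x \<oplus>\<^bsub>gr M n\<^esub> \<delta> y)),
                  smult = (\<lambda>a x. \<epsilon> (a \<odot>\<^bsub>gr M n\<^esub> \<delta> x))\<rparr>),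
       dif = (\<lambda>n x. \<epsilon> (dif M n (\<delta> x)))\<rparr>)"

definition relabel_functor ::
  "'k ring \<Rightarrow> ('v \<Rightarrow> 'w) \<Rightarrow>
   (('k, 'v) cpx, int \<Rightarrow> 'v \<Rightarrow> 'v, ('k, 'w) cpx, int \<Rightarrow> 'w \<Rightarrow> 'w) afun" where
  "relabel_functor R \<epsilon> =
     \<lparr>fob = (\<lambda>Ms. relabel_cpx \<epsilon> (hd Ms)),
      fcomp = (\<lambda>ws. case ws of
          [(M, [(N, d, f)])] \<Rightarrow>
            (\<lambda>i. \<lambda>y\<in>\<epsilon> ` carrier (gr M i). \<epsilon> (f i (inv_into UNIV \<epsilon> y)))
        | _ \<Rightarrow> \<zero>\<^bsub>gr (inner_hom R (relabel_cpx \<epsilon> (hd (map fst ws))) (relabel_cpx \<epsilon> (hd (map ptgt ws))))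
                  (tdeg ws + 1)\<^esub>)\<rparr>"


section \<open>Serre A-infinity functors\<close>

text \<open>\<open>(1, S) \<cdot> Hom\<^bsub>\<A>\<^esub>\<close> takes values in complexes over \<open>'h\<close>, and \<open>Hom\<^bsub>\<A>\<^sup>o\<^sup>p\<^esub>\<^sup>o\<^sup>p \<cdot> D\<close> takes values in
  complexes over \<open>int \<Rightarrow> 'h \<Rightarrow> 'k\<close>. They are compared in complexes over the sum of these types.\<close>

definition one_S_Hom ::
  "'k ring \<Rightarrow> ('k, 'o, 'h) ainf \<Rightarrow> ('o, 'h, 'o, 'h) afun \<Rightarrow>
   ('o, 'h, ('k, 'h) cpx, int \<Rightarrow> 'h \<Rightarrow> 'h) afun" where
  "one_S_Hom R A S = afun_tuple_comp R (Cdg R) [afun_id (ainf_op A), S] (Hom_functor R A)"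

definition Hom_op_D ::
  "'k ring \<Rightarrow> ('k, 'o, 'h) ainf \<Rightarrow>
   ('o, 'h, ('k, int \<Rightarrow> 'h \<Rightarrow> 'k) cpx, int \<Rightarrow> (int \<Rightarrow> 'h \<Rightarrow> 'k) \<Rightarrow> (int \<Rightarrow> 'h \<Rightarrow> 'k)) afun" where
  "Hom_op_D R A = afun_comp R (Cdg R) (afun_op (Cdg R) (Hom_functor R (ainf_op A))) (D_functor R)"

definition right_Serre_ainf_functor ::
  "'k ring \<Rightarrow> ('k, 'o, 'h) ainf \<Rightarrow> ('o, 'h, 'o, 'h) afun \<Rightarrow> bool" where
  "right_Serre_ainf_functor R A S \<longleftrightarrow>
     ainf_functor R [A] A S \<and>
     isomorphic R [ainf_op A, A] (Cdg R)
       (afun_comp R (Cdg R) (one_S_Hom R A S)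
          (relabel_functor R (Inl :: 'h \<Rightarrow> 'h + (int \<Rightarrow> 'h \<Rightarrow> 'k))))
       (afun_comp R (Cdg R) (Hom_op_D R A)
          (relabel_functor R (Inr :: (int \<Rightarrow> 'h \<Rightarrow> 'k) \<Rightarrow> 'h + (int \<Rightarrow> 'h \<Rightarrow> 'k))))"

definition Serre_ainf_functor ::
  "'k ring \<Rightarrow> ('k, 'o, 'h) ainf \<Rightarrow> ('o, 'h, 'o, 'h) afun \<Rightarrow> bool" where
  "Serre_ainf_functor R A S \<longleftrightarrow> right_Serre_ainf_functor R A S \<and> ainf_equivalence R A A S"

end

theory Submission
  imports Defs
begin

text \<open>The degree \<open>(0,0)\<close> component \<open>\<psi>\<close> of a natural isomorphism \<open>r : (1,S) \<cdot> Hom\<^bsub>\<A>\<^esub> \<rightarrow> Hom\<^bsub>\<A>\<^sup>o\<^sup>p\<^esub>\<^sup>o\<^sup>p \<cdot> D\<close> consists of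
  homotopy equivalences \<open>\<A>(X,YS) \<rightarrow> Hom(\<A>(Y,X),k)\<close>. Projecting \<open>r B\<^sub>1 = 0\<close> to tensors of length one in
  the arguments shows that the components of degrees \<open>(1,0)\<close> and \<open>(0,1)\<close> are homotopies which make \<open>\<psi>\<close>
  natural in \<open>X\<close> and in \<open>Y\<close>; likewise, \<open>b\<^sub>3\<close> and \<open>S\<^sub>2\<close> are homotopies for the associativity of \<open>m\<^sub>2\<close> and for
  the multiplicativity of \<open>S\<^sub>1\<close>. Naturality in \<open>Y\<close>, applied to the unit of \<open>YS\<close> and the unit of \<open>Y\<close>, gives that \<open>\<psi>\<close>
  identifies \<open>1\<^bsub>Y\<^esub> S\<close> with \<open>1\<^bsub>YS\<^esub>\<close>, so \<open>S\<close> is unital. A quasi-inverse of an equivalence is unital by cancelling the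
  invertible natural transformations.\<close>

section \<open>Linear algebra with signs\<close>

text \<open>Two obstacles shape the proof. The A-infinity identities are given through
  \<open>tensor_eq\<close>, a congruence on formal sums generated by multilinearity, from which no
  equation can be read off directly. It is used only through two invariants: well-formedness, which
  yields the memberships that the formulas need, and \<open>lin1\<close>, a linear projection to
  tensors of length one. The other obstacle is units. Neither \<open>S\<close> nor a quasi-inverse
  is assumed to preserve them, and the units of \<open>kcat R (Cdg R)\<close> are arbitrary choices.
  These questions are settled on cycles of degree zero modulo boundaries, where homotopies disappear
  and ordinary cancellation arguments apply. The signs in the homotopies come from the shift:
  \<open>b_3\<close> and \<open>f_2\<close> enter as
  \<open>(s \<otimes> s \<otimes> s) b_3 s^{-1}\<close> and
  \<open>(s \<otimes> s) f_2 s^{-1}\<close>, both with the sign of the degree of the second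
  argument. The natural isomorphism lives over a sum type, so its components are carried back along
  \<open>Inl\<close> and \<open>Inr\<close> before they become homotopies.\<close>

lemma sg_0 [simp]: "sg R 0 = \<one>\<^bsub>R\<^esub>"
  by (simp add: sg_def)

lemma lsum_simps [simp]: "lsum M [] = \<zero>\<^bsub>M\<^esub>" "lsum M (x # xs) = x \<oplus>\<^bsub>M\<^esub> lsum M xs"
  by (auto simp: lsum_def)

lemma sgm_0 [simp]: "sgm M 0 x = x"
  by (simp add: sgm_def)

lemma sgm_even: "even e \<Longrightarrow> sgm M e x = x"
  by (simp add: sgm_def)

lemma sgm_odd: "odd e \<Longrightarrow> sgm M e x = \<ominus>\<^bsub>M\<^esub> x"
  by (simp add: sgm_def)

lemma sgm_parity: "even (a - b) \<Longrightarrow> sgm M a x = sgm M b x"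
  by (auto simp add: sgm_def)

locale ground =
  fixes R :: "'k ring"
  assumes ground_cring: "cring R"

locale kmod = module R M for R :: "'k ring" and M :: "('k, 'm) module"

context kmod
begin

lemma closed_facts:
  "\<zero>\<^bsub>M\<^esub> \<in> carrier M"
  "x \<in> carrier M \<Longrightarrow> y \<in> carrier M \<Longrightarrow> x \<oplus>\<^bsub>M\<^esub> y \<in> carrier M"
  "x \<in> carrier M \<Longrightarrow> y \<in> carrier M \<Longrightarrow> x \<ominus>\<^bsub>M\<^esub> y \<in> carrier M"
  "x \<in> carrier M \<Longrightarrow> \<ominus>\<^bsub>M\<^esub> x \<in> carrier M"
  "c \<in> carrier R \<Longrightarrow> x \<in> carrier M \<Longrightarrow> c \<odot>\<^bsub>M\<^esub> x \<in> carrier M"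
  "x \<in> carrier M \<Longrightarrow> sgm M e x \<in> carrier M"
  by (simp_all add: sgm_def)

lemma simp_facts:
  "x \<in> carrier M \<Longrightarrow> x \<oplus>\<^bsub>M\<^esub> \<zero>\<^bsub>M\<^esub> = x"
  "x \<in> carrier M \<Longrightarrow> \<zero>\<^bsub>M\<^esub> \<oplus>\<^bsub>M\<^esub> x = x"
  "x \<in> carrier M \<Longrightarrow> \<ominus>\<^bsub>M\<^esub> (\<ominus>\<^bsub>M\<^esub> x) = x"
  "\<ominus>\<^bsub>M\<^esub> \<zero>\<^bsub>M\<^esub> = \<zero>\<^bsub>M\<^esub>"
  "x \<in> carrier M \<Longrightarrow> \<one>\<^bsub>R\<^esub> \<odot>\<^bsub>M\<^esub> x = x"
  "x \<in> carrier M \<Longrightarrow> \<zero>\<^bsub>R\<^esub> \<odot>\<^bsub>M\<^esub> x = \<zero>\<^bsub>M\<^esub>"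
  "c \<in> carrier R \<Longrightarrow> c \<odot>\<^bsub>M\<^esub> \<zero>\<^bsub>M\<^esub> = \<zero>\<^bsub>M\<^esub>"
  "x \<in> carrier M \<Longrightarrow> sg R e \<odot>\<^bsub>M\<^esub> x = sgm M e x"
  "x \<in> carrier M \<Longrightarrow> sgm M a (sgm M b x) = sgm M (a + b) x"
  "sgm M e \<zero>\<^bsub>M\<^esub> = \<zero>\<^bsub>M\<^esub>"
  "x \<in> carrier M \<Longrightarrow> x \<ominus>\<^bsub>M\<^esub> x = \<zero>\<^bsub>M\<^esub>"
  "x \<in> carrier M \<Longrightarrow> x \<ominus>\<^bsub>M\<^esub> \<zero>\<^bsub>M\<^esub> = x"
  by (auto simp: a_minus_def r_neg sgm_def sg_def smult_l_minus)

lemma axiom_facts: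
  "x \<in> carrier M \<Longrightarrow> y \<in> carrier M \<Longrightarrow> z \<in> carrier M \<Longrightarrow> x \<oplus>\<^bsub>M\<^esub> y \<oplus>\<^bsub>M\<^esub> z = x \<oplus>\<^bsub>M\<^esub> (y \<oplus>\<^bsub>M\<^esub> z)"
  "x \<in> carrier M \<Longrightarrow> y \<in> carrier M \<Longrightarrow> x \<oplus>\<^bsub>M\<^esub> y = y \<oplus>\<^bsub>M\<^esub> x"
  "c \<in> carrier R \<Longrightarrow> c' \<in> carrier R \<Longrightarrow> x \<in> carrier M \<Longrightarrow>
    (c \<oplus>\<^bsub>R\<^esub> c') \<odot>\<^bsub>M\<^esub> x = c \<odot>\<^bsub>M\<^esub> x \<oplus>\<^bsub>M\<^esub> c' \<odot>\<^bsub>M\<^esub> x"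
  "c \<in> carrier R \<Longrightarrow> c' \<in> carrier R \<Longrightarrow> x \<in> carrier M \<Longrightarrow>
    (c \<otimes>\<^bsub>R\<^esub> c') \<odot>\<^bsub>M\<^esub> x = c \<odot>\<^bsub>M\<^esub> (c' \<odot>\<^bsub>M\<^esub> x)"
  "x \<in> carrier M \<Longrightarrow> y \<in> carrier M \<Longrightarrow> z \<in> carrier M \<Longrightarrow> x \<oplus>\<^bsub>M\<^esub> (y \<oplus>\<^bsub>M\<^esub> z) = y \<oplus>\<^bsub>M\<^esub> (x \<oplus>\<^bsub>M\<^esub> z)"
  by (simp_all add: a_ac smult_l_distr smult_r_distr smult_assoc1)

lemma sgm_facts:
  "x \<in> carrier M \<Longrightarrow> y \<in> carrier M \<Longrightarrow> sgm M e (x \<oplus>\<^bsub>M\<^esub> y) = sgm M e x \<oplus>\<^bsub>M\<^esub> sgm M e y"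
  "x \<in> carrier M \<Longrightarrow> sgm M e (\<ominus>\<^bsub>M\<^esub> x) = \<ominus>\<^bsub>M\<^esub> sgm M e x"
  "c \<in> carrier R \<Longrightarrow> x \<in> carrier M \<Longrightarrow> sgm M e (c \<odot>\<^bsub>M\<^esub> x) = c \<odot>\<^bsub>M\<^esub> sgm M e x"
  by (auto simp: sgm_def smult_r_minus minus_add)

lemma smult_facts:
  "c \<in> carrier R \<Longrightarrow> x \<in> carrier M \<Longrightarrow> y \<in> carrier M \<Longrightarrow>
    c \<odot>\<^bsub>M\<^esub> (x \<oplus>\<^bsub>M\<^esub> y) = c \<odot>\<^bsub>M\<^esub> x \<oplus>\<^bsub>M\<^esub> c \<odot>\<^bsub>M\<^esub> y"
  "c \<in> carrier R \<Longrightarrow> x \<in> carrier M \<Longrightarrow> c \<odot>\<^bsub>M\<^esub> (\<ominus>\<^bsub>M\<^esub> x) = \<ominus>\<^bsub>M\<^esub> (c \<odot>\<^bsub>M\<^esub> x)"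
  "c \<in> carrier R \<Longrightarrow> c' \<in> carrier R \<Longrightarrow> x \<in> carrier M \<Longrightarrow> c \<odot>\<^bsub>M\<^esub> (c' \<odot>\<^bsub>M\<^esub> x) = (c \<otimes>\<^bsub>R\<^esub> c') \<odot>\<^bsub>M\<^esub> x"
  by (simp_all add: smult_r_distr smult_r_minus smult_assoc1)

end

text \<open>HOL-Algebra provides the normalisation method of the next declaration for rings only.\<close>

lemmas (in kmod) [algebra abelian_group "zero M" "add M" "a_inv M" "a_minus M"] =
  a_closed zero_closed a_inv_closed minus_closed a_assoc l_zero l_neg a_comm a_minus_def
  r_zero r_neg r_neg1 r_neg2 minus_zero minus_minus minus_add a_lcomm

lemma (in kmod) uminus_unique: "x \<in> carrier M \<Longrightarrow> y \<in> carrier M \<Longrightarrow> x \<oplus>\<^bsub>M\<^esub> y = \<zero>\<^bsub>M\<^esub> \<Longrightarrow> x = \<ominus>\<^bsub>M\<^esub> y"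
  by (simp add: minus_equality)

context ground
begin

lemma kmod: "module R M \<Longrightarrow> kmod R M"
  by (simp add: kmod_def)

lemma sg_closed [simp, intro]: "sg R e \<in> carrier R"
proof -
  interpret cring R by (rule ground_cring)
  show ?thesis by (simp add: sg_def)
qed

lemma one_closed [simp, intro]: "\<one>\<^bsub>R\<^esub> \<in> carrier R"
proof -
  interpret cring R by (rule ground_cring)
  show ?thesis by simp
qed

lemma sg_sg [simp]: "sg R a \<otimes>\<^bsub>R\<^esub> sg R b = sg R (a + b)"
proof -
  interpret cring R by (rule ground_cring)
  show ?thesis by (simp add: sg_def l_minus r_minus)
qed

lemma sg_one [simp]: "sg R a \<otimes>\<^bsub>R\<^esub> \<one>\<^bsub>R\<^esub> = sg R a" "\<one>\<^bsub>R\<^esub> \<otimes>\<^bsub>R\<^esub> sg R a = sg R a"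
  "\<one>\<^bsub>R\<^esub> \<otimes>\<^bsub>R\<^esub> \<one>\<^bsub>R\<^esub> = \<one>\<^bsub>R\<^esub>"
  using sg_sg[of _ 0] sg_sg[of 0] sg_sg[of 0 0] by simp_all

text \<open>Exported from the locale, the facts carry \<open>module R M\<close> as a premise. The
  simplifier can then use them for all the modules occurring in one goal, without an interpretation
  for each.\<close>

lemmas module_axioms = kmod.axiom_facts[OF kmod]
lemmas module_facts [simp, intro] = kmod.closed_facts[OF kmod]
lemmas module_simps [simp] = kmod.simp_facts[OF kmod]
lemmas sgm_distrib = kmod.sgm_facts[OF kmod]
lemmas smult_distrib = kmod.smult_facts[OF kmod]

subsection \<open>Linear maps\<close>

abbreviation lin :: "('k, 'm) module \<Rightarrow> ('k, 'n) module \<Rightarrow> ('m \<Rightarrow> 'n) \<Rightarrow> bool" where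
  "lin \<equiv> linear_map R"

abbreviation elts :: "('k, 'm) cpx \<Rightarrow> int \<Rightarrow> 'm set" where
  "elts M n \<equiv> carrier (gr M n)"

lemma linear_mapI:
  assumes "\<And>x. x \<in> carrier M \<Longrightarrow> f x \<in> carrier N"
    and "\<And>x y. x \<in> carrier M \<Longrightarrow> y \<in> carrier M \<Longrightarrow> f (x \<oplus>\<^bsub>M\<^esub> y) = f x \<oplus>\<^bsub>N\<^esub> f y"
    and "\<And>a x. a \<in> carrier R \<Longrightarrow> x \<in> carrier M \<Longrightarrow> f (a \<odot>\<^bsub>M\<^esub> x) = a \<odot>\<^bsub>N\<^esub> f x"
  shows "lin M N f"
  using assms by (simp add: linear_map_def)

lemma linear_mapD:
  assumes "lin M N f"
  shows "x \<in> carrier M \<Longrightarrow> f x \<in> carrier N"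
    "x \<in> carrier M \<Longrightarrow> y \<in> carrier M \<Longrightarrow> f (x \<oplus>\<^bsub>M\<^esub> y) = f x \<oplus>\<^bsub>N\<^esub> f y"
    "a \<in> carrier R \<Longrightarrow> x \<in> carrier M \<Longrightarrow> f (a \<odot>\<^bsub>M\<^esub> x) = a \<odot>\<^bsub>N\<^esub> f x"
  using assms by (auto simp: linear_map_def)

lemma linear_map_more:
  fixes M :: "('k, 'm) module" and N :: "('k, 'n) module"
  assumes f: "lin M N f" and M: "module R M" and N: "module R N"
  shows "f \<zero>\<^bsub>M\<^esub> = \<zero>\<^bsub>N\<^esub>"
    "x \<in> carrier M \<Longrightarrow> f (\<ominus>\<^bsub>M\<^esub> x) = \<ominus>\<^bsub>N\<^esub> f x"
    "x \<in> carrier M \<Longrightarrow> y \<in> carrier M \<Longrightarrow> f (x \<ominus>\<^bsub>M\<^esub> y) = f x \<ominus>\<^bsub>N\<^esub> f y" (is "PROP ?goal1")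
    "x \<in> carrier M \<Longrightarrow> f (sgm M e x) = sgm N e (f x)"
proof -
  interpret m: kmod R M by (rule kmod[OF M])
  interpret n: kmod R N by (rule kmod[OF N])
  note [simp] = linear_mapD[OF f]
  show z: "f \<zero>\<^bsub>M\<^esub> = \<zero>\<^bsub>N\<^esub>"
    using linear_mapD(3)[OF f, of "\<zero>\<^bsub>R\<^esub>" "\<zero>\<^bsub>M\<^esub>"] by simp
  show minus: "f (\<ominus>\<^bsub>M\<^esub> x) = \<ominus>\<^bsub>N\<^esub> f x" if x: "x \<in> carrier M" for x
  proof -
    have "f (\<ominus>\<^bsub>M\<^esub> x) \<oplus>\<^bsub>N\<^esub> f x = \<zero>\<^bsub>N\<^esub>"
      using x linear_mapD(2)[OF f, of "\<ominus>\<^bsub>M\<^esub> x" x] by (simp add: m.l_neg z)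
    then show ?thesis using x by (simp add: n.minus_equality)
  qed
  show "PROP ?goal1"
    by (simp add: a_minus_def minus)
  show "x \<in> carrier M \<Longrightarrow> f (sgm M e x) = sgm N e (f x)"
    by (simp add: sgm_def minus)
qed

lemma linear_map_cong:
  assumes "lin M N f" and "module R M" and "\<And>x. x \<in> carrier M \<Longrightarrow> f x = g x"
  shows "lin M N g"
proof (rule linear_mapI)
  show "g x \<in> carrier N" if "x \<in> carrier M" for x
    using that assms(3)[of x] linear_mapD(1)[OF assms(1), of x] by auto
  show "g (x \<oplus>\<^bsub>M\<^esub> y) = g x \<oplus>\<^bsub>N\<^esub> g y" if "x \<in> carrier M" "y \<in> carrier M" for x y
    using that assms(2) assms(3)[of x] assms(3)[of y] assms(3)[of "x \<oplus>\<^bsub>M\<^esub> y"] linear_mapD(2)[OF assms(1)] by auto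
  show "g (a \<odot>\<^bsub>M\<^esub> x) = a \<odot>\<^bsub>N\<^esub> g x" if "a \<in> carrier R" "x \<in> carrier M" for a x
    using that assms(2) assms(3)[of x] assms(3)[of "a \<odot>\<^bsub>M\<^esub> x"] linear_mapD(3)[OF assms(1)] by auto
qed

lemma linear_map_compose:
  assumes "lin M N f" and "lin N P g"
  shows "lin M P (\<lambda>x. g (f x))"
  using linear_mapD[OF assms(1)] linear_mapD[OF assms(2)] by (intro linear_mapI) auto

lemma linear_map_ident: "lin M M (\<lambda>x. x)"
  by (auto simp: linear_map_def)

lemma linear_map_sgm:
  assumes "lin M N f" and "module R N"
  shows "lin M N (\<lambda>x. sgm N e (f x))"
  using assms by (auto simp: linear_map_def sgm_distrib Pi_iff)

lemma linear_map_uminus: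
  assumes "lin M N f" and "module R N"
  shows "lin M N (\<lambda>x. \<ominus>\<^bsub>N\<^esub> f x)"
  using linear_map_sgm[OF assms, of 1] by (simp add: sgm_odd)

lemma linear_map_sum:
  assumes f: "lin M N f" and g: "lin M N g" and N: "module R N"
  shows "lin M N (\<lambda>x. f x \<oplus>\<^bsub>N\<^esub> g x)"
proof -
  interpret n: kmod R N by (rule kmod[OF N])
  show ?thesis
    using linear_mapD[OF f] linear_mapD[OF g] N
    by (intro linear_mapI) (auto simp: n.a_ac n.smult_r_distr)
qed

lemma linear_map_smult:
  assumes f: "lin M N f" and c: "c \<in> carrier R" and N: "module R N"
  shows "lin M N (\<lambda>x. c \<odot>\<^bsub>N\<^esub> f x)"
proof -
  interpret n: kmod R N by (rule kmod[OF N])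
  show ?thesis
    using linear_mapD[OF f] c
    by (intro linear_mapI)
      (auto simp: n.smult_r_distr simp flip: n.smult_assoc1, auto simp: n.smult_assoc1[symmetric] n.m_comm)
qed

lemma linear_map_zero:
  assumes "module R N"
  shows "lin M N (\<lambda>x. \<zero>\<^bsub>N\<^esub>)"
  using assms by (intro linear_mapI) auto

subsection \<open>Complexes\<close>

lemma is_complexD:
  assumes "is_complex R M"
  shows "module R (gr M n)" "lin (gr M n) (gr M (n + 1)) (dif M n)"
    "x \<in> elts M n \<Longrightarrow> dif M (n + 1) (dif M n x) = \<zero>\<^bsub>gr M (n + 2)\<^esub>" (is "PROP ?goal1")
    "x \<in> elts M n \<Longrightarrow> dif M n x \<in> elts M (n + 1)" (is "PROP ?goal2")
    "x \<in> elts M (n - 1) \<Longrightarrow> dif M (n - 1) x \<in> elts M n" (is "PROP ?goal3")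
    "lin (gr M (n - 1)) (gr M n) (dif M (n - 1))"
proof -
  show 1: "module R (gr M n)" "lin (gr M n) (gr M (n + 1)) (dif M n)"
    "PROP ?goal1"
    using assms by (auto simp: is_complex_def)
  show "PROP ?goal2"
    using linear_mapD(1)[OF 1(2)] .
  show "lin (gr M (n - 1)) (gr M n) (dif M (n - 1))"
    using assms by (auto simp: is_complex_def dest: spec[of _ "n - 1"])
  then show "PROP ?goal3"
    by (rule linear_mapD(1))
qed

lemma gr_inner_hom_simps:
  "f \<in> elts (inner_hom R M N) n \<longleftrightarrow>
     (\<forall>i. f i \<in> extensional (elts M i) \<and> lin (gr M i) (gr N (i + n)) (f i))"
  "\<zero>\<^bsub>gr (inner_hom R M N) n\<^esub> = (\<lambda>i. \<lambda>x\<in>elts M i. \<zero>\<^bsub>gr N (i + n)\<^esub>)"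
  "f \<oplus>\<^bsub>gr (inner_hom R M N) n\<^esub> g = (\<lambda>i. \<lambda>x\<in>elts M i. f i x \<oplus>\<^bsub>gr N (i + n)\<^esub> g i x)"
  "a \<odot>\<^bsub>gr (inner_hom R M N) n\<^esub> f = (\<lambda>i. \<lambda>x\<in>elts M i. a \<odot>\<^bsub>gr N (i + n)\<^esub> f i x)"
  by (auto simp: inner_hom_def)

lemma dif_inner_hom:
  "dif (inner_hom R M N) n f = (\<lambda>i. \<lambda>x\<in>elts M i.
     dif N (i + n) (f i x) \<ominus>\<^bsub>gr N (i + n + 1)\<^esub> sgm (gr N (i + n + 1)) n (f (i + 1) (dif M i x)))"
  by (simp add: inner_hom_def)

lemma inner_homD:
  assumes "f \<in> elts (inner_hom R M N) n"
  shows "lin (gr M i) (gr N (i + n)) (f i)"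
    "x \<in> elts M i \<Longrightarrow> f i x \<in> elts N (i + n)"
  using assms linear_mapD(1)[of "gr M i" "gr N (i + n)" "f i"] by (auto simp: gr_inner_hom_simps)

lemma inner_hom_memI:
  assumes "\<And>i. lin (gr M i) (gr N (i + n)) (f i)" and M: "\<And>i. module R (gr M i)"
  shows "(\<lambda>i. \<lambda>x\<in>elts M i. f i x) \<in> elts (inner_hom R M N) n"
  unfolding gr_inner_hom_simps
  by (auto intro!: linear_map_cong[OF assms(1) M])

text \<open>Extensionality outside the carriers, built into \<open>inner_hom\<close>, makes this
  true. Equations between families of maps are thereby reduced to pointwise ones.\<close>

lemma inner_hom_eqI:
  assumes "f \<in> elts (inner_hom R M N) n" and "g \<in> elts (inner_hom R M N) n"
    and "\<And>i x. x \<in> elts M i \<Longrightarrow> f i x = g i x"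
  shows "f = g"
proof
  fix i
  show "f i = g i"
    by (rule extensionalityI[of _ "elts M i"]) (use assms in \<open>auto simp: gr_inner_hom_simps\<close>)
qed

lemma module_inner_hom:
  fixes M :: "('k, 'm) cpx" and N :: "('k, 'n) cpx"
  assumes M: "\<And>i. module R (gr M i)" and N: "\<And>i. module R (gr N i)"
  shows "module R (gr (inner_hom R M N) n)"
proof -
  let ?H = "gr (inner_hom R M N) n"
  have kN: "kmod R (gr N i)" for i by (rule kmod[OF N])
  have add: "f \<oplus>\<^bsub>?H\<^esub> g \<in> carrier ?H" if "f \<in> carrier ?H" "g \<in> carrier ?H" for f g
    unfolding gr_inner_hom_simps(3)
    by (rule inner_hom_memI[OF linear_map_sum M]) (use that N in \<open>auto intro: inner_homD\<close>)
  have smult: "a \<odot>\<^bsub>?H\<^esub> f \<in> carrier ?H" if "f \<in> carrier ?H" "a \<in> carrier R" for f a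
    unfolding gr_inner_hom_simps(4)
    by (rule inner_hom_memI[OF linear_map_smult M]) (use that N in \<open>auto intro: inner_homD\<close>)
  have zero: "\<zero>\<^bsub>?H\<^esub> \<in> carrier ?H"
    unfolding gr_inner_hom_simps(2)
    by (rule inner_hom_memI[OF linear_map_zero M]) (use N in auto)
  have inv: "\<exists>g\<in>carrier ?H. g \<oplus>\<^bsub>?H\<^esub> f = \<zero>\<^bsub>?H\<^esub>" if f: "f \<in> carrier ?H" for f
  proof
    let ?g = "\<lambda>i. \<lambda>x\<in>elts M i. \<ominus>\<^bsub>gr N (i + n)\<^esub> f i x"
    show g: "?g \<in> carrier ?H"
      by (rule inner_hom_memI[OF linear_map_uminus M]) (use f N in \<open>auto intro: inner_homD\<close>)
    have "\<ominus>\<^bsub>gr N (i + n)\<^esub> f i x \<oplus>\<^bsub>gr N (i + n)\<^esub> f i x = \<zero>\<^bsub>gr N (i + n)\<^esub>"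
      if "x \<in> elts M i" for i x
    proof -
      interpret kmod R "gr N (i + n)" by (rule kN)
      show ?thesis using inner_homD(2)[OF f that] by (simp add: l_neg)
    qed
    then show "?g \<oplus>\<^bsub>?H\<^esub> f = \<zero>\<^bsub>?H\<^esub>"
      by (intro inner_hom_eqI[OF add[OF g f] zero]) (simp add: gr_inner_hom_simps)
  qed
  have mem: "f i x \<in> elts N (i + n)" if "f \<in> carrier ?H" "x \<in> elts M i" for f i x
    using inner_homD(2)[OF that] .
  have R [simp]: "a \<oplus>\<^bsub>R\<^esub> b \<in> carrier R" "a \<otimes>\<^bsub>R\<^esub> b \<in> carrier R"
    if "a \<in> carrier R" "b \<in> carrier R" for a b
    using that ground_cring by (auto simp: cring.cring_simprules)
  show ?thesis
  proof (rule moduleI[OF ground_cring abelian_groupI])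
    show "\<And>f. f \<in> carrier ?H \<Longrightarrow> \<exists>g\<in>carrier ?H. g \<oplus>\<^bsub>?H\<^esub> f = \<zero>\<^bsub>?H\<^esub>" by (rule inv)
  \<comment> \<open>Each remaining module axiom is either a closure property or an equation which
    \<open>inner_hom_eqI\<close> reduces to the same axiom in \<open>gr N (i + n)\<close>.\<close>
  qed (((simp add: add smult zero; fail) | (rule inner_hom_eqI[of _ M N n], (simp add: add smult zero; fail)+,
        simp add: gr_inner_hom_simps(2-4) mem N module_axioms smult_distrib(1))))+
qed

lemma inner_hom_uminus:
  fixes M :: "('k, 'm) cpx" and N :: "('k, 'n) cpx"
  assumes M: "\<And>i. module R (gr M i)" and N: "\<And>i. module R (gr N i)"
    and f: "f \<in> elts (inner_hom R M N) n" and x: "x \<in> elts M i"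
  shows "(\<ominus>\<^bsub>gr (inner_hom R M N) n\<^esub> f) i x = \<ominus>\<^bsub>gr N (i + n)\<^esub> f i x"
proof -
  interpret h: kmod R "gr (inner_hom R M N) n" by (rule kmod[OF module_inner_hom[OF M N]])
  interpret n: kmod R "gr N (i + n)" by (rule kmod[OF N])
  have "(\<ominus>\<^bsub>gr (inner_hom R M N) n\<^esub> f \<oplus>\<^bsub>gr (inner_hom R M N) n\<^esub> f) i x = \<zero>\<^bsub>gr N (i + n)\<^esub>"
    using f x by (simp add: h.l_neg gr_inner_hom_simps(2))
  then have "(\<ominus>\<^bsub>gr (inner_hom R M N) n\<^esub> f) i x \<oplus>\<^bsub>gr N (i + n)\<^esub> f i x = \<zero>\<^bsub>gr N (i + n)\<^esub>"
    using x by (simp add: gr_inner_hom_simps(3))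
  then show ?thesis
    using inner_homD(2)[OF f x] inner_homD(2)[OF h.a_inv_closed[OF f] x] by (simp add: n.uminus_unique)
qed

lemma inner_hom_pointwise:
  fixes M :: "('k, 'm) cpx" and N :: "('k, 'n) cpx"
  assumes M: "\<And>i. module R (gr M i)" and N: "\<And>i. module R (gr N i)"
    and f: "f \<in> elts (inner_hom R M N) n" and x: "x \<in> elts M i"
  shows "g \<in> elts (inner_hom R M N) n \<Longrightarrow>
      (f \<ominus>\<^bsub>gr (inner_hom R M N) n\<^esub> g) i x = f i x \<ominus>\<^bsub>gr N (i + n)\<^esub> g i x"
    "sgm (gr (inner_hom R M N) n) e f i x = sgm (gr N (i + n)) e (f i x)"
  using x by (auto simp: sgm_def a_minus_def inner_hom_uminus[OF M N] f gr_inner_hom_simps(3))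

text \<open>The square of the differential vanishes because its two mixed terms, with one
  differential on either side of \<open>f\<close>, carry the signs of \<open>n\<close> and
  \<open>n + 1\<close> and cancel.\<close>

lemma is_complex_inner_hom:
  assumes M: "is_complex R M" and N: "is_complex R N"
  shows "is_complex R (inner_hom R M N)"
proof -
  let ?I = "inner_hom R M N"
  note mM [simp] = is_complexD(1)[OF M] and mN [simp] = is_complexD(1)[OF N]
  have mH [simp]: "module R (gr (?I) n)" for n
    by (rule module_inner_hom) auto
  note dM [simp] = is_complexD(4)[OF M] and dN [simp] = is_complexD(4)[OF N]
  note lM = is_complexD(2)[OF M] and lN = is_complexD(2)[OF N]
  have fd: "lin (gr M i) (gr N (i + n + 1)) (\<lambda>x. f (i + 1) (dif M i x))"
    "lin (gr M i) (gr N (i + n + 1)) (\<lambda>x. dif N (i + n) (f i x))"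
    if "f \<in> elts (?I) n" for f n i
    using linear_map_compose[OF lM[of i] inner_homD(1)[OF that, of "i + 1"]]
      linear_map_compose[OF inner_homD(1)[OF that, of i] lN]
    by (simp_all add: ac_simps)
  have d: "dif (?I) n f \<in> elts (?I) (n + 1)"
    if f: "f \<in> elts (?I) n" for f n
  proof -
    have "lin (gr M i) (gr N (i + n + 1)) (\<lambda>x. dif N (i + n) (f i x) \<oplus>\<^bsub>gr N (i + n + 1)\<^esub>
        (\<ominus>\<^bsub>gr N (i + n + 1)\<^esub> sgm (gr N (i + n + 1)) n (f (i + 1) (dif M i x))))" for i
      by (intro linear_map_sum linear_map_uminus linear_map_sgm fd f mN)
    then show ?thesis
      unfolding dif_inner_hom by (intro inner_hom_memI mM) (simp add: a_minus_def add.assoc)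
  qed
  have fin [simp]: "f i x \<in> elts N (i + n)" if "f \<in> elts (?I) n" "x \<in> elts M i"
    for f n i x using inner_homD(2)[OF that] .
  have fd' [simp]: "f (i + 1) (dif M i x) \<in> elts N (i + n + 1)"
    "dif N (i + n) (f i x) \<in> elts N (i + n + 1)"
    if "f \<in> elts (?I) n" "x \<in> elts M i" for f n i x
    using linear_mapD(1)[OF fd(1)[OF that(1)] that(2)] linear_mapD(1)[OF fd(2)[OF that(1)] that(2)] .
  have eq: "i + (n + 1) = i + n + 1" "i + 1 + n = i + n + 1" for i n :: int by auto
  have lin: "lin (gr (?I) n) (gr (?I) (n + 1)) (dif (?I) n)" for n
  proof (rule linear_mapI)
    show "dif (?I) n f \<in> elts (?I) (n + 1)"
      if "f \<in> elts (?I) n" for f using d[OF that] .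
  next
    fix f g assume f: "f \<in> elts (?I) n" and g: "g \<in> elts (?I) n"
    show "dif (?I) n (f \<oplus>\<^bsub>gr (?I) n\<^esub> g) =
      dif (?I) n f \<oplus>\<^bsub>gr (?I) (n + 1)\<^esub> dif (?I) n g"
    proof (rule inner_hom_eqI[OF d module_facts(2)[OF mH d d]])
      fix i x assume x: "x \<in> elts M i"
      interpret kmod R "gr N (i + n + 1)" by (rule kmod) simp
      have s: "sgm (gr N (i + n + 1)) n (f (i + 1) (dif M i x)) \<in> elts N (i + n + 1)"
        "sgm (gr N (i + n + 1)) n (g (i + 1) (dif M i x)) \<in> elts N (i + n + 1)"
        using f g x by simp_all
      show "dif (?I) n (f \<oplus>\<^bsub>gr (?I) n\<^esub> g) i x =
        (dif (?I) n f \<oplus>\<^bsub>gr (?I) (n + 1)\<^esub> dif (?I) n g) i x"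
        using x f g s fd'[OF f x] fd'[OF g x]
        by (simp add: dif_inner_hom gr_inner_hom_simps(3) linear_mapD(2)[OF lN] eq[of i n] sgm_distrib
            del: module_facts fd' dN) algebra
    qed (use f g in auto)
  next
    fix a f assume a: "a \<in> carrier R" and f: "f \<in> elts (?I) n"
    have af: "a \<odot>\<^bsub>gr (?I) n\<^esub> f \<in> elts (?I) n"
      by (rule module_facts(5)[OF mH a f])
    show "dif (?I) n (a \<odot>\<^bsub>gr (?I) n\<^esub> f) =
      a \<odot>\<^bsub>gr (?I) (n + 1)\<^esub> dif (?I) n f"
    proof (rule inner_hom_eqI[OF d[OF af] module_facts(5)[OF mH a d[OF f]]])
      fix i x assume x: "x \<in> elts M i"
      show "dif (?I) n (a \<odot>\<^bsub>gr (?I) n\<^esub> f) i x =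
        (a \<odot>\<^bsub>gr (?I) (n + 1)\<^esub> dif (?I) n f) i x"
        using x f a by (simp add: dif_inner_hom gr_inner_hom_simps(4) linear_mapD(3)[OF lN] eq[of i n]
            sgm_distrib a_minus_def smult_distrib)
    qed
  qed
  have dd: "dif (?I) (n + 1) (dif (?I) n f) = \<zero>\<^bsub>gr (?I) (n + 2)\<^esub>"
    if f: "f \<in> elts (?I) n" for f n
  proof -
    have "dif (?I) (n + 1) (dif (?I) n f) \<in> elts (?I) (n + 2)"
      using d[OF d[OF f]] by (simp only: add.assoc one_add_one)
    then show ?thesis
    proof (rule inner_hom_eqI[OF _ module_facts(1)[OF mH]])
      fix i x assume x: "x \<in> elts M i"
      interpret kmod R "gr N (2 + (i + n))" by (rule kmod) simp
      have m1: "dif N (i + n + 1) (f (i + 1) (dif M i x)) \<in> elts N (2 + (i + n))"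
        using dN[OF fd'(1)[OF f x]] by (simp add: ac_simps)
      have d2: "dif M (i + 1) (dif M i x) = \<zero>\<^bsub>gr M (2 + i)\<^esub>" using is_complexD(3)[OF M x] by (simp add: ac_simps)
      have d3: "dif N (i + n + 1) (dif N (i + n) (f i x)) = \<zero>\<^bsub>gr N (2 + (i + n))\<^esub>"
        using is_complexD(3)[OF N fin[OF f x]] by (simp add: ac_simps)
      have f0: "f (2 + i) \<zero>\<^bsub>gr M (2 + i)\<^esub> = \<zero>\<^bsub>gr N (2 + (i + n))\<^esub>"
        using linear_map_more(1)[OF inner_homD(1)[OF f] mM mN, of "2 + i"] by (simp add: algebra_simps)
      have eq2: "i + 1 + (n + 1) = 2 + (i + n)" "i + n + 1 + 1 = 2 + (i + n)" "i + (n + 2) = 2 + (i + n)"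
        "i + 1 + 1 = 2 + i" "i + (n + 2) = 2 + (i + n)" "i + (2 + n) = 2 + (i + n)" by auto
      have l1: "lin (gr N (i + n + 1)) (gr N (2 + (i + n))) (dif N (i + n + 1))"
        using lN[of "i + n + 1"] by (simp add: ac_simps)
      show "dif (?I) (n + 1) (dif (?I) n f) i x =
        \<zero>\<^bsub>gr (?I) (n + 2)\<^esub> i x"
        using x f m1 fd'[OF f x]
        by (cases "even n") (simp_all add: dif_inner_hom gr_inner_hom_simps(2) eq[of i n] eq2
            linear_map_more[OF l1] linear_mapD(2)[OF l1] d3 d2 f0 sgm_def a_minus_def r_neg l_neg)
    qed
  qed
  show ?thesis using lin dd by (simp add: is_complex_def)
qed

lemma is_complex_unit_cpx: "is_complex R (unit_cpx R)"
proof -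
  interpret cring R by (rule ground_cring)
  have "module R (gr (unit_cpx R) n)" for n
    by (rule moduleI[OF ground_cring abelian_groupI])
      (auto simp: unit_cpx_def a_ac m_assoc l_distr r_distr split: if_splits intro: bexI[of _ "\<ominus>\<^bsub>R\<^esub> _"] l_neg)
  then show ?thesis
    by (auto simp: is_complex_def linear_map_def unit_cpx_def)
qed

lemma unit_cpx_simps: "dif (unit_cpx R) n x = \<zero>\<^bsub>R\<^esub>" "\<zero>\<^bsub>gr (unit_cpx R) n\<^esub> = \<zero>\<^bsub>R\<^esub>"
  "a \<odot>\<^bsub>gr (unit_cpx R) n\<^esub> x = a \<otimes>\<^bsub>R\<^esub> x"
  by (simp_all add: unit_cpx_def)

lemma is_complex_dual:
  fixes M :: "('k, 'm) cpx"
  shows "is_complex R M \<Longrightarrow> is_complex R (dual R M)"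
  by (rule is_complex_inner_hom[OF _ is_complex_unit_cpx])

section \<open>Relabelled complexes\<close>

lemma relabel_linear:
  fixes M :: "('k, 'm) cpx" and \<epsilon> :: "'m \<Rightarrow> 'n"
  assumes "inj \<epsilon>"
  shows "lin (gr M n) (gr (relabel_cpx \<epsilon> M) n) \<epsilon>"
    "lin (gr (relabel_cpx \<epsilon> M) n) (gr M n) (inv_into UNIV \<epsilon>)"
    "x \<in> elts M n \<Longrightarrow> dif (relabel_cpx \<epsilon> M) n (\<epsilon> x) = \<epsilon> (dif M n x)"
    "elts (relabel_cpx \<epsilon> M) n = \<epsilon> ` elts M n"
    "y \<in> elts (relabel_cpx \<epsilon> M) n \<Longrightarrow> inv_into UNIV \<epsilon> (dif (relabel_cpx \<epsilon> M) n y) = dif M n (inv_into UNIV \<epsilon> y)"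
    "\<epsilon> x \<oplus>\<^bsub>gr (relabel_cpx \<epsilon> M) n\<^esub> \<epsilon> x' = \<epsilon> (x \<oplus>\<^bsub>gr M n\<^esub> x')"
    "\<zero>\<^bsub>gr (relabel_cpx \<epsilon> M) n\<^esub> = \<epsilon> \<zero>\<^bsub>gr M n\<^esub>"
    "a \<odot>\<^bsub>gr (relabel_cpx \<epsilon> M) n\<^esub> \<epsilon> x = \<epsilon> (a \<odot>\<^bsub>gr M n\<^esub> x)"
  using assms by (auto simp: linear_map_def relabel_cpx_def Let_def)

lemma is_complex_relabel:
  fixes M :: "('k, 'm) cpx" and \<epsilon> :: "'m \<Rightarrow> 'n"
  assumes M: "is_complex R M" and \<epsilon>: "inj \<epsilon>"
  shows "is_complex R (relabel_cpx \<epsilon> M)"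
proof -
  note r = relabel_linear[OF \<epsilon>]
  note m = is_complexD(1)[OF M]
  have "module R (gr (relabel_cpx \<epsilon> M) n)" for n
  proof -
    interpret kmod R "gr M n" by (rule kmod[OF m])
    have "\<exists>y\<in>\<epsilon> ` elts M n. y \<oplus>\<^bsub>gr (relabel_cpx \<epsilon> M) n\<^esub> \<epsilon> x = \<epsilon> \<zero>\<^bsub>gr M n\<^esub>"
      if "x \<in> elts M n" for x
      using that by (intro bexI[of _ "\<epsilon> (\<ominus>\<^bsub>gr M n\<^esub> x)"]) (auto simp: r(6) l_neg)
    then show ?thesis
      by (intro moduleI[OF ground_cring abelian_groupI])
        (auto simp: r(4,6,7,8) a_ac smult_l_distr smult_r_distr smult_assoc1)
  qed
  moreover have "lin (gr (relabel_cpx \<epsilon> M) n) (gr (relabel_cpx \<epsilon> M) (n + 1)) (dif (relabel_cpx \<epsilon> M) n)" for n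
    using m linear_mapD[OF is_complexD(2)[OF M]]
    by (intro linear_mapI) (auto simp: r(3,4,6,8))
  ultimately show ?thesis
    using is_complexD(3,4)[OF M] by (auto simp: is_complex_def r(3,4,7))
qed


subsection \<open>Morphisms of the homotopy category\<close>

lemma hdeg_simps [simp]: "hdeg [] = 0" "hdeg (x # xs) = fst x + hdeg xs"
  by (simp_all add: hdeg_def)

lemma args_in_iff:
  "args_in [M] xs \<longleftrightarrow> (\<exists>a x. xs = [(a, x)] \<and> x \<in> elts M a)"
  "args_in [M, N] xs \<longleftrightarrow> (\<exists>a x b y. xs = [(a, x), (b, y)] \<and> x \<in> elts M a \<and> y \<in> elts N b)"
  "args_in [M, N, L] xs \<longleftrightarrow> (\<exists>a x b y c z. xs = [(a, x), (b, y), (c, z)] \<and>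
     x \<in> elts M a \<and> y \<in> elts N b \<and> z \<in> elts L c)"
  by (fastforce simp: args_in_def list_all2_Cons1)+

lemma all_args_in:
  "(\<forall>xs. args_in [M] xs \<longrightarrow> Q xs) \<longleftrightarrow> (\<forall>a. \<forall>x\<in>elts M a. Q [(a, x)])"
  "(\<forall>xs. args_in [M, N] xs \<longrightarrow> Q xs) \<longleftrightarrow>
     (\<forall>a b. \<forall>x\<in>elts M a. \<forall>y\<in>elts N b. Q [(a, x), (b, y)])"
  "(\<forall>xs. args_in [M, N, L] xs \<longrightarrow> Q xs) \<longleftrightarrow>
     (\<forall>a b c. \<forall>x\<in>elts M a. \<forall>y\<in>elts N b. \<forall>z\<in>elts L c.
        Q [(a, x), (b, y), (c, z)])"
  by (fastforce simp: args_in_iff)+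

text \<open>The linearity clause of \<open>multilinear\<close> is guarded by an argument list, so it
  says something only where such a list exists. The zero elements of the complex supply one in every
  degree.\<close>

lemma multilinear1_iff:
  fixes M :: "('k, 'm) cpx" and P :: "('k, 'p) cpx"
  assumes "is_complex R M"
  shows "multilinear R [M] P e F \<longleftrightarrow> (\<forall>a. lin (gr M a) (gr P (a + e)) (\<lambda>x. F [(a, x)]))"
    (is "?L \<longleftrightarrow> ?R")
proof
  assume L: ?L
  have z: "\<zero>\<^bsub>gr M a\<^esub> \<in> elts M a" for a
    using is_complexD(1)[OF assms] by auto
  show ?R
    using L[unfolded multilinear_def, rule_format, of "[(_, \<zero>\<^bsub>gr M _\<^esub>)]"] z
    by (auto simp: args_in_iff)
next
  assume ?R
  then show ?L
    using linear_mapD(1)[OF spec[OF \<open>?R\<close>]] by (auto simp: multilinear_def args_in_iff)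
qed

lemma multilinear2_iff:
  fixes M N :: "('k, 'm) cpx" and P :: "('k, 'p) cpx"
  assumes "is_complex R M" "is_complex R N"
  shows "multilinear R [M, N] P e F \<longleftrightarrow>
    (\<forall>a b. \<forall>y\<in>elts N b. lin (gr M a) (gr P (a + b + e)) (\<lambda>x. F [(a, x), (b, y)])) \<and>
    (\<forall>a b. \<forall>x\<in>elts M a. lin (gr N b) (gr P (a + b + e)) (\<lambda>y. F [(a, x), (b, y)]))"
    (is "?L \<longleftrightarrow> ?R")
proof
  assume L: ?L
  have z: "\<zero>\<^bsub>gr M a\<^esub> \<in> elts M a" "\<zero>\<^bsub>gr N a\<^esub> \<in> elts N a" for a
    using is_complexD(1)[OF assms(1)] is_complexD(1)[OF assms(2)] by auto
  show ?R
  proof (intro conjI allI ballI)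
    show "lin (gr M a) (gr P (a + b + e)) (\<lambda>x. F [(a, x), (b, y)])" if "y \<in> elts N b" for a b y
      using L[unfolded multilinear_def, rule_format, of "[(a, \<zero>\<^bsub>gr M a\<^esub>), (b, y)]"] that z
      by (auto simp: args_in_iff dest: spec[of _ 0])
    show "lin (gr N b) (gr P (a + b + e)) (\<lambda>y. F [(a, x), (b, y)])" if "x \<in> elts M a" for a b x
      using L[unfolded multilinear_def, rule_format, of "[(a, x), (b, \<zero>\<^bsub>gr N b\<^esub>)]"] that z
      by (auto simp: args_in_iff dest: spec[of _ 1])
  qed
next
  assume ?R
  then show ?L
    using linear_mapD(1)[OF bspec[OF spec[OF spec[OF conjunct1[OF \<open>?R\<close>]]]]]
    by (auto simp: multilinear_def args_in_iff less_Suc_eq nth_Cons')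
qed

lemma multilinear3I:
  fixes M N L :: "('k, 'm) cpx" and P :: "('k, 'p) cpx"
  assumes "\<And>a b c y z. y \<in> elts N b \<Longrightarrow> z \<in> elts L c \<Longrightarrow>
      lin (gr M a) (gr P (a + b + c + e)) (\<lambda>x. F [(a, x), (b, y), (c, z)])"
    and "\<And>a b c x z. x \<in> elts M a \<Longrightarrow> z \<in> elts L c \<Longrightarrow>
      lin (gr N b) (gr P (a + b + c + e)) (\<lambda>y. F [(a, x), (b, y), (c, z)])"
    and "\<And>a b c x y. x \<in> elts M a \<Longrightarrow> y \<in> elts N b \<Longrightarrow>
      lin (gr L c) (gr P (a + b + c + e)) (\<lambda>z. F [(a, x), (b, y), (c, z)])"
  shows "multilinear R [M, N, L] P e F"
  using assms linear_mapD(1)[OF assms(1)]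
  by (auto simp: multilinear_def args_in_iff less_Suc_eq nth_Cons' add.assoc)

lemma after_dif_simps:
  "after_dif [M] N F [(a, x)] = F [(a + 1, dif M a x)] \<oplus>\<^bsub>N\<^esub> \<zero>\<^bsub>N\<^esub>"
  "after_dif [M, M'] N F [(a, x), (b, y)] = sgm N b (F [(a + 1, dif M a x), (b, y)]) \<oplus>\<^bsub>N\<^esub>
     (F [(a, x), (b + 1, dif M' b y)] \<oplus>\<^bsub>N\<^esub> \<zero>\<^bsub>N\<^esub>)"
  "after_dif [M, M', M''] N F [(a, x), (b, y), (c, z)] =
     sgm N (b + c) (F [(a + 1, dif M a x), (b, y), (c, z)]) \<oplus>\<^bsub>N\<^esub>
     (sgm N c (F [(a, x), (b + 1, dif M' b y), (c, z)]) \<oplus>\<^bsub>N\<^esub>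
     (F [(a, x), (b, y), (c + 1, dif M'' c z)] \<oplus>\<^bsub>N\<^esub> \<zero>\<^bsub>N\<^esub>))"
  by (simp_all add: after_dif_def upt_rec)

lemma K_mor1_iff:
  assumes M: "is_complex R M" and P: "is_complex R P"
  shows "K_mor R [M] P F \<longleftrightarrow>
    (\<forall>a. lin (gr M a) (gr P a) (\<lambda>x. F [(a, x)])) \<and>
    (\<forall>a. \<forall>x\<in>elts M a. dif P a (F [(a, x)]) = F [(a + 1, dif M a x)])"
proof -
  \<comment> \<open>Membership lets the simplifier drop the zero with which \<open>lsum\<close>
    ends. The analogous facts below serve the same purpose.\<close>
  have "F [(a + 1, dif M a x)] \<in> elts P (a + 1)"
    if "\<forall>a. lin (gr M a) (gr P a) (\<lambda>x. F [(a, x)])" "x \<in> elts M a" for a x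
    using linear_mapD(1)[OF that(1)[rule_format, of "a + 1"]] is_complexD(4)[OF M that(2)] .
  then show ?thesis
    using is_complexD(1)[OF P]
    by (auto simp: K_mor_def multilinear1_iff[OF M] all_args_in after_dif_simps)
qed

lemma K_mor2_iff:
  assumes M: "is_complex R M" and N: "is_complex R N" and P: "is_complex R P"
  shows "K_mor R [M, N] P F \<longleftrightarrow>
    (\<forall>a b. \<forall>y\<in>elts N b. lin (gr M a) (gr P (a + b)) (\<lambda>x. F [(a, x), (b, y)])) \<and>
    (\<forall>a b. \<forall>x\<in>elts M a. lin (gr N b) (gr P (a + b)) (\<lambda>y. F [(a, x), (b, y)])) \<and>
    (\<forall>a b. \<forall>x\<in>elts M a. \<forall>y\<in>elts N b. dif P (a + b) (F [(a, x), (b, y)]) =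
       sgm (gr P (a + b + 1)) b (F [(a + 1, dif M a x), (b, y)]) \<oplus>\<^bsub>gr P (a + b + 1)\<^esub>
       F [(a, x), (b + 1, dif N b y)])"
proof -
  have "F [(a, x), (b + 1, dif N b y)] \<in> elts P (a + b + 1)"
    if "\<forall>a b. \<forall>x\<in>elts M a. lin (gr N b) (gr P (a + b)) (\<lambda>y. F [(a, x), (b, y)])"
      "x \<in> elts M a" "y \<in> elts N b" for a x b y
    using linear_mapD(1)[OF that(1)[rule_format, of x a "b + 1"] is_complexD(4)[OF N that(3)]] that
    by (simp add: add.assoc)
  then show ?thesis
    using is_complexD(1)[OF P]
    by (auto simp: K_mor_def multilinear2_iff[OF M N] all_args_in after_dif_simps)
qed

lemma K_eq1_iff:
  assumes M: "is_complex R M" and P: "is_complex R P"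
  shows "K_eq R [M] P F G \<longleftrightarrow>
    (\<exists>H. (\<forall>a. lin (gr M a) (gr P (a - 1)) (H a)) \<and>
      (\<forall>a. \<forall>x\<in>elts M a. F [(a, x)] \<ominus>\<^bsub>gr P a\<^esub> G [(a, x)] =
         dif P (a - 1) (H a x) \<oplus>\<^bsub>gr P a\<^esub> H (a + 1) (dif M a x)))" (is "?L \<longleftrightarrow> (\<exists>H. ?lin H \<and> ?htp H)")
proof -
  have mem: "H (a + 1) (dif M a x) \<in> elts P a"
    if "?lin H" "x \<in> elts M a" for H a x
    using linear_mapD(1)[OF that(1)[rule_format, of "a + 1"] is_complexD(4)[OF M that(2)]] by simp
  show ?thesis
  proof
    assume ?L
    then obtain H where H: "multilinear R [M] P (- 1) H"
      "\<forall>xs. args_in [M] xs \<longrightarrow> F xs \<ominus>\<^bsub>gr P (hdeg xs)\<^esub> G xs =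
             dif P (hdeg xs - 1) (H xs) \<oplus>\<^bsub>gr P (hdeg xs)\<^esub> after_dif [M] (gr P (hdeg xs)) H xs"
      by (auto simp: K_eq_def)
    let ?H = "\<lambda>a x. H [(a, x)]"
    have "?lin ?H"
      using H(1) by (simp add: multilinear1_iff[OF M])
    then show "\<exists>H. ?lin H \<and> ?htp H"
      using mem[of ?H] H(2)[unfolded all_args_in] is_complexD(1)[OF P]
      by (intro exI[of _ ?H]) (simp add: after_dif_simps all_args_in)
  next
    assume "\<exists>H. ?lin H \<and> ?htp H"
    then obtain H where H: "?lin H" "?htp H" by (elim exE conjE)
    show ?L unfolding K_eq_def all_args_in
      using H mem[OF H(1)] is_complexD(1)[OF P]
      by (intro exI[of _ "\<lambda>xs. H (fst (xs ! 0)) (snd (xs ! 0))"])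
        (auto simp: multilinear1_iff[OF M] after_dif_simps all_args_in)
  qed
qed

lemma K_eq2_iff:
  assumes M: "is_complex R M" and N: "is_complex R N" and P: "is_complex R P"
  shows "K_eq R [M, N] P F G \<longleftrightarrow>
    (\<exists>H. (\<forall>a b. \<forall>y\<in>elts N b. lin (gr M a) (gr P (a + b - 1)) (\<lambda>x. H a x b y)) \<and>
      (\<forall>a b. \<forall>x\<in>elts M a. lin (gr N b) (gr P (a + b - 1)) (\<lambda>y. H a x b y)) \<and>
      (\<forall>a b. \<forall>x\<in>elts M a. \<forall>y\<in>elts N b.
         F [(a, x), (b, y)] \<ominus>\<^bsub>gr P (a + b)\<^esub> G [(a, x), (b, y)] =
         dif P (a + b - 1) (H a x b y) \<oplus>\<^bsub>gr P (a + b)\<^esub>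
          (sgm (gr P (a + b)) b (H (a + 1) (dif M a x) b y) \<oplus>\<^bsub>gr P (a + b)\<^esub> H a x (b + 1) (dif N b y))))"
    (is "?L \<longleftrightarrow> (\<exists>H. ?lin1 H \<and> ?lin2 H \<and> ?htp H)")
proof -
  have mem: "H a x (b + 1) (dif N b y) \<in> elts P (a + b)"
    if "?lin2 H" "x \<in> elts M a" "y \<in> elts N b" for H a x b y
    using linear_mapD(1)[OF that(1)[rule_format, of x a "b + 1"] is_complexD(4)[OF N that(3)]] that by simp
  show ?thesis
  proof
    assume ?L
    then obtain H where H: "multilinear R [M, N] P (- 1) H"
      "\<forall>xs. args_in [M, N] xs \<longrightarrow> F xs \<ominus>\<^bsub>gr P (hdeg xs)\<^esub> G xs =
             dif P (hdeg xs - 1) (H xs) \<oplus>\<^bsub>gr P (hdeg xs)\<^esub> after_dif [M, N] (gr P (hdeg xs)) H xs"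
      by (auto simp: K_eq_def)
    let ?H = "\<lambda>a x b y. H [(a, x), (b, y)]"
    have "?lin1 ?H" "?lin2 ?H"
      using H(1) by (simp_all add: multilinear2_iff[OF M N])
    then show "\<exists>H. ?lin1 H \<and> ?lin2 H \<and> ?htp H"
      using mem[of ?H] H(2)[unfolded all_args_in] is_complexD(1)[OF P]
      by (intro exI[of _ ?H]) (simp add: after_dif_simps all_args_in)
  next
    assume "\<exists>H. ?lin1 H \<and> ?lin2 H \<and> ?htp H"
    then obtain H where H: "?lin1 H" "?lin2 H" "?htp H" by (elim exE conjE)
    show ?L unfolding K_eq_def all_args_in
      using H mem[OF H(2)] is_complexD(1)[OF P]
      by (intro exI[of _ "\<lambda>xs. H (fst (xs ! 0)) (snd (xs ! 0)) (fst (xs ! 1)) (snd (xs ! 1))"])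
        (auto simp: multilinear2_iff[OF M N] after_dif_simps all_args_in)
  qed
qed

text \<open>An introduction rule suffices, since the only homotopy in three variables is the one
  built from \<open>b_3\<close>.\<close>

lemma K_eq3I:
  assumes M: "is_complex R M" and N: "is_complex R N" and L: "is_complex R L" and P: "is_complex R P"
    and H: "\<And>a b c y z. y \<in> elts N b \<Longrightarrow> z \<in> elts L c \<Longrightarrow>
      lin (gr M a) (gr P (a + b + c - 1)) (\<lambda>x. H a x b y c z)"
    "\<And>a b c x z. x \<in> elts M a \<Longrightarrow> z \<in> elts L c \<Longrightarrow>
      lin (gr N b) (gr P (a + b + c - 1)) (\<lambda>y. H a x b y c z)"
    "\<And>a b c x y. x \<in> elts M a \<Longrightarrow> y \<in> elts N b \<Longrightarrow>
      lin (gr L c) (gr P (a + b + c - 1)) (\<lambda>z. H a x b y c z)"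
    and eq: "\<And>a b c x y z. x \<in> elts M a \<Longrightarrow> y \<in> elts N b \<Longrightarrow> z \<in> elts L c \<Longrightarrow>
      F [(a, x), (b, y), (c, z)] \<ominus>\<^bsub>gr P (a + b + c)\<^esub> G [(a, x), (b, y), (c, z)] =
         dif P (a + b + c - 1) (H a x b y c z) \<oplus>\<^bsub>gr P (a + b + c)\<^esub>
          (sgm (gr P (a + b + c)) (b + c) (H (a + 1) (dif M a x) b y c z) \<oplus>\<^bsub>gr P (a + b + c)\<^esub>
          (sgm (gr P (a + b + c)) c (H a x (b + 1) (dif N b y) c z) \<oplus>\<^bsub>gr P (a + b + c)\<^esub>
           H a x b y (c + 1) (dif L c z)))"
  shows "K_eq R [M, N, L] P F G"
proof -
  have mem: "H a x b y (c + 1) (dif L c z) \<in> elts P (a + b + c)"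
    if "x \<in> elts M a" "y \<in> elts N b" "z \<in> elts L c" for a x b y c z
    using linear_mapD(1)[OF H(3)[of x a y b "c + 1"] is_complexD(4)[OF L that(3)]] that by (simp add: add.assoc)
  show ?thesis unfolding K_eq_def all_args_in
    using H eq mem is_complexD(1)[OF P]
    by (intro exI[of _ "\<lambda>xs. H (fst (xs ! 0)) (snd (xs ! 0)) (fst (xs ! 1)) (snd (xs ! 1)) (fst (xs ! 2)) (snd (xs ! 2))"])
      (auto intro!: multilinear3I simp: after_dif_simps all_args_in add.assoc[symmetric])
qed

end

section \<open>Projecting tensor identities to components\<close>

text \<open>The projection of a path to the summand \<open>sA(X, Y)\<close> of degree
  \<open>d\<close> in the tensor coalgebra. The default value zero kills all paths of another
  length, with other end points or of another degree.\<close>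

definition proj1 :: "('k, 'o, 'h) ainf \<Rightarrow> 'o \<Rightarrow> 'o \<Rightarrow> int \<Rightarrow> ('o, 'h) path \<Rightarrow> 'h" where
  "proj1 A X Y d p = (if fst p = X \<and> (\<exists>x. snd p = [(Y, d, x)]) then snd (snd (hd (snd p)))
     else \<zero>\<^bsub>mor A X Y (d + 1)\<^esub>)"

definition lin1 :: "('k, 'o, 'h) ainf \<Rightarrow> 'o \<Rightarrow> 'o \<Rightarrow> int \<Rightarrow> ('k, 'o, 'h) fsum \<Rightarrow> 'h" where
  "lin1 A X Y d L = lsum (mor A X Y (d + 1)) (map (\<lambda>(c, p). c \<odot>\<^bsub>mor A X Y (d + 1)\<^esub> proj1 A X Y d p) L)"

lemma proj1_simps [simp]:
  "d' = d \<Longrightarrow> proj1 A X Y d (X, [(Y, d', x)]) = x"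
  "proj1 A X Y d (X', []) = \<zero>\<^bsub>mor A X Y (d + 1)\<^esub>"
  "proj1 A X Y d (X', l # l' # w) = \<zero>\<^bsub>mor A X Y (d + 1)\<^esub>"
  by (auto simp: proj1_def)

lemma composable_append:
  "composable A X (u @ w) \<longleftrightarrow> composable A X u \<and> composable A (end_of X u) w"
proof (induction A X u rule: composable.induct)
  case (1 A X)
  then show ?case by (cases w) auto
qed auto

lemma composable_objs: "composable A X u \<Longrightarrow> X \<in> obj A \<and> end_of X u \<in> obj A"
  by (induction A X u rule: composable.induct) auto

lemma is_fsum_simps [simp]:
  "is_fsum R A []"
  "is_fsum R A ((c, p) # L) \<longleftrightarrow> c \<in> carrier R \<and> is_path A p \<and> is_fsum R A L"
  "is_fsum R A (L @ M) \<longleftrightarrow> is_fsum R A L \<and> is_fsum R A M"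
  by (auto simp: is_fsum_def)

lemma is_path_simps [simp]:
  "is_path A (X, []) \<longleftrightarrow> X \<in> obj A"
  "is_path A (X, (Y, d, x) # w) \<longleftrightarrow> X \<in> obj A \<and> x \<in> carrier (mor A X Y (d + 1)) \<and> is_path A (Y, w)"
  by (auto simp: is_path_def)

lemma degree_simps [simp]:
  "wdeg [] = 0" "wdeg ((Y, d, x) # w) = d + wdeg w"
  "pdeg (X, w) = wdeg w" "ptgt (X, w) = end_of X w"
  "tdeg [] = 0" "tdeg (p # ps) = pdeg p + tdeg ps"
  "tlen [] = 0" "tlen (p # ps) = length (snd p) + tlen ps"
  by (simp_all add: wdeg_def pdeg_def ptgt_def tdeg_def tlen_def)

lemma lin_ext_simps [simp]:
  "lin_ext R F [] = []"
  "lin_ext R F ((c, p) # L) = map (\<lambda>(c', q). (c \<otimes>\<^bsub>R\<^esub> c', q)) (F p) @ lin_ext R F L"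
  by (simp_all add: lin_ext_def)

lemma lin1_simps [simp]:
  "lin1 A X Y d [] = \<zero>\<^bsub>mor A X Y (d + 1)\<^esub>"
  "lin1 A X Y d ((c, p) # L) = c \<odot>\<^bsub>mor A X Y (d + 1)\<^esub> proj1 A X Y d p \<oplus>\<^bsub>mor A X Y (d + 1)\<^esub> lin1 A X Y d L"
  by (simp_all add: lin1_def)

context ground
begin

lemma proj1_closed:
  assumes "module R (mor A X Y (d + 1))" and "is_path A p"
  shows "proj1 A X Y d p \<in> carrier (mor A X Y (d + 1))"
  using assms by (cases p) (auto simp: proj1_def)

lemma lin1_closed:
  assumes "module R (mor A X Y (d + 1))" and "is_fsum R A L"
  shows "lin1 A X Y d L \<in> carrier (mor A X Y (d + 1))"
  using assms by (induction L) (auto simp: proj1_closed)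

lemma lin1_append:
  assumes M: "module R (mor A X Y (d + 1))" and "is_fsum R A L" "is_fsum R A L'"
  shows "lin1 A X Y d (L @ L') = lin1 A X Y d L \<oplus>\<^bsub>mor A X Y (d + 1)\<^esub> lin1 A X Y d L'"
proof -
  interpret kmod R "mor A X Y (d + 1)" by (rule kmod[OF M])
  show ?thesis
    using assms(2,3) by (induction L) (auto simp: proj1_closed M lin1_closed a_assoc)
qed

lemma lin1_scale:
  assumes M: "module R (mor A X Y (d + 1))" and c: "c \<in> carrier R" and L: "is_fsum R A L"
  shows "lin1 A X Y d (map (\<lambda>(c', q). (c \<otimes>\<^bsub>R\<^esub> c', q)) L) = c \<odot>\<^bsub>mor A X Y (d + 1)\<^esub> lin1 A X Y d L"
  using L by (induction L) (auto simp: M c smult_distrib proj1_closed lin1_closed)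

text \<open>Well-formedness of the extension is proved along with the formula, because
  \<open>lin1_append\<close> needs it in the induction step.\<close>

lemma lin1_lin_ext:
  assumes M: "module R (mor A X Y (d + 1))"
    and "\<And>c p. (c, p) \<in> set L \<Longrightarrow> c \<in> carrier R \<and> is_fsum R A (F p)"
  shows "lin1 A X Y d (lin_ext R F L) =
    lsum (mor A X Y (d + 1)) (map (\<lambda>(c, p). c \<odot>\<^bsub>mor A X Y (d + 1)\<^esub> lin1 A X Y d (F p)) L) \<and>
    is_fsum R A (lin_ext R F L)"
  using assms(2)
proof (induction L)
  case (Cons cp L)
  interpret cring R by (rule ground_cring)
  obtain c p where cp: "cp = (c, p)" by (cases cp)
  have c: "c \<in> carrier R" "is_fsum R A (F p)" using Cons.prems[of c p] cp by auto
  have f: "is_fsum R A (map (\<lambda>(c', q). (c \<otimes>\<^bsub>R\<^esub> c', q)) (F p))"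
    using c by (auto simp: is_fsum_def)
  have IH: "lin1 A X Y d (lin_ext R F L) =
    lsum (mor A X Y (d + 1)) (map (\<lambda>(c, p). c \<odot>\<^bsub>mor A X Y (d + 1)\<^esub> lin1 A X Y d (F p)) L) \<and>
    is_fsum R A (lin_ext R F L)"
    by (rule Cons.IH) (use Cons.prems in auto)
  then show ?case using f c by (simp add: cp lin1_append M lin1_scale)
qed simp

lemma lin1_lin_ext_list:
  assumes "module R (mor A X Y (d + 1))" and "list_all (\<lambda>(c, p). c \<in> carrier R \<and> is_fsum R A (F p)) L"
  shows "lin1 A X Y d (lin_ext R F L) =
    lsum (mor A X Y (d + 1)) (map (\<lambda>(c, p). c \<odot>\<^bsub>mor A X Y (d + 1)\<^esub> lin1 A X Y d (F p)) L)"
  using lin1_lin_ext[OF assms(1), of L F] assms(2) by (auto simp: list_all_iff)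

text \<open>The module conditions are split off from \<open>ainf_category\<close> so that projected
  identities are available for \<open>Cdg R\<close> from its modules alone.\<close>

definition kquiver :: "('k, 'o, 'h) ainf \<Rightarrow> bool" where
  "kquiver A \<longleftrightarrow> (\<forall>X\<in>obj A. \<forall>Y\<in>obj A. \<forall>n. module R (mor A X Y n))"

lemma kquiverD: "kquiver A \<Longrightarrow> X \<in> obj A \<Longrightarrow> Y \<in> obj A \<Longrightarrow> module R (mor A X Y n)"
  by (simp add: kquiver_def)

lemma is_path_insert:
  fixes A :: "('k, 'o, 'h) ainf"
  assumes mods: "kquiver A"
    and p: "is_path A (X, u @ (Y, d, x) # v)"
  shows "end_of X u \<in> obj A" "Y \<in> obj A" "x \<in> carrier (mor A (end_of X u) Y (d + 1))"
    "is_path A (X, u @ (Y, d, y) # v) \<Longrightarrow>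
      is_path A (X, u @ (Y, d, x \<oplus>\<^bsub>mor A (end_of X u) Y (d + 1)\<^esub> y) # v)" (is "PROP ?goal1")
    "a \<in> carrier R \<Longrightarrow> is_path A (X, u @ (Y, d, a \<odot>\<^bsub>mor A (end_of X u) Y (d + 1)\<^esub> x) # v)" (is "PROP ?goal2")
proof -
  show o: "end_of X u \<in> obj A" "Y \<in> obj A" "x \<in> carrier (mor A (end_of X u) Y (d + 1))"
    using p by (auto simp: is_path_def composable_append dest!: composable_objs)
  show "PROP ?goal1"
    "PROP ?goal2"
    using p o kquiverD[OF mods o(1,2)] by (auto simp: is_path_def composable_append)
qed

text \<open>Every generator of the congruence is guarded by well-formedness. In
  \<open>natural_square\<close> this is used backwards, to read off from an identity that all
  entries occurring in it lie in the right modules.\<close>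

lemma tensor_eq_is_fsum:
  fixes A :: "('k, 'o, 'h) ainf"
  assumes mods: "kquiver A"
    and eq: "tensor_eq R A L M"
  shows "is_fsum R A L \<and> is_fsum R A M"
proof -
  interpret c: cring R by (rule ground_cring)
  show ?thesis
    using eq by induction (auto simp: is_path_insert[OF mods])
qed

text \<open>A tensor of length one is just an element of a module. A generating relation at such a
  path of the right end points and degree is a module axiom; at every other path both of its sides
  project to zero.\<close>

lemma tensor_eq_lin1:
  fixes A :: "('k, 'o, 'h) ainf"
  assumes mods: "kquiver A"
    and eq: "tensor_eq R A L M" and X: "X \<in> obj A" and Y: "Y \<in> obj A"
  shows "lin1 A X Y d L = lin1 A X Y d M"
proof -
  interpret c: cring R by (rule ground_cring)
  note m = kquiverD[OF mods X Y]
  interpret kmod R "mor A X Y (d + 1)" by (rule kmod[OF m])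
  note fs = tensor_eq_is_fsum[OF mods]
  have off: "proj1 A X Y d (X', u @ (Y', e, z) # v) = \<zero>\<^bsub>mor A X Y (d + 1)\<^esub>"
    if "\<not> (u = [] \<and> v = [] \<and> X' = X \<and> Y' = Y \<and> e = d)" for X' u Y' e z v
    using that by (auto simp: proj1_def append_eq_Cons_conv)
  show ?thesis
    using eq
  proof induction
    case (append L L' M M')
    then show ?case using fs[OF append(1)] fs[OF append(2)] by (simp add: lin1_append m)
  next
    case (commute L M)
    then show ?case by (simp add: lin1_append m lin1_closed a_comm)
  next
    case (coeff_zero p)
    then show ?case by (simp add: m proj1_closed)
  next
    case (coeff_add c e p)
    then show ?case by (simp add: m proj1_closed smult_l_distr)
  next
    case (add c X' u Y' e x v y)
    note o = is_path_insert(1-3)[OF mods add(2)] is_path_insert(3)[OF mods add(3)]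
    show ?case
      using add o m
      by (cases "u = [] \<and> v = [] \<and> X' = X \<and> Y' = Y \<and> e = d") (auto simp: smult_r_distr off)
  next
    case (smult c a X' u Y' e x v)
    note o = is_path_insert(1-3)[OF mods smult(3)]
    show ?case
      using smult o m
      by (cases "u = [] \<and> v = [] \<and> X' = X \<and> Y' = Y \<and> e = d") (auto simp: smult_assoc1 off)
  qed auto
qed

end

lemma bhat_simps:
  "bhat R A (X, [(Y, d, x)]) = [(\<one>\<^bsub>R\<^esub>, (X, [(Y, d + 1, bmap A (X, [(Y, d, x)]))]))]"
  "bhat R A (X, [(Y, d, x), (Z, e, y)]) =
    [(sg R e, (X, [(Y, d + 1, bmap A (X, [(Y, d, x)])), (Z, e, y)])),
     (\<one>\<^bsub>R\<^esub>, (X, [(Z, d + e + 1, bmap A (X, [(Y, d, x), (Z, e, y)]))])),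
     (\<one>\<^bsub>R\<^esub>, (X, [(Y, d, x), (Z, e + 1, bmap A (Y, [(Z, e, y)]))]))]"
  "bhat R A (X, [(Y, d, x), (Z, e, y), (W, f, z)]) =
    [(sg R (e + f), (X, [(Y, d + 1, bmap A (X, [(Y, d, x)])), (Z, e, y), (W, f, z)])),
     (sg R f, (X, [(Z, d + e + 1, bmap A (X, [(Y, d, x), (Z, e, y)])), (W, f, z)])),
     (\<one>\<^bsub>R\<^esub>, (X, [(W, d + (e + f) + 1, bmap A (X, [(Y, d, x), (Z, e, y), (W, f, z)]))])),
     (sg R f, (X, [(Y, d, x), (Z, e + 1, bmap A (Y, [(Z, e, y)])), (W, f, z)])),
     (\<one>\<^bsub>R\<^esub>, (X, [(Y, d, x), (W, e + f + 1, bmap A (Y, [(Z, e, y), (W, f, z)]))])),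
     (\<one>\<^bsub>R\<^esub>, (X, [(Y, d, x), (Z, e, y), (W, f + 1, bmap A (Z, [(W, f, z)]))]))]"
  "bhat R A (X, []) = []"
  by (simp_all add: bhat_def upt_rec numeral_2_eq_2 numeral_3_eq_3)


section \<open>The homotopy category of a unital A-infinity category\<close>

locale ainf_cat = ground R for R :: "'k ring" +
  fixes A :: "('k, 'o, 'h) ainf"
  assumes ainf: "ainf_category R A"
begin

abbreviation el :: "'o \<Rightarrow> 'o \<Rightarrow> int \<Rightarrow> 'h set" where
  "el X Y n \<equiv> carrier (mor A X Y n)"

lemma mor_module [simp, intro]: "X \<in> obj A \<Longrightarrow> Y \<in> obj A \<Longrightarrow> module R (mor A X Y n)"
  using ainf by (simp add: ainf_category_def)

lemma kquiver [simp, intro]: "kquiver A"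
  by (simp add: kquiver_def)

lemma bmap_closed:
  assumes "is_path A (X, w)"
  shows "bmap A (X, w) \<in> el X (end_of X w) (wdeg w + 2)"
proof -
  have "is_tuple [A] [(X, w)]" using assms by (simp add: is_tuple_def)
  moreover have "components R [A] A hd hd 1 (\<lambda>ws. bmap A (hd ws))"
    using ainf by (simp add: ainf_category_def)
  ultimately show ?thesis
    unfolding components_def by (fastforce simp: add.assoc)
qed

lemma bmap_linear:
  assumes "is_path A (X, u)" and "is_path A (Y, v)" and "end_of X u = Z"
    and "e = wdeg u + d + wdeg v + 2"
  shows "lin (mor A Z Y (d + 1)) (mor A X (end_of Y v) e)
    (\<lambda>x. bmap A (X, u @ (Y, d, x) # v))"
proof -
  have o: "X \<in> obj A" "Z \<in> obj A" "Y \<in> obj A"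
    using assms by (auto simp: is_path_def dest!: composable_objs)
  have eo: "end_of X (u @ w) = end_of (end_of X u) w" for X and u w :: "('o \<times> int \<times> 'h) list"
    by (induction u arbitrary: X) auto
  have ew: "wdeg (u @ w) = wdeg u + wdeg w" for u w :: "('o \<times> int \<times> 'h) list"
    by (simp add: wdeg_def)
  let ?ws = "[(X, u @ (Y, d, \<zero>\<^bsub>mor A Z Y (d + 1)\<^esub>) # v)]"
  have "is_tuple [A] ?ws"
    using assms o module_facts(1)[OF mor_module[OF o(2,3)]]
    by (auto simp: is_tuple_def is_path_def composable_append)
  moreover have "components R [A] A hd hd 1 (\<lambda>ws. bmap A (hd ws))"
    using ainf by (simp add: ainf_category_def)
  ultimately have "lin (mor A Z Y (d + 1)) (mor A X (end_of Y v) (wdeg (u @ (Y, d, \<zero>\<^bsub>mor A Z Y (d + 1)\<^esub>) # v) + 1 + 1))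
    (\<lambda>x. bmap A (X, u @ (Y, d, x) # v))"
    unfolding components_def using assms(3)
    by (auto simp: eo dest!: spec[of _ ?ws] spec[of _ 0])
  then show ?thesis by (simp add: ew assms(4) add.assoc)
qed

end

text \<open>The letters are the terms of \<open>b1_b3\<close>: \<open>u\<close> is
  \<open>b_1\<close> after \<open>b_3\<close>; \<open>v\<close>, \<open>w\<close>, \<open>p\<close>
  are \<open>b_3\<close> after \<open>b_1\<close> in the first, second, third argument;
  \<open>q\<close> and \<open>r\<close> are the two iterates of \<open>b_2\<close>. Solving for
  \<open>r\<close> leaves four cases, since all signs depend on the parities of \<open>b\<close> and
  \<open>c\<close>.\<close>

lemma (in kmod) assoc_identity:
  assumes "u \<in> carrier M" "v \<in> carrier M" "w \<in> carrier M" "p \<in> carrier M" "q \<in> carrier M" "r \<in> carrier M"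
    and "sgm M (b + c) v \<oplus>\<^bsub>M\<^esub> (sgm M (c - 1) q \<oplus>\<^bsub>M\<^esub> (u \<oplus>\<^bsub>M\<^esub> (sgm M (c - 1) w \<oplus>\<^bsub>M\<^esub> (r \<oplus>\<^bsub>M\<^esub> p)))) =
      \<zero>\<^bsub>M\<^esub>"
  shows "sgm M (c + b) q \<ominus>\<^bsub>M\<^esub> sgm M b r = sgm M b u \<oplus>\<^bsub>M\<^esub> (sgm M (b + c) (sgm M b v) \<oplus>\<^bsub>M\<^esub>
    (sgm M c (sgm M (b + 1) w) \<oplus>\<^bsub>M\<^esub> sgm M b p))"
proof -
  have "r = \<ominus>\<^bsub>M\<^esub> (sgm M (b + c) v \<oplus>\<^bsub>M\<^esub> (sgm M (c - 1) q \<oplus>\<^bsub>M\<^esub> (u \<oplus>\<^bsub>M\<^esub>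
      (sgm M (c - 1) w \<oplus>\<^bsub>M\<^esub> p))))"
    using assms by (intro uminus_unique) (simp_all add: a_ac closed_facts simp_facts sgm_facts)
  then show ?thesis
    using assms(1-6)
    by (cases "even b"; cases "even c"; simp add: sgm_def del: minus_add; algebra)
qed

section \<open>The A-infinity relations in arities one to three\<close>

context ainf_cat
begin

text \<open>Degrees are those in the category itself here and in the next two definitions; paths
  count degrees in its suspension, hence \<open>a - 1\<close>.\<close>

definition b1 :: "'o \<Rightarrow> 'o \<Rightarrow> int \<Rightarrow> 'h \<Rightarrow> 'h" where
  "b1 X Y a x = bmap A (X, [(Y, a - 1, x)])"

definition b2 :: "'o \<Rightarrow> 'o \<Rightarrow> 'o \<Rightarrow> int \<Rightarrow> 'h \<Rightarrow> int \<Rightarrow> 'h \<Rightarrow> 'h" where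
  "b2 X Y Z a x b y = bmap A (X, [(Y, a - 1, x), (Z, b - 1, y)])"

definition b3 :: "'o \<Rightarrow> 'o \<Rightarrow> 'o \<Rightarrow> 'o \<Rightarrow> int \<Rightarrow> 'h \<Rightarrow> int \<Rightarrow> 'h \<Rightarrow> int \<Rightarrow> 'h \<Rightarrow> 'h" where
  "b3 X Y Z W a x b y c z = bmap A (X, [(Y, a - 1, x), (Z, b - 1, y), (W, c - 1, z)])"

lemma gr_mor_cpx [simp]: "gr (mor_cpx A X Y) = mor A X Y"
  and dif_mor_cpx: "dif (mor_cpx A X Y) a x = b1 X Y a x"
  by (simp_all add: mor_cpx_def b1_def)

lemma m2_b2: "m2 A X Y Z (a, x) (b, y) = sgm (mor A X Z (a + b)) b (b2 X Y Z a x b y)"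
  by (simp add: m2_def b2_def)

text \<open>Here and below the target degrees are variables, so that the rules apply up to arithmetic.\<close>

lemma b_closed [simp, intro]:
  assumes [simp]: "X \<in> obj A" "Y \<in> obj A"
  shows "x \<in> el X Y a \<Longrightarrow> t = a + 1 \<Longrightarrow> b1 X Y a x \<in> el X Y t"
    "Z \<in> obj A \<Longrightarrow> x \<in> el X Y a \<Longrightarrow> y \<in> el Y Z b \<Longrightarrow> t = a + b \<Longrightarrow>
      b2 X Y Z a x b y \<in> el X Z t"
    "Z \<in> obj A \<Longrightarrow> W \<in> obj A \<Longrightarrow> x \<in> el X Y a \<Longrightarrow> y \<in> el Y Z b \<Longrightarrow>
      z \<in> el Z W c \<Longrightarrow> t = a + b + c - 1 \<Longrightarrow> b3 X Y Z W a x b y c z \<in> el X W t"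
  using bmap_closed[of X "[(Y, a - 1, x)]"] bmap_closed[of X "[(Y, a - 1, x), (Z, b - 1, y)]"]
    bmap_closed[of X "[(Y, a - 1, x), (Z, b - 1, y), (W, c - 1, z)]"]
  by (simp_all add: b1_def b2_def b3_def) (simp_all add: algebra_simps)

lemma b_linear:
  assumes [simp]: "X \<in> obj A" "Y \<in> obj A"
  shows "lin (mor A X Y a) (mor A X Y (a + 1)) (b1 X Y a)"
    "Z \<in> obj A \<Longrightarrow> y \<in> el Y Z b \<Longrightarrow>
      lin (mor A X Y a) (mor A X Z (a + b)) (\<lambda>x. b2 X Y Z a x b y)"
    "Z \<in> obj A \<Longrightarrow> x \<in> el X Y a \<Longrightarrow>
      lin (mor A Y Z b) (mor A X Z (a + b)) (\<lambda>y. b2 X Y Z a x b y)"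
    "Z \<in> obj A \<Longrightarrow> W \<in> obj A \<Longrightarrow> y \<in> el Y Z b \<Longrightarrow> z \<in> el Z W c \<Longrightarrow>
      lin (mor A X Y a) (mor A X W (a + b + c - 1)) (\<lambda>x. b3 X Y Z W a x b y c z)"
    "Z \<in> obj A \<Longrightarrow> W \<in> obj A \<Longrightarrow> x \<in> el X Y a \<Longrightarrow> z \<in> el Z W c \<Longrightarrow>
      lin (mor A Y Z b) (mor A X W (a + b + c - 1)) (\<lambda>y. b3 X Y Z W a x b y c z)"
    "Z \<in> obj A \<Longrightarrow> W \<in> obj A \<Longrightarrow> x \<in> el X Y a \<Longrightarrow> y \<in> el Y Z b \<Longrightarrow>
      lin (mor A Z W c) (mor A X W (a + b + c - 1)) (\<lambda>z. b3 X Y Z W a x b y c z)"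
  using bmap_linear[of X "[]" Y "[]" X "a + 1" "a - 1"]
    bmap_linear[of X "[]" Y "[(Z, b - 1, y)]" X "a + b" "a - 1"]
    bmap_linear[of X "[(Y, a - 1, x)]" Z "[]" Y "a + b" "b - 1"]
    bmap_linear[of X "[]" Y "[(Z, b - 1, y), (W, c - 1, z)]" X "a + b + c - 1" "a - 1"]
    bmap_linear[of X "[(Y, a - 1, x)]" Z "[(W, c - 1, z)]" Y "a + b + c - 1" "b - 1"]
    bmap_linear[of X "[(Y, a - 1, x), (Z, b - 1, y)]" W "[]" Z "a + b + c - 1" "c - 1"]
  by (simp_all add: b1_def[abs_def] b2_def b3_def)

lemma bhat_b:
  "bhat R A (X, [(Y, d, x)]) = [(\<one>\<^bsub>R\<^esub>, (X, [(Y, d + 1, b1 X Y (d + 1) x)]))]"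
  "bhat R A (X, [(Y, d, x), (Z, e, y)]) =
    [(sg R e, (X, [(Y, d + 1, b1 X Y (d + 1) x), (Z, e, y)])),
     (\<one>\<^bsub>R\<^esub>, (X, [(Z, d + 1 + e, b2 X Y Z (d + 1) x (e + 1) y)])),
     (\<one>\<^bsub>R\<^esub>, (X, [(Y, d, x), (Z, e + 1, b1 Y Z (e + 1) y)]))]"
  "bhat R A (X, [(Y, d, x), (Z, e, y), (W, f, z)]) =
    [(sg R (e + f), (X, [(Y, d + 1, b1 X Y (d + 1) x), (Z, e, y), (W, f, z)])),
     (sg R f, (X, [(Z, d + 1 + e, b2 X Y Z (d + 1) x (e + 1) y), (W, f, z)])),
     (\<one>\<^bsub>R\<^esub>, (X, [(W, d + 1 + (e + f), b3 X Y Z W (d + 1) x (e + 1) y (f + 1) z)])),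
     (sg R f, (X, [(Y, d, x), (Z, e + 1, b1 Y Z (e + 1) y), (W, f, z)])),
     (\<one>\<^bsub>R\<^esub>, (X, [(Y, d, x), (W, e + 1 + f, b2 Y Z W (e + 1) y (f + 1) z)])),
     (\<one>\<^bsub>R\<^esub>, (X, [(Y, d, x), (Z, e, y), (W, f + 1, b1 Z W (f + 1) z)]))]"
  by (simp_all add: bhat_simps b1_def b2_def b3_def)

lemma b_closed_shifted:
  "X \<in> obj A \<Longrightarrow> Y \<in> obj A \<Longrightarrow> x \<in> el X Y (d + 1) \<Longrightarrow>
    b1 X Y (d + 1) x \<in> el X Y (d + 1 + 1)"
  "X \<in> obj A \<Longrightarrow> Y \<in> obj A \<Longrightarrow> Z \<in> obj A \<Longrightarrow> x \<in> el X Y (d + 1) \<Longrightarrow>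
    y \<in> el Y Z (e + 1) \<Longrightarrow>
    b2 X Y Z (d + 1) x (e + 1) y \<in> el X Z (d + 1 + e + 1)"
  "X \<in> obj A \<Longrightarrow> Y \<in> obj A \<Longrightarrow> Z \<in> obj A \<Longrightarrow> W \<in> obj A \<Longrightarrow> x \<in> el X Y (d + 1) \<Longrightarrow>
    y \<in> el Y Z (e + 1) \<Longrightarrow> z \<in> el Z W (f + 1) \<Longrightarrow>
    b3 X Y Z W (d + 1) x (e + 1) y (f + 1) z \<in> el X W (d + 1 + (e + f) + 1)"
  by (rule b_closed; simp)+

lemma lin1_bhat:
  assumes o: "X \<in> obj A" "Y \<in> obj A" and x: "x \<in> el X Y (d + 1)"
  shows "t = d + 1 \<Longrightarrow> lin1 A X Y t (bhat R A (X, [(Y, d, x)])) = b1 X Y (d + 1) x"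
    and "is_fsum R A (bhat R A (X, [(Y, d, x)]))"
    and "Z \<in> obj A \<Longrightarrow> y \<in> el Y Z (e + 1) \<Longrightarrow> t = d + 1 + e \<Longrightarrow>
      lin1 A X Z t (bhat R A (X, [(Y, d, x), (Z, e, y)])) = b2 X Y Z (d + 1) x (e + 1) y"
    and "Z \<in> obj A \<Longrightarrow> y \<in> el Y Z (e + 1) \<Longrightarrow>
      is_fsum R A (bhat R A (X, [(Y, d, x), (Z, e, y)]))"
    and "Z \<in> obj A \<Longrightarrow> W \<in> obj A \<Longrightarrow> y \<in> el Y Z (e + 1) \<Longrightarrow>
      z \<in> el Z W (f + 1) \<Longrightarrow> t = d + 1 + (e + f) \<Longrightarrow>
      lin1 A X W t (bhat R A (X, [(Y, d, x), (Z, e, y), (W, f, z)])) =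
        b3 X Y Z W (d + 1) x (e + 1) y (f + 1) z"
    and "Z \<in> obj A \<Longrightarrow> W \<in> obj A \<Longrightarrow> y \<in> el Y Z (e + 1) \<Longrightarrow>
      z \<in> el Z W (f + 1) \<Longrightarrow>
      is_fsum R A (bhat R A (X, [(Y, d, x), (Z, e, y), (W, f, z)]))"
  using o x
  by (simp_all only: bhat_b lin1_simps proj1_simps is_fsum_simps is_path_simps b_closed_shifted
      one_closed sg_closed mor_module module_simps module_facts)

text \<open>Projected to length one, the outer \<open>bhat\<close> keeps only the operation that
  consumes a whole path. Hence every summand of \<open>bhat R A (X, w)\<close> contributes exactly
  one term. The list \<open>L\<close> is a parameter so that it can be given in evaluated
  form.\<close>

lemma b_square:
  assumes w: "is_path A (X, w)" and Y: "Y = end_of X w" and L: "bhat R A (X, w) = L" and "is_fsum R A L"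
    and "list_all (\<lambda>(c, p). is_fsum R A (bhat R A p)) L"
  shows "lsum (mor A X Y (d + 1)) (map (\<lambda>(c, p). c \<odot>\<^bsub>mor A X Y (d + 1)\<^esub> lin1 A X Y d (bhat R A p)) L) =
    \<zero>\<^bsub>mor A X Y (d + 1)\<^esub>"
proof -
  have o: "X \<in> obj A" "Y \<in> obj A" using w Y by (auto simp: is_path_def dest!: composable_objs)
  have "tensor_eq R A (lin_ext R (bhat R A) (bhat R A (X, w))) []"
    using ainf w by (simp add: ainf_category_def)
  then have "lin1 A X Y d (lin_ext R (bhat R A) (bhat R A (X, w))) = \<zero>\<^bsub>mor A X Y (d + 1)\<^esub>"
    using tensor_eq_lin1[OF kquiver _ o] by (metis lin1_simps(1))
  moreover have "c \<in> carrier R \<and> is_fsum R A (bhat R A p)" if "(c, p) \<in> set L" for c p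
  proof
    show "c \<in> carrier R" using assms(4) that by (auto simp: is_fsum_def)
    show "is_fsum R A (bhat R A p)" using assms(5) that by (auto simp: list_all_iff)
  qed
  ultimately show ?thesis
    using lin1_lin_ext[OF mor_module[OF o], of L "bhat R A" d] L by simp
qed

lemma b1_b1:
  assumes [simp]: "X \<in> obj A" "Y \<in> obj A" and x: "x \<in> el X Y a"
  shows "b1 X Y (a + 1) (b1 X Y a x) = \<zero>\<^bsub>mor A X Y (a + 2)\<^esub>"
  using b_square[of X "[(Y, a - 1, x)]" Y _ "a + 1"] x
  by (simp add: bhat_b(1)[of X Y "a - 1"] lin1_bhat ac_simps)

lemma b1_b2:
  assumes [simp]: "X \<in> obj A" "Y \<in> obj A" "Z \<in> obj A"
    and x: "x \<in> el X Y a" and y: "y \<in> el Y Z b"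
  shows "sgm (mor A X Z (a + b + 1)) (b - 1) (b2 X Y Z (a + 1) (b1 X Y a x) b y)
    \<oplus>\<^bsub>mor A X Z (a + b + 1)\<^esub> (b1 X Z (a + b) (b2 X Y Z a x b y)
    \<oplus>\<^bsub>mor A X Z (a + b + 1)\<^esub> b2 X Y Z a x (b + 1) (b1 Y Z b y)) = \<zero>\<^bsub>mor A X Z (a + b + 1)\<^esub>"
  using b_square[of X "[(Y, a - 1, x), (Z, b - 1, y)]" Z _ "a + b"] x y
    bhat_b(2)[of X Y "a - 1" x Z "b - 1" y]
  by (auto simp: lin1_bhat)

text \<open>The exponents are suspended degrees of the factors that an operation passes:
  \<open>c - 1\<close> for one factor, and \<open>(b - 1) + (c - 1)\<close>, of the parity of
  \<open>b + c\<close>, for two.\<close>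

lemma b1_b3:
  assumes [simp]: "X \<in> obj A" "Y \<in> obj A" "Z \<in> obj A" "W \<in> obj A"
    and x: "x \<in> el X Y a" and y: "y \<in> el Y Z b" and z: "z \<in> el Z W c"
  shows "sgm (mor A X W (a + b + c)) (b + c) (b3 X Y Z W (a + 1) (b1 X Y a x) b y c z)
    \<oplus>\<^bsub>mor A X W (a + b + c)\<^esub> (sgm (mor A X W (a + b + c)) (c - 1) (b2 X Z W (a + b) (b2 X Y Z a x b y) c z)
    \<oplus>\<^bsub>mor A X W (a + b + c)\<^esub> (b1 X W (a + b + c - 1) (b3 X Y Z W a x b y c z)
    \<oplus>\<^bsub>mor A X W (a + b + c)\<^esub> (sgm (mor A X W (a + b + c)) (c - 1) (b3 X Y Z W a x (b + 1) (b1 Y Z b y) c z)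
    \<oplus>\<^bsub>mor A X W (a + b + c)\<^esub> (b2 X Y W a x (b + c) (b2 Y Z W b y c z)
    \<oplus>\<^bsub>mor A X W (a + b + c)\<^esub> b3 X Y Z W a x b y (c + 1) (b1 Z W c z))))) = \<zero>\<^bsub>mor A X W (a + b + c)\<^esub>"
proof -
  have e: "a + (b + c) - 1 = a + b + c - 1" by simp
  show ?thesis
    using b_square[of X "[(Y, a - 1, x), (Z, b - 1, y), (W, c - 1, z)]" W _ "a + b + c - 1"] x y z
      bhat_b(3)[of X Y "a - 1" x Z "b - 1" y W "c - 1" z]
    by (auto simp: lin1_bhat sgm_parity[of "b + c - 2" "b + c"] e)
qed


lemma is_complex_mor_cpx [simp, intro]:
  assumes [simp]: "X \<in> obj A" "Y \<in> obj A"
  shows "is_complex R (mor_cpx A X Y)"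
  using b_linear(1)[of X Y] b1_b1[of X Y]
  by (auto simp: is_complex_def dif_mor_cpx[abs_def])

lemma m2_linear:
  assumes [simp]: "X \<in> obj A" "Y \<in> obj A" "Z \<in> obj A"
  shows "y \<in> el Y Z b \<Longrightarrow> lin (mor A X Y a) (mor A X Z (a + b)) (\<lambda>x. m2 A X Y Z (a, x) (b, y))"
    "x \<in> el X Y a \<Longrightarrow> lin (mor A Y Z b) (mor A X Z (a + b)) (\<lambda>y. m2 A X Y Z (a, x) (b, y))"
    "x \<in> el X Y a \<Longrightarrow> y \<in> el Y Z b \<Longrightarrow> t = a + b \<Longrightarrow>
      m2 A X Y Z (a, x) (b, y) \<in> el X Z t"
  by (auto simp: m2_b2 intro!: linear_map_sgm b_linear)

text \<open>Multiplying \<open>b1_b2\<close> by the sign of \<open>b\<close> turns it into the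
  Leibniz rule: the sign \<open>b - 1\<close> in front of the first term becomes \<open>-1\<close>,
  and the last term gets the sign \<open>b\<close> instead of the sign \<open>b + 1\<close> that
  \<open>m2\<close> gives it, so moving both to the other side yields the claim.\<close>

lemma K_mor_m2:
  assumes [simp]: "X \<in> obj A" "Y \<in> obj A" "Z \<in> obj A"
  shows "K_mor R [mor_cpx A X Y, mor_cpx A Y Z] (mor_cpx A X Z) (\<lambda>xs. m2 A X Y Z (xs ! 0) (xs ! 1))"
proof -
  have "b1 X Z (a + b) (m2 A X Y Z (a, x) (b, y)) =
      sgm (mor A X Z (a + b + 1)) b (m2 A X Y Z (a + 1, b1 X Y a x) (b, y)) \<oplus>\<^bsub>mor A X Z (a + b + 1)\<^esub>
      m2 A X Y Z (a, x) (b + 1, b1 Y Z b y)"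
    if x: "x \<in> el X Y a" and y: "y \<in> el Y Z b" for a b x y
  proof -
    let ?M = "mor A X Z (a + b + 1)"
    interpret kmod R "?M" by (rule kmod) simp
    have d: "a + 1 + b = a + b + 1" "a + (b + 1) = a + b + 1" by auto
    define u v w where "u = b1 X Z (a + b) (b2 X Y Z a x b y)"
      and "v = b2 X Y Z (a + 1) (b1 X Y a x) b y" and "w = b2 X Y Z a x (b + 1) (b1 Y Z b y)"
    have c: "u \<in> el X Z (a + b + 1)" "v \<in> el X Z (a + b + 1)"
      "w \<in> el X Z (a + b + 1)"
      using x y by (auto simp: u_def v_def w_def)
    have s: "b1 X Z (a + b) (sgm (mor A X Z (a + b)) b (b2 X Y Z a x b y)) = sgm (?M) b u"
      unfolding u_def by (rule linear_map_more(4)[OF b_linear(1)]) (use x y in auto)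
    have eq: "sgm (?M) (b - 1) v \<oplus>\<^bsub>?M\<^esub> (u \<oplus>\<^bsub>?M\<^esub> w) =
      \<zero>\<^bsub>?M\<^esub>"
      unfolding u_def v_def w_def by (rule b1_b2) (use x y in auto)
    have u: "u = \<ominus>\<^bsub>?M\<^esub> (sgm (?M) (b - 1) v \<oplus>\<^bsub>?M\<^esub> w)"
    proof (rule uminus_unique)
      show "u \<oplus>\<^bsub>?M\<^esub> (sgm (?M) (b - 1) v \<oplus>\<^bsub>?M\<^esub> w) =
        \<zero>\<^bsub>?M\<^esub>"
        using eq c by (simp add: a_ac)
    qed (use c in auto)
    show ?thesis
      unfolding m2_b2 s d u_def[symmetric] v_def[symmetric] w_def[symmetric]
      using c by (subst u) (cases "even b"; simp add: sgm_def minus_add)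
  qed
  then show ?thesis
    using m2_linear[of X Y Z] by (simp add: K_mor2_iff dif_mor_cpx)
qed

lemma K_eq_m2_assoc:
  assumes [simp]: "X \<in> obj A" "Y \<in> obj A" "Z \<in> obj A" "W \<in> obj A"
  shows "K_eq R [mor_cpx A X Y, mor_cpx A Y Z, mor_cpx A Z W] (mor_cpx A X W)
    (\<lambda>xs. m2 A X Z W (fst (xs ! 0) + fst (xs ! 1), m2 A X Y Z (xs ! 0) (xs ! 1)) (xs ! 2))
    (\<lambda>xs. m2 A X Y W (xs ! 0) (fst (xs ! 1) + fst (xs ! 2), m2 A Y Z W (xs ! 1) (xs ! 2)))"
(is "K_eq R _ _ ?F ?G")
proof -
  \<comment> \<open>This is \<open>(s \<otimes> s \<otimes> s) b_3 s^{-1}\<close>: the first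
    \<open>s\<close> passes \<open>y\<close> and \<open>z\<close>, the second passes
    \<open>z\<close>, so the sign of the degree of \<open>y\<close> remains.\<close>
  let ?H = "\<lambda>a x b y c z. sgm (mor A X W (a + b + c - 1)) b (b3 X Y Z W a x b y c z)"
  show ?thesis
  proof (rule K_eq3I[where H = ?H])
  fix a b c x y z
  assume "x \<in> elts (mor_cpx A X Y) a" and "y \<in> elts (mor_cpx A Y Z) b"
    and "z \<in> elts (mor_cpx A Z W) c"
  then have x: "x \<in> el X Y a" and y: "y \<in> el Y Z b" and z: "z \<in> el Z W c"
    by simp_all
  let ?M = "mor A X W (a + b + c)"
  interpret kmod R ?M by (rule kmod) simp
  have d: "a + 1 + b + c - 1 = a + b + c" "a + (b + 1) + c - 1 = a + b + c" "a + b + (c + 1) - 1 = a + b + c"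
    "a + (b + c) = a + b + c" by auto
  define u v w p q r where "u = b1 X W (a + b + c - 1) (b3 X Y Z W a x b y c z)"
    and "v = b3 X Y Z W (a + 1) (b1 X Y a x) b y c z" and "w = b3 X Y Z W a x (b + 1) (b1 Y Z b y) c z"
    and "p = b3 X Y Z W a x b y (c + 1) (b1 Z W c z)"
    and "q = b2 X Z W (a + b) (b2 X Y Z a x b y) c z" and "r = b2 X Y W a x (b + c) (b2 Y Z W b y c z)"
  have C: "u \<in> carrier ?M" "v \<in> carrier ?M" "w \<in> carrier ?M" "p \<in> carrier ?M" "q \<in> carrier ?M" "r \<in> carrier ?M"
    using x y z by (auto simp: u_def v_def w_def p_def q_def r_def)
  have s: "b1 X W (a + b + c - 1) (sgm (mor A X W (a + b + c - 1)) b (b3 X Y Z W a x b y c z)) = sgm ?M b u"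
    using linear_map_more(4)[OF b_linear(1), of X W "a + b + c - 1" "b3 X Y Z W a x b y c z" b] x y z
    by (simp add: u_def)
  have q: "m2 A X Z W (a + b, m2 A X Y Z (a, x) (b, y)) (c, z) = sgm ?M (c + b) q"
    using linear_map_more(4)[OF b_linear(2), of X Z W z c "a + b" "b2 X Y Z a x b y" b] x y z C
    by (simp add: m2_b2 q_def)
  have r: "m2 A X Y W (a, x) (b + c, m2 A Y Z W (b, y) (c, z)) = sgm ?M b r"
    using linear_map_more(4)[OF b_linear(3), of X Y W x a "b + c" "b2 Y Z W b y c z" c] x y z C
    by (simp add: m2_b2 r_def d sgm_parity[of "2 * c + b" b])
  have eq: "sgm ?M (b + c) v \<oplus>\<^bsub>?M\<^esub> (sgm ?M (c - 1) q \<oplus>\<^bsub>?M\<^esub> (u \<oplus>\<^bsub>?M\<^esub>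
      (sgm ?M (c - 1) w \<oplus>\<^bsub>?M\<^esub> (r \<oplus>\<^bsub>?M\<^esub> p)))) = \<zero>\<^bsub>?M\<^esub>"
    unfolding u_def v_def w_def p_def q_def r_def by (rule b1_b3) (use x y z in auto)
  have "m2 A X Z W (a + b, m2 A X Y Z (a, x) (b, y)) (c, z) \<ominus>\<^bsub>?M\<^esub>
      m2 A X Y W (a, x) (b + c, m2 A Y Z W (b, y) (c, z)) =
    b1 X W (a + b + c - 1) (sgm (mor A X W (a + b + c - 1)) b (b3 X Y Z W a x b y c z)) \<oplus>\<^bsub>?M\<^esub>
    (sgm ?M (b + c) (sgm ?M b (b3 X Y Z W (a + 1) (b1 X Y a x) b y c z)) \<oplus>\<^bsub>?M\<^esub>
    (sgm ?M c (sgm ?M (b + 1) (b3 X Y Z W a x (b + 1) (b1 Y Z b y) c z)) \<oplus>\<^bsub>?M\<^esub>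
     sgm ?M b (b3 X Y Z W a x b y (c + 1) (b1 Z W c z))))"
    unfolding q r s u_def[symmetric] v_def[symmetric] w_def[symmetric] p_def[symmetric]
    by (rule assoc_identity[OF C eq])
  then show "m2 A X Z W
        (fst ([(a, x), (b, y), (c, z)] ! 0) + fst ([(a, x), (b, y), (c, z)] ! 1),
         m2 A X Y Z ([(a, x), (b, y), (c, z)] ! 0) ([(a, x), (b, y), (c, z)] ! 1))
        ([(a, x), (b, y), (c, z)] ! 2) \<ominus>\<^bsub>gr (mor_cpx A X W) (a + b + c)\<^esub>
       m2 A X Y W ([(a, x), (b, y), (c, z)] ! 0)
        (fst ([(a, x), (b, y), (c, z)] ! 1) + fst ([(a, x), (b, y), (c, z)] ! 2),
         m2 A Y Z W ([(a, x), (b, y), (c, z)] ! 1) ([(a, x), (b, y), (c, z)] ! 2)) =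
      dif (mor_cpx A X W) (a + b + c - 1) (?H a x b y c z) \<oplus>\<^bsub>gr (mor_cpx A X W) (a + b + c)\<^esub>
      (sgm (gr (mor_cpx A X W) (a + b + c)) (b + c) (?H (a + 1) (dif (mor_cpx A X Y) a x) b y c z)
       \<oplus>\<^bsub>gr (mor_cpx A X W) (a + b + c)\<^esub>
       (sgm (gr (mor_cpx A X W) (a + b + c)) c (?H a x (b + 1) (dif (mor_cpx A Y Z) b y) c z)
        \<oplus>\<^bsub>gr (mor_cpx A X W) (a + b + c)\<^esub> ?H a x b y (c + 1) (dif (mor_cpx A Z W) c z)))"
    by (simp only: dif_mor_cpx gr_mor_cpx d nth_Cons_0 nth_Cons_Suc fst_conv numeral_2_eq_2 One_nat_def)
qed (use assms in \<open>auto simp: gr_mor_cpx intro!: linear_map_sgm b_linear\<close>)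
qed

end

section \<open>Units and the resulting enriched category\<close>

locale unital_ainf_cat = ainf_cat R A for R :: "'k ring" and A :: "('k, 'o, 'h) ainf" +
  assumes units: "\<And>X. X \<in> obj A \<Longrightarrow> \<exists>\<i>. is_unit R A X \<i>"
begin

definition uni :: "'o \<Rightarrow> 'h" where
  "uni X = (SOME \<i>. is_unit R A X \<i>)"

lemma kcat_simps [simp]:
  "Kobj (kcat R A) = obj A" "Khom (kcat R A) = mor_cpx A" "Kcomp (kcat R A) = m2 A" "Kunit (kcat R A) = uni"
  by (auto simp: kcat_def uni_def)

lemma is_unit_uni: "X \<in> obj A \<Longrightarrow> is_unit R A X (uni X)"
  unfolding uni_def using someI_ex[OF units] .

lemma cycle_uni: "X \<in> obj A \<Longrightarrow> cycle (mor_cpx A X X) 0 (uni X)"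
  using is_unit_uni[of X] by (simp add: is_unit_def cycle_def dif_mor_cpx b1_def)

lemma uni_closed [simp, intro]: "X \<in> obj A \<Longrightarrow> uni X \<in> el X X 0"
  using cycle_uni by (simp add: cycle_def)

text \<open>In the left unit law the minus sign and the Koszul sign \<open>a - 1\<close> combine to
  the sign \<open>a\<close> in \<open>m2\<close>; in the right one \<open>m2\<close> has no sign. So
  the conditions in \<open>is_unit\<close> are literally the two unit laws.\<close>

lemma K_eq_uni:
  assumes [simp]: "X \<in> obj A" "Y \<in> obj A"
  shows "K_eq R [mor_cpx A X Y] (mor_cpx A X Y) (\<lambda>xs. m2 A X X Y (0, uni X) (xs ! 0)) (\<lambda>xs. snd (xs ! 0))" (is ?goal1)
    "K_eq R [mor_cpx A X Y] (mor_cpx A X Y) (\<lambda>xs. m2 A X Y Y (xs ! 0) (0, uni Y)) (\<lambda>xs. snd (xs ! 0))" (is ?goal2)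
proof -
  have "\<ominus>\<^bsub>mor A X Y a\<^esub> sgm (mor A X Y a) (a - 1) (b2 X X Y 0 (uni X) a x) =
    m2 A X X Y (0, uni X) (a, x)" if "x \<in> el X Y a" for a x
  proof -
    have "b2 X X Y 0 (uni X) a x \<in> el X Y a" using that by auto
    then show ?thesis by (auto simp: m2_b2 sgm_def)
  qed
  moreover have "K_eq R [mor_cpx A X Y] (mor_cpx A X Y)
      (\<lambda>xs. \<ominus>\<^bsub>mor A X Y (fst (xs ! 0))\<^esub> sgm (mor A X Y (fst (xs ! 0))) (fst (xs ! 0) - 1)
         (bmap A (X, [(X, -1, uni X), (Y, fst (xs ! 0) - 1, snd (xs ! 0))]))) (\<lambda>xs. snd (xs ! 0))"
    using is_unit_uni[of X] assms unfolding is_unit_def by blast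
  ultimately show ?goal1
    by (simp add: K_eq1_iff b2_def)
  have "K_eq R [mor_cpx A X Y] (mor_cpx A X Y)
      (\<lambda>xs. bmap A (X, [(Y, fst (xs ! 0) - 1, snd (xs ! 0)), (Y, -1, uni Y)])) (\<lambda>xs. snd (xs ! 0))"
    using is_unit_uni[of Y] assms unfolding is_unit_def by blast
  then show ?goal2
    by (simp add: K_eq1_iff m2_b2 b2_def)
qed

theorem K_category_kcat: "K_category R (kcat R A)"
  by (simp add: K_category_def K_mor_m2 K_eq_m2_assoc K_eq_uni cycle_uni del: One_nat_def)

end

section \<open>A-infinity functors and natural transformations on homotopy categories\<close>

lemma tbhat_simps:
  "tbhat R [A] [p] = map (\<lambda>(c, q). (\<one>\<^bsub>R\<^esub> \<otimes>\<^bsub>R\<^esub> c, [q])) (bhat R A p)"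
  "tbhat R [A, A'] [p, p'] = map (\<lambda>(c, q). (sg R (pdeg p') \<otimes>\<^bsub>R\<^esub> c, [q, p'])) (bhat R A p) @
     map (\<lambda>(c, q). (\<one>\<^bsub>R\<^esub> \<otimes>\<^bsub>R\<^esub> c, [p, q])) (bhat R A' p')"
  by (simp_all add: tbhat_def upt_rec split_def)

lemma pcuts_simps [simp]:
  "pcuts (X, []) = [((X, []), (X, []))]"
  "pcuts (X, [(Y, d, x)]) = [((X, []), (X, [(Y, d, x)])), ((X, [(Y, d, x)]), (Y, []))]"
  "pcuts (X, [(Y, d, x), (Z, e, y)]) = [((X, []), (X, [(Y, d, x), (Z, e, y)])),
     ((X, [(Y, d, x)]), (Y, [(Z, e, y)])), ((X, [(Y, d, x), (Z, e, y)]), (Z, []))]"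
  by (simp_all add: pcuts_def upt_rec)

context ground
begin

lemma fhat_simps:
  "fhat R f [(X, [])] = [(\<one>\<^bsub>R\<^esub>, (fob f [X], []))]"
  "fhat R f [(X, [(Y, d, x)])] = [(\<one>\<^bsub>R\<^esub>, (fob f [X], [(fob f [Y], d, fcomp f [(X, [(Y, d, x)])])]))]"
  "fhat R f [(X, [(Y, d, x), (Z, e, y)])] =
     [(\<one>\<^bsub>R\<^esub>, (fob f [X], [(fob f [Z], d + e, fcomp f [(X, [(Y, d, x), (Z, e, y)])])])),
      (\<one>\<^bsub>R\<^esub>, (fob f [X], [(fob f [Y], d, fcomp f [(X, [(Y, d, x)])]), (fob f [Z], e, fcomp f [(Y, [(Z, e, y)])])]))]"
  "fhat R f [(X, []), (Z, [])] = [(\<one>\<^bsub>R\<^esub>, (fob f [X, Z], []))]"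
  "fhat R f [(X, [(Y, d, x)]), (Z, [])] =
     [(\<one>\<^bsub>R\<^esub>, (fob f [X, Z], [(fob f [Y, Z], d, fcomp f [(X, [(Y, d, x)]), (Z, [])])]))]"
  "fhat R f [(X, []), (Z, [(W, d, x)])] =
     [(\<one>\<^bsub>R\<^esub>, (fob f [X, Z], [(fob f [X, W], d, fcomp f [(X, []), (Z, [(W, d, x)])])]))]"
  by (simp_all add: fhat_def upt_rec)

text \<open>The only letter goes to \<open>g\<close>, to \<open>r\<close> or to \<open>f\<close>, in
  this order. In the first case \<open>r\<close>, of degree \<open>-1\<close>, passes an element of
  degree \<open>d\<close>, whence the sign.\<close>

lemma rhat_simps:
  "rhat R f g (-1) r [(X, [(Y, d, x)])] =
     [(sg R (- d), (fob f [X], [(fob g [X], -1, r [(X, [])]), (fob g [Y], d, fcomp g [(X, [(Y, d, x)])])])),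
      (\<one>\<^bsub>R\<^esub>, (fob f [X], [(fob g [Y], d - 1, r [(X, [(Y, d, x)])])])),
      (\<one>\<^bsub>R\<^esub>, (fob f [X], [(fob f [Y], d, fcomp f [(X, [(Y, d, x)])]), (fob g [Y], -1, r [(Y, [])])]))]"
  "rhat R f g (-1) r [(X, [(Y, d, x)]), (Z, [])] =
     [(sg R (- d), (fob f [X, Z], [(fob g [X, Z], -1, r [(X, []), (Z, [])]),
        (fob g [Y, Z], d, fcomp g [(X, [(Y, d, x)]), (Z, [])])])),
      (\<one>\<^bsub>R\<^esub>, (fob f [X, Z], [(fob g [Y, Z], d - 1, r [(X, [(Y, d, x)]), (Z, [])])])),
      (\<one>\<^bsub>R\<^esub>, (fob f [X, Z], [(fob f [Y, Z], d, fcomp f [(X, [(Y, d, x)]), (Z, [])]),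
        (fob g [Y, Z], -1, r [(Y, []), (Z, [])])]))]"
  "rhat R f g (-1) r [(X, []), (Z, [(W, d, x)])] =
     [(sg R (- d), (fob f [X, Z], [(fob g [X, Z], -1, r [(X, []), (Z, [])]),
        (fob g [X, W], d, fcomp g [(X, []), (Z, [(W, d, x)])])])),
      (\<one>\<^bsub>R\<^esub>, (fob f [X, Z], [(fob g [X, W], d - 1, r [(X, []), (Z, [(W, d, x)])])])),
      (\<one>\<^bsub>R\<^esub>, (fob f [X, Z], [(fob f [X, W], d, fcomp f [(X, []), (Z, [(W, d, x)])]),
        (fob g [X, W], -1, r [(X, []), (W, [])])]))]"
  by (simp_all add: rhat_def fhat_simps)

text \<open>The component of \<open>r B\<^sub>1 = 0\<close> on tensors of length one.\<close>

lemma natural_square: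
  fixes B :: "('k, 'p, 'g) ainf"
  assumes mods: "kquiver B"
    and r: "natural_transformation R As B f g r" and ws: "is_tuple As ws"
    and rh: "rhat R f g (-1) r ws = [(sg R (- d), (F0, [(G0, -1, r0), (G1, d, g1)])),
      (\<one>\<^bsub>R\<^esub>, (F0, [(G1, d - 1, rw)])), (\<one>\<^bsub>R\<^esub>, (F0, [(F1, d, f1), (G1, -1, r1)]))]"
    and tb: "tbhat R As ws = [(\<one>\<^bsub>R\<^esub>, ws')]"
    and rh': "rhat R f g (-1) r ws' = [(c, (F0, [l1, l2])), (\<one>\<^bsub>R\<^esub>, (F0, [(G1, d, rw')])), (c', (F0, [l3, l4]))]"
    and cc: "c \<in> carrier R" "c' \<in> carrier R"
  shows "F0 \<in> obj B \<and> F1 \<in> obj B \<and> G0 \<in> obj B \<and> G1 \<in> obj B"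
    and "f1 \<in> carrier (mor B F0 F1 (d + 1)) \<and> g1 \<in> carrier (mor B G0 G1 (d + 1)) \<and>
      r0 \<in> carrier (mor B F0 G0 0) \<and> r1 \<in> carrier (mor B F1 G1 0)" (is ?goal1)
    and "bmap B (F0, [(G0, -1, r0), (G1, d, g1)]) \<in> carrier (mor B F0 G1 (d + 1)) \<and>
      bmap B (F0, [(G1, d - 1, rw)]) \<in> carrier (mor B F0 G1 (d + 1)) \<and>
      bmap B (F0, [(F1, d, f1), (G1, -1, r1)]) \<in> carrier (mor B F0 G1 (d + 1)) \<and>
      rw' \<in> carrier (mor B F0 G1 (d + 1))" (is ?goal2)
    and "sgm (mor B F0 G1 (d + 1)) d (bmap B (F0, [(G0, -1, r0), (G1, d, g1)]))
      \<oplus>\<^bsub>mor B F0 G1 (d + 1)\<^esub> (bmap B (F0, [(G1, d - 1, rw)])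
      \<oplus>\<^bsub>mor B F0 G1 (d + 1)\<^esub> (bmap B (F0, [(F1, d, f1), (G1, -1, r1)])
      \<oplus>\<^bsub>mor B F0 G1 (d + 1)\<^esub> rw')) = \<zero>\<^bsub>mor B F0 G1 (d + 1)\<^esub>" (is ?goal3)
proof -
  let ?L = "B1 R As B f g (- 1) r ws"
  have eq: "tensor_eq R B ?L []"
    using r ws by (simp add: natural_transformation_def)
  \<comment> \<open>The relation itself certifies that all its paths are well formed; the
    memberships in the conclusions are extracted from this.\<close>
  have fs: "is_fsum R B ?L"
    using tensor_eq_is_fsum[OF mods eq] by simp
  note L = B1_def rh tb rh' lin_ext_simps bhat_simps
  have facts: "is_path B (F0, [(G0, 0, bmap B (F0, [(G0, -1, r0)])), (G1, d, g1)])"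
    "is_path B (F0, [(G1, d, bmap B (F0, [(G0, -1, r0), (G1, d, g1)]))])"
    "is_path B (F0, [(G0, -1, r0), (G1, d + 1, bmap B (G0, [(G1, d, g1)]))])"
    "is_path B (F0, [(G1, d, bmap B (F0, [(G1, d - 1, rw)]))])"
    "is_path B (F0, [(F1, d + 1, bmap B (F0, [(F1, d, f1)])), (G1, -1, r1)])"
    "is_path B (F0, [(G1, d, bmap B (F0, [(F1, d, f1), (G1, -1, r1)]))])"
    "is_path B (F0, [(F1, d, f1), (G1, 0, bmap B (F1, [(G1, -1, r1)]))])"
    "is_path B (F0, [(G1, d, rw')])"
    "is_path B (F0, [l1, l2])" "is_path B (F0, [l3, l4])" 
    using fs by (auto simp: L)
  show "F0 \<in> obj B \<and> F1 \<in> obj B \<and> G0 \<in> obj B \<and> G1 \<in> obj B"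
    and ?goal1
    and m: ?goal2
    using facts by auto
  have o: "F0 \<in> obj B" "G1 \<in> obj B" using facts by auto
  interpret cring R by (rule ground_cring)
  \<comment> \<open>Terms of length two project to zero. These are the ones where \<open>b_1\<close>
    acts on one of two factors, and the outer summands of \<open>rhat\<close> on the differential of
    the argument, which is why \<open>l1\<close> to \<open>l4\<close> can stay arbitrary.\<close>
  have "lin1 B F0 G1 d ?L = \<zero>\<^bsub>mor B F0 G1 (d + 1)\<^esub>"
    using tensor_eq_lin1[OF mods eq o, of d] by simp
  then show ?goal3
    using m kquiverD[OF mods o] cc facts by (simp add: L sgm_parity[of "- d" d])
qed

lemma components_linear:
  assumes F: "components R As B \<phi> \<chi> e F" and "is_tuple As ws" and "i < length ws"
    and "ws ! i = (X, u @ (Y, d, x) # v)" and "t = tdeg ws + e + 1"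
  shows "lin (mor (As ! i) (end_of X u) Y (d + 1)) (mor B (\<phi> (map fst ws)) (\<chi> (map ptgt ws)) t)
    (\<lambda>y. F (ws[i := (X, u @ (Y, d, y) # v)]))"
  using assms unfolding components_def by blast

end

section \<open>A-infinity functors in arities one and two\<close>

locale ainf_fun = src: ainf_cat R A + tgt: ainf_cat R B
  for R :: "'k ring" and A :: "('k, 'o, 'h) ainf" and B :: "('k, 'p, 'g) ainf" +
  fixes f :: "('o, 'h, 'p, 'g) afun"
  assumes ainf_functor: "ainf_functor R [A] B f"
begin

abbreviation fo :: "'o \<Rightarrow> 'p" where
  "fo X \<equiv> fob f [X]"

definition f1 :: "'o \<Rightarrow> 'o \<Rightarrow> int \<Rightarrow> 'h \<Rightarrow> 'g" where
  "f1 X Y a x = fcomp f [(X, [(Y, a - 1, x)])]"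

definition f2 :: "'o \<Rightarrow> 'o \<Rightarrow> 'o \<Rightarrow> int \<Rightarrow> 'h \<Rightarrow> int \<Rightarrow> 'h \<Rightarrow> 'g" where
  "f2 X Y Z a x b y = fcomp f [(X, [(Y, a - 1, x), (Z, b - 1, y)])]"

lemma fo_obj [simp, intro]: "X \<in> obj A \<Longrightarrow> fo X \<in> obj B"
  using ainf_functor by (simp add: ainf_functor_def is_objs_def)

lemma components_f: "components R [A] B (fob f) (fob f) 0 (fcomp f)"
  using ainf_functor by (simp add: ainf_functor_def)

lemma f_linear:
  assumes [simp]: "X \<in> obj A" "Y \<in> obj A"
  shows "linear_map R (mor A X Y a) (mor B (fo X) (fo Y) a) (f1 X Y a)"
    and "Z \<in> obj A \<Longrightarrow> y \<in> carrier (mor A Y Z b) \<Longrightarrow>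
      linear_map R (mor A X Y a) (mor B (fo X) (fo Z) (a + b - 1)) (\<lambda>x. f2 X Y Z a x b y)"
    and "Z \<in> obj A \<Longrightarrow> x \<in> carrier (mor A X Y a) \<Longrightarrow>
      linear_map R (mor A Y Z b) (mor B (fo X) (fo Z) (a + b - 1)) (\<lambda>y. f2 X Y Z a x b y)"
proof -
  show "linear_map R (mor A X Y a) (mor B (fo X) (fo Y) a) (f1 X Y a)"
    using src.components_linear[OF components_f, of "[(X, [(Y, a - 1, \<zero>\<^bsub>mor A X Y a\<^esub>)])]" 0 X "[]" Y "a - 1" _ "[]" a]
    by (simp add: is_tuple_def f1_def[abs_def])
  show "linear_map R (mor A X Y a) (mor B (fo X) (fo Z) (a + b - 1)) (\<lambda>x. f2 X Y Z a x b y)"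
    if "Z \<in> obj A" "y \<in> carrier (mor A Y Z b)"
    using that src.components_linear[OF components_f, of "[(X, [(Y, a - 1, \<zero>\<^bsub>mor A X Y a\<^esub>), (Z, b - 1, y)])]" 0 X "[]" Y "a - 1" _ "[(Z, b - 1, y)]" "a + b - 1"]
    by (simp add: is_tuple_def f2_def)
  show "linear_map R (mor A Y Z b) (mor B (fo X) (fo Z) (a + b - 1)) (\<lambda>y. f2 X Y Z a x b y)"
    if "Z \<in> obj A" "x \<in> carrier (mor A X Y a)"
    using that src.components_linear[OF components_f, of "[(X, [(Y, a - 1, x), (Z, b - 1, \<zero>\<^bsub>mor A Y Z b\<^esub>)])]" 0 X "[(Y, a - 1, x)]" Z "b - 1" _ "[]" "a + b - 1"]
    by (simp add: is_tuple_def f2_def)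
qed

lemma f_closed [simp, intro]:
  assumes [simp]: "X \<in> obj A" "Y \<in> obj A"
  shows "x \<in> carrier (mor A X Y a) \<Longrightarrow> t = a \<Longrightarrow> f1 X Y a x \<in> carrier (mor B (fo X) (fo Y) t)"
    and "Z \<in> obj A \<Longrightarrow> x \<in> carrier (mor A X Y a) \<Longrightarrow> y \<in> carrier (mor A Y Z b) \<Longrightarrow> t = a + b - 1 \<Longrightarrow>
      f2 X Y Z a x b y \<in> carrier (mor B (fo X) (fo Z) t)"
  using f_linear(1)[of X Y a] f_linear(2)[of X Y Z y b a] by (auto dest: src.linear_mapD(1))

lemma fhat_f:
  "fhat R f [(X, [(Y, d, x)])] = [(\<one>\<^bsub>R\<^esub>, (fo X, [(fo Y, d, f1 X Y (d + 1) x)]))]"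
  "fhat R f [(X, [(Y, d, x), (Z, e, y)])] =
     [(\<one>\<^bsub>R\<^esub>, (fo X, [(fo Z, d + e, f2 X Y Z (d + 1) x (e + 1) y)])),
      (\<one>\<^bsub>R\<^esub>, (fo X, [(fo Y, d, f1 X Y (d + 1) x), (fo Z, e, f1 Y Z (e + 1) y)]))]"
  by (simp_all add: src.fhat_simps f1_def f2_def)

lemma functor_lin1:
  assumes "is_path A (X, w)" and "Y = end_of X w"
  shows "lin1 B (fo X) (fo Y) d (lin_ext R (bhat R B) (fhat R f [(X, w)])) =
    lin1 B (fo X) (fo Y) d (lin_ext R (fhat R f) (tbhat R [A] [(X, w)]))"
proof (rule src.tensor_eq_lin1)
  show "tensor_eq R B (lin_ext R (bhat R B) (fhat R f [(X, w)])) (lin_ext R (fhat R f) (tbhat R [A] [(X, w)]))"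
    using ainf_functor assms by (simp add: ainf_functor_def is_tuple_def)
  show "fo X \<in> obj B" "fo Y \<in> obj B"
    using assms by (auto simp: is_path_def dest!: composable_objs)
qed auto

lemma f1_b1:
  assumes [simp]: "X \<in> obj A" "Y \<in> obj A" and x: "x \<in> carrier (mor A X Y a)"
  shows "tgt.b1 (fo X) (fo Y) a (f1 X Y a x) = f1 X Y (a + 1) (src.b1 X Y a x)"
  using functor_lin1[of X "[(Y, a - 1, x)]" Y a] x
  by (simp add: fhat_f tbhat_simps src.bhat_b src.lin1_lin_ext_list tgt.lin1_bhat del: lin_ext_simps)

lemma f2_b2:
  assumes [simp]: "X \<in> obj A" "Y \<in> obj A" "Z \<in> obj A"
    and x: "x \<in> carrier (mor A X Y a)" and y: "y \<in> carrier (mor A Y Z b)"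
  shows "tgt.b1 (fo X) (fo Z) (a + b - 1) (f2 X Y Z a x b y) \<oplus>\<^bsub>mor B (fo X) (fo Z) (a + b)\<^esub>
      tgt.b2 (fo X) (fo Y) (fo Z) a (f1 X Y a x) b (f1 Y Z b y) =
    sgm (mor B (fo X) (fo Z) (a + b)) (b - 1) (f2 X Y Z (a + 1) (src.b1 X Y a x) b y) \<oplus>\<^bsub>mor B (fo X) (fo Z) (a + b)\<^esub>
      (f1 X Z (a + b) (src.b2 X Y Z a x b y) \<oplus>\<^bsub>mor B (fo X) (fo Z) (a + b)\<^esub>
       f2 X Y Z a x (b + 1) (src.b1 Y Z b y))"
  using functor_lin1[of X "[(Y, a - 1, x), (Z, b - 1, y)]" Z "a + b - 1"] x y
  by (simp add: fhat_f tbhat_simps src.bhat_b src.lin1_lin_ext_list tgt.lin1_bhat del: lin_ext_simps)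

end

text \<open>The letters follow \<open>f2_b2\<close>: \<open>u\<close> is \<open>b_1\<close> after
  \<open>f_2\<close>, \<open>v\<close> is \<open>b_2\<close> of two values of \<open>f_1\<close>,
  \<open>p\<close> is \<open>f_1\<close> of \<open>b_2\<close>, and \<open>w\<close>,
  \<open>q\<close> are \<open>f_2\<close> after \<open>b_1\<close> in the first and the second
  argument.\<close>

lemma (in kmod) functor_identity:
  assumes "u \<in> carrier M" "v \<in> carrier M" "w \<in> carrier M" "p \<in> carrier M" "q \<in> carrier M"
    and "u \<oplus>\<^bsub>M\<^esub> v = sgm M (b - 1) w \<oplus>\<^bsub>M\<^esub> (p \<oplus>\<^bsub>M\<^esub> q)"
  shows "sgm M b p \<ominus>\<^bsub>M\<^esub> sgm M b v = sgm M b u \<oplus>\<^bsub>M\<^esub> (sgm M b (sgm M b w) \<oplus>\<^bsub>M\<^esub> sgm M (b + 1) q)"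
proof -
  have "u = (u \<oplus>\<^bsub>M\<^esub> v) \<oplus>\<^bsub>M\<^esub> \<ominus>\<^bsub>M\<^esub> v"
    using assms(1,2) by algebra
  then have "u = (sgm M (b - 1) w \<oplus>\<^bsub>M\<^esub> (p \<oplus>\<^bsub>M\<^esub> q)) \<oplus>\<^bsub>M\<^esub> \<ominus>\<^bsub>M\<^esub> v"
    using assms(6) by simp
  then show ?thesis
    using assms(2-5) by (cases "even b"; simp add: sgm_def del: minus_add; algebra)
qed

text \<open>The letters follow \<open>natural_square\<close> with \<open>d = a - 1\<close>:
  \<open>u\<close> and \<open>w\<close> are the two products of a functor value with a component of
  \<open>r\<close> at an object, while \<open>v\<close> and \<open>p\<close> contain the component
  of \<open>r\<close> of length one.\<close>

lemma (in kmod) natural_identity: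
  assumes "u \<in> carrier M" "v \<in> carrier M" "w \<in> carrier M" "p \<in> carrier M"
    and "sgm M (a - 1) u \<oplus>\<^bsub>M\<^esub> (v \<oplus>\<^bsub>M\<^esub> (w \<oplus>\<^bsub>M\<^esub> p)) = \<zero>\<^bsub>M\<^esub>"
  shows "w \<ominus>\<^bsub>M\<^esub> sgm M a u = \<ominus>\<^bsub>M\<^esub> v \<oplus>\<^bsub>M\<^esub> \<ominus>\<^bsub>M\<^esub> p"
proof -
  have "w = \<ominus>\<^bsub>M\<^esub> (sgm M (a - 1) u \<oplus>\<^bsub>M\<^esub> (v \<oplus>\<^bsub>M\<^esub> p))"
    using assms by (intro uminus_unique) (simp_all add: a_ac closed_facts simp_facts sgm_facts)
  then show ?thesis
    using assms(1-4) by (cases "even a"; simp add: sgm_def del: minus_add; algebra)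
qed

context ainf_fun
begin

lemma kfun_simps [simp]:
  "Kob (kfun f) X = fo X" "Kmap (kfun f) X Y (a, x) = f1 X Y a x"
  by (simp_all add: kfun_def f1_def)

lemma K_mor_f1:
  assumes [simp]: "X \<in> obj A" "Y \<in> obj A"
  shows "K_mor R [mor_cpx A X Y] (mor_cpx B (fo X) (fo Y)) (\<lambda>xs. Kmap (kfun f) X Y (xs ! 0))"
  using f_linear(1)[of X Y] f1_b1[of X Y]
  by (simp add: src.K_mor1_iff src.dif_mor_cpx tgt.dif_mor_cpx)

lemma K_eq_f_m2:
  assumes [simp]: "X \<in> obj A" "Y \<in> obj A" "Z \<in> obj A"
  shows "K_eq R [mor_cpx A X Y, mor_cpx A Y Z] (mor_cpx B (fo X) (fo Z))
    (\<lambda>xs. Kmap (kfun f) X Z (fst (xs ! 0) + fst (xs ! 1), m2 A X Y Z (xs ! 0) (xs ! 1)))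
    (\<lambda>xs. m2 B (fo X) (fo Y) (fo Z) (fst (xs ! 0), Kmap (kfun f) X Y (xs ! 0)) (fst (xs ! 1), Kmap (kfun f) Y Z (xs ! 1)))"
proof -
  let ?M = "mor B (fo X) (fo Z)"
  \<comment> \<open>This is \<open>(s \<otimes> s) f_2 s^{-1}\<close>; the sign arises from moving
    \<open>s\<close> past \<open>y\<close>, as in \<open>m2\<close>.\<close>
  let ?H = "\<lambda>a x b y. sgm (?M (a + b - 1)) b (f2 X Y Z a x b y)"
  have main: "f1 X Z (a + b) (m2 A X Y Z (a, x) (b, y)) \<ominus>\<^bsub>?M (a + b)\<^esub>
      m2 B (fo X) (fo Y) (fo Z) (a, f1 X Y a x) (b, f1 Y Z b y) =
    tgt.b1 (fo X) (fo Z) (a + b - 1) (?H a x b y) \<oplus>\<^bsub>?M (a + b)\<^esub>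
    (sgm (?M (a + b)) b (?H (a + 1) (src.b1 X Y a x) b y) \<oplus>\<^bsub>?M (a + b)\<^esub>
     ?H a x (b + 1) (src.b1 Y Z b y))"
    if x: "x \<in> carrier (mor A X Y a)" and y: "y \<in> carrier (mor A Y Z b)" for a x b y
  proof -
    let ?Q = "?M (a + b)"
    interpret kmod R ?Q by (rule src.kmod) simp
    have d: "a + 1 + b - 1 = a + b" "a + (b + 1) - 1 = a + b" by auto
    have 1: "f1 X Z (a + b) (m2 A X Y Z (a, x) (b, y)) = sgm ?Q b (f1 X Z (a + b) (src.b2 X Y Z a x b y))"
      unfolding src.m2_b2 by (rule src.linear_map_more(4)[OF f_linear(1)]) (use x y in auto)
    have 2: "tgt.b1 (fo X) (fo Z) (a + b - 1) (?H a x b y) =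
        sgm ?Q b (tgt.b1 (fo X) (fo Z) (a + b - 1) (f2 X Y Z a x b y))"
      using src.linear_map_more(4)[OF tgt.b_linear(1), of "fo X" "fo Z" "a + b - 1" "f2 X Y Z a x b y" b] x y
      by simp
    show ?thesis
      unfolding 1 2 tgt.m2_b2 d
      by (rule functor_identity[OF _ _ _ _ _ f2_b2]) (use x y in auto)
  qed
  show ?thesis
    unfolding src.K_eq2_iff[OF src.is_complex_mor_cpx src.is_complex_mor_cpx tgt.is_complex_mor_cpx, OF assms(1,2,2,3) fo_obj fo_obj, OF assms(1,3)]
    by (rule exI[of _ ?H])
      (use main in \<open>auto simp: src.dif_mor_cpx tgt.dif_mor_cpx intro!: src.linear_map_sgm f_linear\<close>)
qed

end

section \<open>Natural transformations in the homotopy category\<close>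

context ainf_cat
begin

lemma natural_K_eq:
  assumes r: "natural_transformation R [A] A f g r" and [simp]: "X \<in> obj A" "Y \<in> obj A"
  shows "K_eq R [mor_cpx A X Y] (mor_cpx A (fob f [X]) (fob g [Y]))
    (\<lambda>xs. m2 A (fob f [X]) (fob f [Y]) (fob g [Y]) (fst (xs ! 0), Kmap (kfun f) X Y (xs ! 0)) (0, r [(Y, [])]))
    (\<lambda>xs. m2 A (fob f [X]) (fob g [X]) (fob g [Y]) (0, r [(X, [])]) (fst (xs ! 0), Kmap (kfun g) X Y (xs ! 0)))"
proof -
  let ?F = "fob f [X]" and ?G = "fob g [Y]"
  \<comment> \<open>The minus sign appears because \<open>natural_identity\<close> moves both terms
    with the length-one component of \<open>r\<close> to the other side.\<close>
  let ?H = "\<lambda>a x. \<ominus>\<^bsub>mor A ?F ?G (a - 1)\<^esub> r [(X, [(Y, a - 1, x)])]"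
  have tb: "tbhat R [A] [(X, [(Y, a - 1, x)])] = [(\<one>\<^bsub>R\<^esub>, [(X, [(Y, a, b1 X Y a x)])])]" for a x
    using bhat_b(1)[of X Y "a - 1" x] by (simp add: tbhat_simps)
  have ws: "is_tuple [A] [(X, [(Y, a - 1, x)])]" if "x \<in> el X Y a" for a x
    using that by (simp add: is_tuple_def)
  note sq = natural_square[OF kquiver r ws rhat_simps(1) tb rhat_simps(1) sg_closed one_closed]
  \<comment> \<open>The lemma will be applied to composites, for which only naturality of
    \<open>r\<close> is at hand. That the values of \<open>f\<close> and \<open>g\<close> are
    objects is contained in the well-formedness of the naturality relation, taken here at a zero
    morphism.\<close>
  have o [simp]: "?F \<in> obj A" "?G \<in> obj A"
    using sq(1)[of "\<zero>\<^bsub>mor A X Y 0\<^esub>" 0] by auto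
  have lin: "lin (mor A X Y a) (mor A ?F ?G (a - 1)) (\<lambda>x. r [(X, [(Y, a - 1, x)])])" for a
    using components_linear[of "[A]" A "fob f" "fob g" "-1" r "[(X, [(Y, a - 1, \<zero>\<^bsub>mor A X Y a\<^esub>)])]" 0 X "[]" Y "a - 1" _ "[]" "a - 1"] r
    by (simp add: is_tuple_def natural_transformation_def)
  have linH: "lin (mor A X Y a) (mor A ?F ?G (a - 1)) (?H a)" for a
    by (rule linear_map_uminus[OF lin]) simp
  have main: "m2 A ?F (fob f [Y]) ?G (a, fcomp f [(X, [(Y, a - 1, x)])]) (0, r [(Y, [])]) \<ominus>\<^bsub>mor A ?F ?G a\<^esub>
      m2 A ?F (fob g [X]) ?G (0, r [(X, [])]) (a, fcomp g [(X, [(Y, a - 1, x)])]) =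
    b1 ?F ?G (a - 1) (?H a x) \<oplus>\<^bsub>mor A ?F ?G a\<^esub> \<ominus>\<^bsub>mor A ?F ?G a\<^esub> r [(X, [(Y, a, b1 X Y a x)])]"
    if x: "x \<in> el X Y a" for a x
  proof -
    interpret kmod R "mor A ?F ?G a" by (rule kmod) simp
    have "b1 ?F ?G (a - 1) (?H a x) = \<ominus>\<^bsub>mor A ?F ?G a\<^esub> b1 ?F ?G (a - 1) (r [(X, [(Y, a - 1, x)])])"
      using linear_map_more(2)[OF b_linear(1), of ?F ?G "a - 1"] linear_mapD(1)[OF lin x] by simp
    then show ?thesis
      using natural_identity[OF _ _ _ _ sq(4)[OF x, simplified]] sq(3)[OF x] by (simp add: m2_b2 b1_def b2_def)
  qed
  show ?thesis
    unfolding K_eq1_iff[OF is_complex_mor_cpx[OF assms(2,3)] is_complex_mor_cpx[OF o]]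
    by (rule exI[of _ ?H]) (use main linH in \<open>auto simp: kfun_def dif_mor_cpx\<close>)
qed

end

section \<open>Reasoning up to boundaries\<close>

context ground
begin

lemma homologous_refl:
  assumes M: "is_complex R M" and x: "x \<in> elts M n"
  shows "homologous M n x x"
  unfolding homologous_def
  using linear_map_more(1)[OF is_complexD(6)[OF M] is_complexD(1)[OF M] is_complexD(1)[OF M], of n] x is_complexD(1)[OF M]
  by (intro bexI[of _ "\<zero>\<^bsub>gr M (n - 1)\<^esub>"]) auto

lemma homologous_sym:
  assumes M: "is_complex R M" and x: "x \<in> elts M n" and y: "y \<in> elts M n"
    and xy: "homologous M n x y"
  shows "homologous M n y x"
proof -
  interpret kmod R "gr M n" by (rule kmod[OF is_complexD(1)[OF M]])
  obtain z where z: "z \<in> elts M (n - 1)" "x \<ominus>\<^bsub>gr M n\<^esub> y = dif M (n - 1) z"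
    using xy by (auto simp: homologous_def)
  have "y \<ominus>\<^bsub>gr M n\<^esub> x = \<ominus>\<^bsub>gr M n\<^esub> (x \<ominus>\<^bsub>gr M n\<^esub> y)"
    using x y by (simp add: a_minus_def minus_add a_comm)
  also have "\<dots> = dif M (n - 1) (\<ominus>\<^bsub>gr M (n - 1)\<^esub> z)"
    using linear_map_more(2)[OF is_complexD(6)[OF M] is_complexD(1)[OF M] is_complexD(1)[OF M] z(1)] z by simp
  finally show ?thesis
    using z is_complexD(1)[OF M] by (auto simp: homologous_def)
qed

lemma homologous_trans:
  assumes M: "is_complex R M" and x: "x \<in> elts M n" "y \<in> elts M n" "z \<in> elts M n"
    and xy: "homologous M n x y" "homologous M n y z"
  shows "homologous M n x z"
proof -
  interpret kmod R "gr M n" by (rule kmod[OF is_complexD(1)[OF M]])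
  obtain u v where u: "u \<in> elts M (n - 1)" "x \<ominus>\<^bsub>gr M n\<^esub> y = dif M (n - 1) u"
    and v: "v \<in> elts M (n - 1)" "y \<ominus>\<^bsub>gr M n\<^esub> z = dif M (n - 1) v"
    using xy by (auto simp: homologous_def)
  have "x \<ominus>\<^bsub>gr M n\<^esub> z = (x \<ominus>\<^bsub>gr M n\<^esub> y) \<oplus>\<^bsub>gr M n\<^esub> (y \<ominus>\<^bsub>gr M n\<^esub> z)"
    using x by algebra
  also have "\<dots> = dif M (n - 1) (u \<oplus>\<^bsub>gr M (n - 1)\<^esub> v)"
    using linear_mapD(2)[OF is_complexD(6)[OF M] u(1) v(1)] u v by simp
  finally show ?thesis
    using u v is_complexD(1)[OF M] by (auto simp: homologous_def)
qed

lemma K_mor1_cycle: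
  assumes M: "is_complex R M" and P: "is_complex R P" and F: "K_mor R [M] P F" and x: "cycle M a x"
  shows "cycle P a (F [(a, x)])"
  using F x linear_mapD(1) linear_map_more(1)[OF _ is_complexD(1)[OF M] is_complexD(1)[OF P]]
  unfolding K_mor1_iff[OF M P] cycle_def by metis

lemma K_mor1_homologous:
  assumes M: "is_complex R M" and P: "is_complex R P" and F: "K_mor R [M] P F"
    and x: "x \<in> elts M a" and y: "y \<in> elts M a" and xy: "homologous M a x y"
  shows "homologous P a (F [(a, x)]) (F [(a, y)])"
proof -
  have lin: "lin (gr M a) (gr P a) (\<lambda>x. F [(a, x)])" for a
    using F unfolding K_mor1_iff[OF M P] by blast
  obtain z where z: "z \<in> elts M (a - 1)" "x \<ominus>\<^bsub>gr M a\<^esub> y = dif M (a - 1) z"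
    using xy by (auto simp: homologous_def)
  have "F [(a, x)] \<ominus>\<^bsub>gr P a\<^esub> F [(a, y)] = F [(a, dif M (a - 1) z)]"
    using linear_map_more(3)[OF lin is_complexD(1)[OF M] is_complexD(1)[OF P] x y] z by simp
  also have "\<dots> = dif P (a - 1) (F [(a - 1, z)])"
  proof -
    have "dif P (a - 1) (F [(a - 1, z)]) = F [(a - 1 + 1, dif M (a - 1) z)]"
      using F z(1) unfolding K_mor1_iff[OF M P] by blast
    then show ?thesis by simp
  qed
  finally show ?thesis
    using linear_mapD(1)[OF lin z(1)] by (auto simp: homologous_def)
qed

lemma lsum_zeros:
  assumes "module R M"
  shows "lsum M (map (\<lambda>i. \<zero>\<^bsub>M\<^esub>) xs) = \<zero>\<^bsub>M\<^esub>"
  by (induction xs) (simp_all add: assms)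

lemma hdeg_update: "i < length xs \<Longrightarrow> hdeg (xs[i := x]) = hdeg xs - fst (xs ! i) + fst x"
proof (induction xs arbitrary: i)
  case (Cons y xs)
  then show ?case by (cases i) auto
qed simp

text \<open>On cycles every term of \<open>after_dif\<close> has a zero argument, so only the
  boundary of \<open>H xs\<close> is left. All statements about units pass from homotopies to
  homology classes in this way.\<close>

lemma K_eq_cycles:
  fixes P :: "('k, 'p) cpx" and Ms :: "('k, 'm) cpx list"
  assumes P: "is_complex R P" and Ms: "list_all (is_complex R) Ms" and F: "K_eq R Ms P F G"
    and xs: "list_all2 (\<lambda>M x. cycle M (fst x) (snd x)) Ms xs"
  shows "homologous P (hdeg xs) (F xs) (G xs)"
proof -
  let ?n = "hdeg xs"
  have len [simp]: "length Ms = length xs" using xs by (rule list_all2_lengthD)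
  have c: "snd (xs ! i) \<in> elts (Ms ! i) (fst (xs ! i))"
    "dif (Ms ! i) (fst (xs ! i)) (snd (xs ! i)) = \<zero>\<^bsub>gr (Ms ! i) (fst (xs ! i) + 1)\<^esub>"
    if "i < length xs" for i
    using xs that by (auto simp: list_all2_conv_all_nth cycle_def)
  have args: "args_in Ms xs" using c by (simp add: args_in_def list_all2_conv_all_nth)
  obtain H where H: "multilinear R Ms P (-1) H"
    "F xs \<ominus>\<^bsub>gr P ?n\<^esub> G xs = dif P (?n - 1) (H xs) \<oplus>\<^bsub>gr P ?n\<^esub> after_dif Ms (gr P ?n) H xs"
    using F args by (auto simp: K_eq_def)
  have mP: "module R (gr P n)" for n using is_complexD(1)[OF P] .
  have "H (xs[i := (fst (xs ! i) + 1, dif (Ms ! i) (fst (xs ! i)) (snd (xs ! i)))]) = \<zero>\<^bsub>gr P ?n\<^esub>"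
    if i: "i < length xs" for i
  proof -
    \<comment> \<open>Multilinearity of \<open>H\<close> is used at the list whose place
      \<open>i\<close> holds the zero of the degree into which the differential maps.\<close>
    let ?ys = "xs[i := (fst (xs ! i) + 1, \<zero>\<^bsub>gr (Ms ! i) (fst (xs ! i) + 1)\<^esub>)]"
    have mi: "module R (gr (Ms ! i) n)" for n
      by (rule is_complexD(1)) (use Ms i in \<open>simp add: list_all_length\<close>)
    have "args_in Ms ?ys"
      using c i mi by (auto simp: args_in_def list_all2_conv_all_nth nth_list_update)
    moreover have "hdeg ?ys = ?n + 1"
      using i by (simp add: hdeg_update)
    ultimately have "lin (gr (Ms ! i) (fst (xs ! i) + 1)) (gr P ?n)
        (\<lambda>x. H (xs[i := (fst (xs ! i) + 1, x)]))"
      using H(1) i unfolding multilinear_def by (fastforce dest: spec[of _ ?ys])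
    then show ?thesis
      using linear_map_more(1)[OF _ mi mP] c(2)[OF i] by simp
  qed
  then have "after_dif Ms (gr P ?n) H xs = lsum (gr P ?n) (map (\<lambda>i. \<zero>\<^bsub>gr P ?n\<^esub>) [0..<length xs])"
    unfolding after_dif_def using mP by (auto intro!: arg_cong[of _ _ "lsum _"])
  also have "\<dots> = \<zero>\<^bsub>gr P ?n\<^esub>"
    using mP by (rule lsum_zeros)
  finally have "F xs \<ominus>\<^bsub>gr P ?n\<^esub> G xs = dif P (?n - 1) (H xs)"
    using H args is_complexD(5)[OF P, of "H xs" ?n] mP by (simp add: multilinear_def)
  then show ?thesis
    using H(1) args by (auto simp: homologous_def multilinear_def)
qed

end

context ainf_fun
begin

lemma f1_cycle:
  "X \<in> obj A \<Longrightarrow> Y \<in> obj A \<Longrightarrow> cycle (mor_cpx A X Y) a x \<Longrightarrow>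
    cycle (mor_cpx B (fo X) (fo Y)) a (f1 X Y a x)"
  using src.K_mor1_cycle[OF _ _ K_mor_f1[of X Y]] by simp

lemma f1_homologous:
  "X \<in> obj A \<Longrightarrow> Y \<in> obj A \<Longrightarrow> cycle (mor_cpx A X Y) a x \<Longrightarrow> cycle (mor_cpx A X Y) a y \<Longrightarrow>
    homologous (mor_cpx A X Y) a x y \<Longrightarrow> homologous (mor_cpx B (fo X) (fo Y)) a (f1 X Y a x) (f1 X Y a y)"
  using src.K_mor1_homologous[OF _ _ K_mor_f1[of X Y]] by (simp add: cycle_def)

end

section \<open>Cycles of degree zero modulo boundaries as an ordinary category\<close>

context unital_ainf_cat
begin

abbreviation cyc :: "'o \<Rightarrow> 'o \<Rightarrow> 'h \<Rightarrow> bool" where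
  "cyc X Y \<equiv> cycle (mor_cpx A X Y) 0"

abbreviation hml :: "'o \<Rightarrow> 'o \<Rightarrow> 'h \<Rightarrow> 'h \<Rightarrow> bool" where
  "hml X Y \<equiv> homologous (mor_cpx A X Y) 0"

abbreviation mu :: "'o \<Rightarrow> 'o \<Rightarrow> 'o \<Rightarrow> 'h \<Rightarrow> 'h \<Rightarrow> 'h" where
  "mu X Y Z x y \<equiv> m2 A X Y Z (0, x) (0, y)"

lemma cyc_mem: "cyc X Y x \<Longrightarrow> x \<in> el X Y 0"
  by (simp add: cycle_def)

lemma cyc_dif: "cyc X Y x \<Longrightarrow> b1 X Y 0 x = \<zero>\<^bsub>mor A X Y 1\<^esub>"
  by (simp add: cycle_def dif_mor_cpx)

lemma hml_refl: "X \<in> obj A \<Longrightarrow> Y \<in> obj A \<Longrightarrow> cyc X Y x \<Longrightarrow> hml X Y x x"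
  by (simp add: homologous_refl cyc_mem)

lemma hml_sym: "X \<in> obj A \<Longrightarrow> Y \<in> obj A \<Longrightarrow> cyc X Y x \<Longrightarrow> cyc X Y y \<Longrightarrow> hml X Y x y \<Longrightarrow> hml X Y y x"
  by (simp add: homologous_sym cyc_mem)

lemma hml_trans:
  "X \<in> obj A \<Longrightarrow> Y \<in> obj A \<Longrightarrow> cyc X Y x \<Longrightarrow> cyc X Y y \<Longrightarrow> cyc X Y z \<Longrightarrow> hml X Y x y \<Longrightarrow> hml X Y y z \<Longrightarrow> hml X Y x z"
  by (rule homologous_trans[OF is_complex_mor_cpx]) (auto dest: cyc_mem)

lemma m2_dif:
  assumes "X \<in> obj A" "Y \<in> obj A" "Z \<in> obj A"
    and "x \<in> el X Y a" and "y \<in> el Y Z b"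
  shows "b1 X Z (a + b) (m2 A X Y Z (a, x) (b, y)) =
    sgm (mor A X Z (a + b + 1)) b (m2 A X Y Z (a + 1, b1 X Y a x) (b, y)) \<oplus>\<^bsub>mor A X Z (a + b + 1)\<^esub>
    m2 A X Y Z (a, x) (b + 1, b1 Y Z b y)"
  using K_mor_m2[of X Y Z] assms by (simp add: K_mor2_iff dif_mor_cpx)

text \<open>With a cycle as one factor, one of the two terms of the Leibniz rule is a product with
  zero; in degree zero the cycle also causes no sign.\<close>

lemma K_mor_m2_cycle:
  assumes [simp]: "X \<in> obj A" "Y \<in> obj A" "Z \<in> obj A"
  shows "cyc Y Z y \<Longrightarrow> K_mor R [mor_cpx A X Y] (mor_cpx A X Z) (\<lambda>xs. m2 A X Y Z (xs ! 0) (0, y))"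
    and "cyc X Y x \<Longrightarrow> K_mor R [mor_cpx A Y Z] (mor_cpx A X Z) (\<lambda>xs. m2 A X Y Z (0, x) (xs ! 0))"
proof -
  show "K_mor R [mor_cpx A X Y] (mor_cpx A X Z) (\<lambda>xs. m2 A X Y Z (xs ! 0) (0, y))" if y: "cyc Y Z y"
  proof -
    have "b1 X Z a (m2 A X Y Z (a, x) (0, y)) = m2 A X Y Z (a + 1, b1 X Y a x) (0, y)"
      if x: "x \<in> el X Y a" for a x
    proof -
      have "b1 X Z a (m2 A X Y Z (a, x) (0, y)) = m2 A X Y Z (a + 1, b1 X Y a x) (0, y) \<oplus>\<^bsub>mor A X Z (a + 1)\<^esub>
        m2 A X Y Z (a, x) (1, \<zero>\<^bsub>mor A Y Z 1\<^esub>)"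
        using m2_dif[of X Y Z x a y 0] x cyc_mem[OF y] cyc_dif[OF y] by simp
      also have "m2 A X Y Z (a, x) (1, \<zero>\<^bsub>mor A Y Z 1\<^esub>) = \<zero>\<^bsub>mor A X Z (a + 1)\<^esub>"
        using linear_map_more(1)[OF m2_linear(2)] x by simp
      finally show ?thesis
        using x m2_linear(3)[of X Y Z "b1 X Y a x" "a + 1" y 0 "a + 1"] cyc_mem[OF y] by simp
    qed
    then show ?thesis
      using m2_linear(1)[of X Y Z y 0] cyc_mem[OF y] by (simp add: K_mor1_iff dif_mor_cpx)
  qed
  show "K_mor R [mor_cpx A Y Z] (mor_cpx A X Z) (\<lambda>xs. m2 A X Y Z (0, x) (xs ! 0))" if x: "cyc X Y x"
  proof -
    have "b1 X Z b (m2 A X Y Z (0, x) (b, y)) = m2 A X Y Z (0, x) (b + 1, b1 Y Z b y)"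
      if y: "y \<in> el Y Z b" for b y
    proof -
      have "b1 X Z b (m2 A X Y Z (0, x) (b, y)) = sgm (mor A X Z (b + 1)) b (m2 A X Y Z (1, \<zero>\<^bsub>mor A X Y 1\<^esub>) (b, y))
        \<oplus>\<^bsub>mor A X Z (b + 1)\<^esub> m2 A X Y Z (0, x) (b + 1, b1 Y Z b y)"
        using m2_dif[of X Y Z x 0 y b] y cyc_mem[OF x] cyc_dif[OF x] by simp
      also have "m2 A X Y Z (1, \<zero>\<^bsub>mor A X Y 1\<^esub>) (b, y) = \<zero>\<^bsub>mor A X Z (b + 1)\<^esub>"
        using linear_map_more(1)[OF m2_linear(1), of X Y Z y b 1] y by (simp add: add.commute)
      finally show ?thesis
        using y m2_linear(3)[of X Y Z x 0 "b1 Y Z b y" "b + 1" "b + 1"] cyc_mem[OF x] by simp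
    qed
    then show ?thesis
      using m2_linear(2)[of X Y Z x 0] cyc_mem[OF x] by (simp add: K_mor1_iff dif_mor_cpx)
  qed
qed

lemma mu_cyc:
  assumes [simp]: "X \<in> obj A" "Y \<in> obj A" "Z \<in> obj A" and "cyc X Y x" "cyc Y Z y"
  shows "cyc X Z (mu X Y Z x y)"
  using K_mor1_cycle[OF _ _ K_mor_m2_cycle(1)[of X Y Z y]] assms by simp

lemma mu_cong:
  assumes [simp]: "X \<in> obj A" "Y \<in> obj A" "Z \<in> obj A"
    and "cyc X Y x" "cyc X Y x'" "cyc Y Z y" "cyc Y Z y'" "hml X Y x x'" "hml Y Z y y'"
  shows "hml X Z (mu X Y Z x y) (mu X Y Z x' y')"
proof (rule hml_trans)
  show "hml X Z (mu X Y Z x y) (mu X Y Z x' y)"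
    using K_mor1_homologous[OF _ _ K_mor_m2_cycle(1)[of X Y Z y]] assms by (simp add: cyc_mem)
  show "hml X Z (mu X Y Z x' y) (mu X Y Z x' y')"
    using K_mor1_homologous[OF _ _ K_mor_m2_cycle(2)[of X Y Z x']] assms by (simp add: cyc_mem)
qed (use assms in \<open>auto intro: mu_cyc\<close>)

lemma mu_uni:
  assumes [simp]: "X \<in> obj A" "Y \<in> obj A" and "cyc X Y x"
  shows "hml X Y (mu X X Y (uni X) x) x" "hml X Y (mu X Y Y x (uni Y)) x"
  using K_eq_cycles[OF _ _ K_eq_uni(1)[of X Y], of "[(0, x)]"] K_eq_cycles[OF _ _ K_eq_uni(2)[of X Y], of "[(0, x)]"]
    assms(3) by simp_all

lemma mu_assoc:
  assumes [simp]: "X \<in> obj A" "Y \<in> obj A" "Z \<in> obj A" "W \<in> obj A"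
    and x: "cyc X Y x" and y: "cyc Y Z y" and z: "cyc Z W z"
  shows "hml X W (mu X Z W (mu X Y Z x y) z) (mu X Y W x (mu Y Z W y z))"
  using K_eq_cycles[OF _ _ K_eq_m2_assoc[of X Y Z W], of "[(0, x), (0, y), (0, z)]"] x y z by simp

lemma K_invertibleE:
  assumes "K_invertible (kcat R A) X Y t"
  obtains u where "cyc X Y t" "cyc Y X u" "hml X X (mu X Y X t u) (uni X)" "hml Y Y (mu Y X Y u t) (uni Y)"
  using assms by (auto simp: K_invertible_def)

text \<open>Multiplication by an inverse of \<open>t\<close> from the right undoes multiplication by
  \<open>t\<close>, by associativity and the unit law up to boundaries.\<close>

lemma cancel_right:
  assumes o [simp]: "X \<in> obj A" "Y \<in> obj A" "Z \<in> obj A" and t: "K_invertible (kcat R A) Y Z t"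
    and x: "cyc X Y x" and y: "cyc X Y y" and eq: "hml X Z (mu X Y Z x t) (mu X Y Z y t)"
  shows "hml X Y x y"
proof -
  obtain u where u: "cyc Y Z t" "cyc Z Y u" "hml Y Y (mu Y Z Y t u) (uni Y)"
    using t by (rule K_invertibleE)
  have *: "hml X Y (mu X Z Y (mu X Y Z z t) u) z" if z: "cyc X Y z" for z
  proof (rule hml_trans)
    show "hml X Y (mu X Z Y (mu X Y Z z t) u) (mu X Y Y z (mu Y Z Y t u))"
      using mu_assoc z u by simp
    show "hml X Y (mu X Y Y z (mu Y Z Y t u)) z"
    proof (rule hml_trans)
      show "hml X Y (mu X Y Y z (mu Y Z Y t u)) (mu X Y Y z (uni Y))"
        using z u by (intro mu_cong) (auto intro: mu_cyc cycle_uni hml_refl)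
      show "hml X Y (mu X Y Y z (uni Y)) z" using mu_uni z by simp
    qed (use z u in \<open>auto intro!: mu_cyc cycle_uni\<close>)
  qed (use z u in \<open>auto intro!: mu_cyc cycle_uni\<close>)
  have m: "cyc X Y (mu X Z Y (mu X Y Z x t) u)" "cyc X Y (mu X Z Y (mu X Y Z y t) u)"
    using x y u by (auto intro!: mu_cyc)
  have "hml X Y (mu X Z Y (mu X Y Z x t) u) (mu X Z Y (mu X Y Z y t) u)"
    by (rule mu_cong) (use x y u eq in \<open>auto intro: mu_cyc hml_refl\<close>)
  then have "hml X Y (mu X Z Y (mu X Y Z x t) u) y"
    by (rule hml_trans[OF o(1,2) m(1,2) y _ *[OF y]])
  then show ?thesis
    by (rule hml_trans[OF o(1,2) x m(1) y hml_sym[OF o(1,2) m(1) x *[OF x]]])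
qed

lemma cancel_left:
  assumes o [simp]: "X \<in> obj A" "Y \<in> obj A" "Z \<in> obj A" and t: "K_invertible (kcat R A) X Y t"
    and x: "cyc Y Z x" and y: "cyc Y Z y" and eq: "hml X Z (mu X Y Z t x) (mu X Y Z t y)"
  shows "hml Y Z x y"
proof -
  obtain u where u: "cyc X Y t" "cyc Y X u" "hml Y Y (mu Y X Y u t) (uni Y)"
    using t by (rule K_invertibleE)
  have *: "hml Y Z z (mu Y X Z u (mu X Y Z t z))" if z: "cyc Y Z z" for z
  proof (rule hml_trans)
    show "hml Y Z (mu Y Y Z (mu Y X Y u t) z) (mu Y X Z u (mu X Y Z t z))"
      using mu_assoc z u by simp
    show "hml Y Z z (mu Y Y Z (mu Y X Y u t) z)"
    proof (rule hml_sym[OF _ _ _ _ hml_trans])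
      show "hml Y Z (mu Y Y Z (mu Y X Y u t) z) (mu Y Y Z (uni Y) z)"
        using z u by (intro mu_cong) (auto intro: mu_cyc cycle_uni hml_refl)
      show "hml Y Z (mu Y Y Z (uni Y) z) z" using mu_uni z by simp
    qed (use z u in \<open>auto intro!: mu_cyc cycle_uni\<close>)
  qed (use z u in \<open>auto intro!: mu_cyc cycle_uni\<close>)
  have m: "cyc Y Z (mu Y X Z u (mu X Y Z t x))" "cyc Y Z (mu Y X Z u (mu X Y Z t y))"
    using x y u by (auto intro!: mu_cyc)
  have "hml Y Z (mu Y X Z u (mu X Y Z t x)) (mu Y X Z u (mu X Y Z t y))"
    by (rule mu_cong) (use x y u eq in \<open>auto intro: mu_cyc hml_refl\<close>)
  then have "hml Y Z x (mu Y X Z u (mu X Y Z t y))"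
    by (rule hml_trans[OF o(2,3) x m(1,2) *[OF x]])
  then show ?thesis
    by (rule hml_trans[OF o(2,3) x m(2) y _ hml_sym[OF o(2,3) y m(2) *[OF y]]])
qed

text \<open>Preservation of units is the one condition that the relations of an A-infinity functor
  do not supply; it stays a hypothesis, to be established separately for \<open>S\<close> and for
  quasi-inverses.\<close>

lemma K_functor_kfun:
  assumes f: "ainf_functor R [A] A f"
    and u: "\<And>X. X \<in> obj A \<Longrightarrow>
      hml (fob f [X]) (fob f [X]) (Kmap (kfun f) X X (0, uni X)) (uni (fob f [X]))"
  shows "K_functor R (kcat R A) (kcat R A) (kfun f)"
proof -
  interpret f: ainf_fun R A A f by unfold_locales (rule f)
  show ?thesis
    using f.K_mor_f1 f.K_eq_f_m2 u
    by (simp add: K_functor_def K_category_kcat del: One_nat_def)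
qed

lemma fob_simps [simp]:
  "fob (afun_comp R B f g) Xs = fob g [fob f Xs]" "fob (afun_id B) [X] = X"
  by (simp_all add: afun_comp_def afun_id_def Let_def)

lemma kfun_afun_comp:
  assumes f: "ainf_functor R [A] A f" and g: "ainf_functor R [A] A g"
    and "X \<in> obj A" "Y \<in> obj A" and x: "x \<in> el X Y a"
  shows "Kmap (kfun (afun_comp R A f g)) X Y (a, x) = Kmap (K_fcomp (kfun f) (kfun g)) X Y (a, x)"
proof -
  interpret f: ainf_fun R A A f by unfold_locales (rule f)
  interpret g: ainf_fun R A A g by unfold_locales (rule g)
  \<comment> \<open>Membership allows the coefficient one and the final zero of \<open>lsum\<close>
    to be dropped from the one-term sum that defines the composite.\<close>
  have "g.f1 (f.fo X) (f.fo Y) a (f.f1 X Y a x) \<in> el (g.fo (f.fo X)) (g.fo (f.fo Y)) a"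
    using assms by auto
  then show ?thesis
    using assms f.fhat_f(1)[of X Y "a - 1" x]
    by (simp add: kfun_def K_fcomp_def afun_comp_def Let_def g.f1_def f.f1_def)
qed

text \<open>The second part is naturality on classes of degree zero, the form in which units can be
  compared and cancelled.\<close>

lemma K_functor_iso_id:
  assumes f: "ainf_functor R [A] A f" and g: "ainf_functor R [A] A g"
    and r: "natural_transformation R [A] A (afun_comp R A f g) (afun_id A) r"
    and inv: "\<And>X. X \<in> obj A \<Longrightarrow> K_invertible (kcat R A) (fob g [fob f [X]]) X (r [(X, [])])"
  shows "K_functor_iso R (kcat R A) (kcat R A) (K_fcomp (kfun f) (kfun g)) K_id"
    and "X \<in> obj A \<Longrightarrow> Y \<in> obj A \<Longrightarrow> cyc X Y x \<Longrightarrow>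
      hml (fob g [fob f [X]]) Y
        (mu (fob g [fob f [X]]) (fob g [fob f [Y]]) Y (Kmap (K_fcomp (kfun f) (kfun g)) X Y (0, x)) (r [(Y, [])]))
        (mu (fob g [fob f [X]]) X Y (r [(X, [])]) x)"
proof -
  interpret f: ainf_fun R A A f by unfold_locales (rule f)
  interpret g: ainf_fun R A A g by unfold_locales (rule g)
  have id: "Kmap (kfun (afun_id A)) X Y (a, x) = x" for X Y a x
    by (simp add: kfun_def afun_id_def)
  have K: "K_eq R [mor_cpx A X Y] (mor_cpx A (g.fo (f.fo X)) Y)
     (\<lambda>xs. m2 A (g.fo (f.fo X)) (g.fo (f.fo Y)) Y
             (fst (xs ! 0), Kmap (K_fcomp (kfun f) (kfun g)) X Y (xs ! 0)) (0, r [(Y, [])]))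
     (\<lambda>xs. m2 A (g.fo (f.fo X)) X Y (0, r [(X, [])]) (xs ! 0))"
    if [simp]: "X \<in> obj A" "Y \<in> obj A" for X Y
    using natural_K_eq[OF r that] kfun_afun_comp[OF f g that]
    by (simp add: K_eq1_iff id)
  show "K_functor_iso R (kcat R A) (kcat R A) (K_fcomp (kfun f) (kfun g)) K_id"
    unfolding K_functor_iso_def
    by (rule exI[of _ "\<lambda>X. r [(X, [])]"]) (use K inv in \<open>simp add: K_fcomp_def K_id_def\<close>)
  show "X \<in> obj A \<Longrightarrow> Y \<in> obj A \<Longrightarrow> cyc X Y x \<Longrightarrow>
      hml (g.fo (f.fo X)) Y
        (mu (g.fo (f.fo X)) (g.fo (f.fo Y)) Y (Kmap (K_fcomp (kfun f) (kfun g)) X Y (0, x)) (r [(Y, [])]))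
        (mu (g.fo (f.fo X)) X Y (r [(X, [])]) x)"
    using K_eq_cycles[OF _ _ K[of X Y], of "[(0, x)]"] by simp
qed

theorem K_equivalence_kfun:
  assumes "ainf_equivalence R A A f"
  shows "K_equivalence R (kcat R A) (kcat R A) (kfun f)"
proof -
  have iso: "\<exists>r. natural_transformation R [A] A F (afun_id A) r \<and>
      (\<forall>X\<in>obj A. K_invertible (kcat R A) (fob F [X]) X (r [(X, [])]))"
    if "isomorphic R [A] A F (afun_id A)" for F
  proof -
    from that[unfolded isomorphic_def]
    obtain r where r: "natural_transformation R [A] A F (afun_id A) r"
      "\<forall>Xs. is_objs [A] Xs \<longrightarrow>
           K_invertible (kcat R A) (fob F Xs) (fob (afun_id A) Xs) (r (map (\<lambda>X. (X, [])) Xs))"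
      by (elim exE conjE)
    have "K_invertible (kcat R A) (fob F [X]) X (r [(X, [])])" if "X \<in> obj A" for X
      using r(2)[rule_format, of "[X]"] that by (simp add: is_objs_def)
    then show ?thesis using r(1) by (intro exI[of _ r] conjI ballI)
  qed
  have f: "ainf_functor R [A] A f"
    and u: "\<And>X. X \<in> obj A \<Longrightarrow> hml (fob f [X]) (fob f [X]) (Kmap (kfun f) X X (0, uni X)) (uni (fob f [X]))"
    using assms by (auto simp: ainf_equivalence_def unital_functor_def)
  obtain g where g: "ainf_functor R [A] A g" and i: "isomorphic R [A] A (afun_comp R A f g) (afun_id A)"
    "isomorphic R [A] A (afun_comp R A g f) (afun_id A)"
    using assms by (auto simp only: ainf_equivalence_def)
  from iso[OF i(1), unfolded fob_simps]
  obtain r where r1: "natural_transformation R [A] A (afun_comp R A f g) (afun_id A) r"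
    and r2: "\<forall>X\<in>obj A. K_invertible (kcat R A) (fob g [fob f [X]]) X (r [(X, [])])"
    by (elim exE conjE)
  note r = r1 bspec[OF r2]
  from iso[OF i(2), unfolded fob_simps]
  obtain s where s1: "natural_transformation R [A] A (afun_comp R A g f) (afun_id A) s"
    and s2: "\<forall>X\<in>obj A. K_invertible (kcat R A) (fob f [fob g [X]]) X (s [(X, [])])"
    by (elim exE conjE)
  note s = s1 bspec[OF s2]
  interpret f: ainf_fun R A A f by unfold_locales (rule f)
  interpret g: ainf_fun R A A g by unfold_locales (rule g)
  have "hml (g.fo Z) (g.fo Z) (Kmap (kfun g) Z Z (0, uni Z)) (uni (g.fo Z))" if Z [simp]: "Z \<in> obj A" for Z
  proof -
    let ?G = "g.fo Z" and ?e = "g.f1 Z Z 0 (uni Z)"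
    let ?W = "f.fo ?G" and ?r = "r [(?G, [])]" and ?s = "s [(Z, [])]"
    let ?V = "g.fo ?W"
    let ?gfe = "g.f1 ?W ?W 0 (f.f1 ?G ?G 0 ?e)" and ?gfu = "g.f1 ?W ?W 0 (f.f1 ?G ?G 0 (uni ?G))"
    note [simp] = cycle_uni f.f1_cycle g.f1_cycle mu_cyc
    have e [simp]: "cyc ?G ?G ?e" by simp
    have si: "K_invertible (kcat R A) ?W Z ?s" and ri: "K_invertible (kcat R A) ?V ?G ?r"
      using s(2) r(2) by auto
    then have sc [simp]: "cyc ?W Z ?s" "cyc ?V ?G ?r"
      by (simp_all add: K_invertible_def)
    \<comment> \<open>Naturality of \<open>s\<close> at the unit of \<open>Z\<close>. Both unit laws
      let that unit be replaced by the unit of \<open>?W\<close> on the other side of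
      \<open>?s\<close>; cancelling \<open>?s\<close> then gives that \<open>f\<close> takes
      \<open>?e\<close> to a unit, as it does with the unit of \<open>?G\<close>.\<close>
    have 1: "hml ?W Z (mu ?W ?W Z (f.f1 ?G ?G 0 ?e) ?s) (mu ?W Z Z ?s (uni Z))"
      using K_functor_iso_id(2)[OF g f s Z Z, of "uni Z"] by (simp add: K_fcomp_def)
    have "hml ?W Z (mu ?W ?W Z (f.f1 ?G ?G 0 ?e) ?s) (mu ?W ?W Z (uni ?W) ?s)"
    proof (rule hml_trans[OF _ _ _ _ _ 1])
      show "hml ?W Z (mu ?W Z Z ?s (uni Z)) (mu ?W ?W Z (uni ?W) ?s)"
        by (rule hml_trans[OF _ _ _ _ _ mu_uni(2) hml_sym[OF _ _ _ _ mu_uni(1)]]) simp_all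
    qed simp_all
    then have e1: "hml ?W ?W (f.f1 ?G ?G 0 ?e) (uni ?W)"
      by (rule cancel_right[OF _ _ _ si, rotated -1]) simp_all
    have e2: "hml ?W ?W (f.f1 ?G ?G 0 (uni ?G)) (uni ?W)"
      using u[of ?G] by simp
    have "hml ?W ?W (f.f1 ?G ?G 0 ?e) (f.f1 ?G ?G 0 (uni ?G))"
      by (rule hml_trans[OF _ _ _ _ _ e1 hml_sym[OF _ _ _ _ e2]]) simp_all
    then have 2: "hml ?V ?V ?gfe ?gfu"
      by (rule g.f1_homologous[rotated -1]) simp_all
    \<comment> \<open>To remove \<open>f\<close> from the equality of \<open>f ?e\<close> and
      \<open>f 1\<close>, \<open>g\<close> has been applied to it. Naturality of \<open>r\<close>,
      used for \<open>?e\<close> and for the unit, turns the result into equality of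
      \<open>?r ?e\<close> and \<open>?r 1\<close>, and \<open>?r\<close> can be cancelled.\<close>
    have 3: "hml ?V ?G (mu ?V ?V ?G (g.f1 ?W ?W 0 (f.f1 ?G ?G 0 x)) ?r)
        (mu ?V ?G ?G ?r x)" if "cyc ?G ?G x" for x
      using K_functor_iso_id(2)[OF f g r _ _ that] by (simp add: K_fcomp_def)
    have e3: "hml ?V ?G (mu ?V ?G ?G ?r ?e)
        (mu ?V ?V ?G ?gfu ?r)"
    proof (rule hml_trans[OF _ _ _ _ _ hml_sym[OF _ _ _ _ 3[OF e]]])
      show "hml ?V ?G (mu ?V ?V ?G ?gfe ?r)
        (mu ?V ?V ?G ?gfu ?r)"
        by (rule mu_cong[OF _ _ _ _ _ _ _ 2 hml_refl]) simp_all
    qed simp_all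
    have "hml ?V ?G (mu ?V ?G ?G ?r ?e) (mu ?V ?G ?G ?r (uni ?G))"
      by (rule hml_trans[OF _ _ _ _ _ e3 3]) simp_all
    then have "hml ?G ?G ?e (uni ?G)"
      by (rule cancel_left[OF _ _ _ ri, rotated -1]) simp_all
    then show ?thesis by simp
  qed
  then have "K_functor R (kcat R A) (kcat R A) (kfun g)"
    by (rule K_functor_kfun[OF g])
  then show ?thesis
    using K_functor_kfun[OF f u] K_functor_iso_id(1)[OF f g r] K_functor_iso_id(1)[OF g f s]
    by (auto simp: K_equivalence_def)
qed

end

section \<open>The dg category of complexes\<close>

context ground
begin

lemma Cdg_simps:
  "obj (Cdg R) = {M. is_complex R M}" "mor (Cdg R) = (\<lambda>M N. gr (inner_hom R M N))"
  "bmap (Cdg R) (M, [(N, d, f)]) = dif (inner_hom R M N) (d + 1) f"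
  "bmap (Cdg R) (M, [(N, d, f), (P, e, g)]) =
     sgm (gr (inner_hom R M P) (d + e + 2)) (e + 1) (hcomp M f (d + 1) g)"
  by (simp_all add: Cdg_def)

lemma mor_cpx_Cdg: "mor_cpx (Cdg R) M N = inner_hom R M N"
  by (simp add: mor_cpx_def Cdg_simps)

lemma kquiver_Cdg: "kquiver (Cdg R)"
  using is_complexD(1) by (auto simp: kquiver_def Cdg_simps intro!: module_inner_hom)

definition id_map :: "('k, 'm) cpx \<Rightarrow> int \<Rightarrow> 'm \<Rightarrow> 'm" where
  "id_map M = (\<lambda>i. \<lambda>x\<in>elts M i. x)"

lemma cycle_id_map:
  assumes M: "is_complex R M"
  shows "cycle (inner_hom R M M) 0 (id_map M)"
proof -
  have mem: "id_map M \<in> elts (inner_hom R M M) 0"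
    unfolding id_map_def by (rule inner_hom_memI) (simp_all add: linear_map_ident is_complexD(1)[OF M])
  note H = is_complex_inner_hom[OF M M]
  have "dif (inner_hom R M M) 0 (id_map M) = \<zero>\<^bsub>gr (inner_hom R M M) (0 + 1)\<^esub>"
  proof (rule inner_hom_eqI[OF is_complexD(4)[OF H mem] module_facts(1)[OF is_complexD(1)[OF H]]])
    fix i x assume x: "x \<in> elts M i"
    then show "dif (inner_hom R M M) 0 (id_map M) i x = \<zero>\<^bsub>gr (inner_hom R M M) (0 + 1)\<^esub> i x"
      using is_complexD(4)[OF M x] is_complexD(1)[OF M]
      by (simp add: dif_inner_hom id_map_def gr_inner_hom_simps(2))
  qed
  then show ?thesis using mem by (simp add: cycle_def)
qed

lemma hcomp_id_map:
  assumes "is_complex R M"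
  shows "f \<in> elts (inner_hom R M N) n \<Longrightarrow> hcomp M (id_map M) 0 f = f"
    and "f \<in> elts (inner_hom R N M) n \<Longrightarrow> hcomp N f n (id_map M) = f"
proof -
  show "hcomp M (id_map M) 0 f = f" if f: "f \<in> elts (inner_hom R M N) n"
  proof
    fix i
    show "hcomp M (id_map M) 0 f i = f i"
      by (rule extensionalityI[of _ "elts M i"])
        (use f in \<open>auto simp: hcomp_def id_map_def gr_inner_hom_simps(1)\<close>)
  qed
  show "hcomp N f n (id_map M) = f" if f: "f \<in> elts (inner_hom R N M) n"
  proof
    fix i
    show "hcomp N f n (id_map M) i = f i"
      by (rule extensionalityI[of _ "elts N i"])
        (use f inner_homD(2)[OF f] in \<open>auto simp: hcomp_def id_map_def gr_inner_hom_simps(1)\<close>)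
  qed
qed

lemma K_eq1_refl:
  assumes M: "is_complex R M" and P: "is_complex R P"
    and "\<And>a x. x \<in> elts M a \<Longrightarrow> F [(a, x)] = G [(a, x)] \<and> G [(a, x)] \<in> elts P a"
  shows "K_eq R [M] P F G"
proof (rule iffD2[OF K_eq1_iff[OF M P] exI[of _ "\<lambda>a x. \<zero>\<^bsub>gr P (a - 1)\<^esub>"]], intro conjI allI ballI)
  note m = is_complexD(1)[OF P]
  show "lin (gr M a) (gr P (a - 1)) (\<lambda>x. \<zero>\<^bsub>gr P (a - 1)\<^esub>)" for a
    by (rule linear_map_zero[OF m])
  fix a x assume x: "x \<in> elts M a"
  have "dif P (a - 1) \<zero>\<^bsub>gr P (a - 1)\<^esub> = \<zero>\<^bsub>gr P a\<^esub>"
    by (rule linear_map_more(1)[OF is_complexD(6)[OF P] m m])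
  then show "F [(a, x)] \<ominus>\<^bsub>gr P a\<^esub> G [(a, x)] =
      dif P (a - 1) \<zero>\<^bsub>gr P (a - 1)\<^esub> \<oplus>\<^bsub>gr P a\<^esub> \<zero>\<^bsub>gr P (a + 1 - 1)\<^esub>"
    using assms(3)[OF x] m[of a] by simp
qed

text \<open>Composition of homogeneous maps is strictly unital, so the zero homotopy serves for both
  unit laws.\<close>

lemma is_unit_id_map:
  fixes M :: "('k, 'm) cpx"
  assumes M: "is_complex R M"
  shows "is_unit R (Cdg R) M (id_map M)"
proof -
  note c = cycle_id_map[OF M, unfolded cycle_def]
  have 1: "K_eq R [mor_cpx (Cdg R) W M] (mor_cpx (Cdg R) W M)
      (\<lambda>xs. bmap (Cdg R) (W, [(M, fst (xs ! 0) - 1, snd (xs ! 0)), (M, -1, id_map M)])) (\<lambda>xs. snd (xs ! 0))"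
    if W: "is_complex R W" for W :: "('k, 'm) cpx"
    unfolding mor_cpx_Cdg
    by (rule K_eq1_refl)
      (use W M in \<open>auto simp: is_complex_inner_hom Cdg_simps hcomp_id_map\<close>)
  have 2: "K_eq R [mor_cpx (Cdg R) M Y] (mor_cpx (Cdg R) M Y)
      (\<lambda>xs. \<ominus>\<^bsub>mor (Cdg R) M Y (fst (xs ! 0))\<^esub> sgm (mor (Cdg R) M Y (fst (xs ! 0))) (fst (xs ! 0) - 1)
         (bmap (Cdg R) (M, [(M, -1, id_map M), (Y, fst (xs ! 0) - 1, snd (xs ! 0))]))) (\<lambda>xs. snd (xs ! 0))"
    if Y: "is_complex R Y" for Y :: "('k, 'm) cpx"
    unfolding mor_cpx_Cdg
  proof (rule K_eq1_refl)
    fix a f assume f: "f \<in> elts (inner_hom R M Y) a"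
    note m = is_complexD(1)[OF is_complex_inner_hom[OF M Y]]
    show "\<ominus>\<^bsub>mor (Cdg R) M Y (fst ([(a, f)] ! 0))\<^esub> sgm (mor (Cdg R) M Y (fst ([(a, f)] ! 0))) (fst ([(a, f)] ! 0) - 1)
         (bmap (Cdg R) (M, [(M, -1, id_map M), (Y, fst ([(a, f)] ! 0) - 1, snd ([(a, f)] ! 0))])) =
        snd ([(a, f)] ! 0) \<and> snd ([(a, f)] ! 0) \<in> elts (inner_hom R M Y) a"
      using f m[of a] by (auto simp: Cdg_simps hcomp_id_map[OF M] sgm_def)
  qed (use M Y in \<open>auto simp: is_complex_inner_hom\<close>)
  show ?thesis
    using c 1 2 by (auto simp: is_unit_def Cdg_simps)
qed

text \<open>The chosen unit may differ from the identity map. Its right unit law, applied to the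
  cycle \<open>id_map M\<close>, compares the two, since composing \<open>id_map M\<close> with it
  gives the chosen unit itself.\<close>

lemma Kunit_Cdg:
  assumes M: "is_complex R M"
  defines "\<iota> \<equiv> Kunit (kcat R (Cdg R)) M"
  shows "\<iota> \<in> elts (inner_hom R M M) 0" "homologous (inner_hom R M M) 0 \<iota> (id_map M)"
proof -
  have \<iota>: "is_unit R (Cdg R) M \<iota>"
    unfolding \<iota>_def kcat_def using someI[of "is_unit R (Cdg R) M", OF is_unit_id_map[OF M]] by simp
  show mem: "\<iota> \<in> elts (inner_hom R M M) 0"
    using \<iota> by (simp add: is_unit_def Cdg_simps)
  have "K_eq R [mor_cpx (Cdg R) M M] (mor_cpx (Cdg R) M M)
      (\<lambda>xs. bmap (Cdg R) (M, [(M, fst (xs ! 0) - 1, snd (xs ! 0)), (M, -1, \<iota>)])) (\<lambda>xs. snd (xs ! 0))"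
    using \<iota> M unfolding is_unit_def by (simp add: Cdg_simps(1))
  from K_eq_cycles[OF _ _ this, of "[(0, id_map M)]"]
  have "homologous (inner_hom R M M) 0 (bmap (Cdg R) (M, [(M, - 1, id_map M), (M, -1, \<iota>)])) (id_map M)"
    using cycle_id_map[OF M] by (simp add: mor_cpx_Cdg is_complex_inner_hom M)
  then show "homologous (inner_hom R M M) 0 \<iota> (id_map M)"
    using mem by (simp add: Cdg_simps hcomp_id_map[OF M])
qed

text \<open>Invertibility refers to the chosen units; replacing these by identity maps turns it into
  the usual notion of homotopy equivalence.\<close>

lemma K_invertible_CdgE:
  fixes M N :: "('k, 'm) cpx"
  assumes M: "is_complex R M" and N: "is_complex R N" and t: "K_invertible (kcat R (Cdg R)) M N t"
  obtains u where "cycle (inner_hom R M N) 0 t" "cycle (inner_hom R N M) 0 u"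
    "homologous (inner_hom R M M) 0 (hcomp M t 0 u) (id_map M)"
    "homologous (inner_hom R N N) 0 (hcomp N u 0 t) (id_map N)"
proof -
  have c: "Khom (kcat R (Cdg R)) = mor_cpx (Cdg R)" "Kcomp (kcat R (Cdg R)) = m2 (Cdg R)"
    by (simp_all add: kcat_def)
  have m: "m2 (Cdg R) X Y Z (0, f) (0, g) = hcomp X f 0 g" for X Y Z :: "('k, 'm) cpx" and f g
    by (simp add: m2_def Cdg_simps)
  have hc: "hcomp X f 0 g \<in> elts (inner_hom R X Z) 0"
    if "is_complex R X" "cycle (inner_hom R X Y) 0 f" "cycle (inner_hom R Y Z) 0 g" for X Y Z :: "('k, 'm) cpx" and f g
  proof -
    have "lin (gr X i) (gr Z (i + 0)) (\<lambda>x. g (i + 0) (f i x))" for i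
      using linear_map_compose[of "gr X i" "gr Y i" "f i" "gr Z i" "g i"] that
        inner_homD(1)[of f X Y 0 i] inner_homD(1)[of g Y Z 0 i] by (simp add: cycle_def)
    then show ?thesis
      unfolding hcomp_def by (rule inner_hom_memI) (rule is_complexD(1)[OF that(1)])
  qed
  from t[unfolded K_invertible_def c mor_cpx_Cdg m]
  obtain u where u: "cycle (inner_hom R M N) 0 t" "cycle (inner_hom R N M) 0 u"
    "homologous (inner_hom R M M) 0 (hcomp M t 0 u) (Kunit (kcat R (Cdg R)) M)"
    "homologous (inner_hom R N N) 0 (hcomp N u 0 t) (Kunit (kcat R (Cdg R)) N)"
    by (elim conjE exE)
  show ?thesis
  proof (rule that[OF u(1,2)])
    show "homologous (inner_hom R M M) 0 (hcomp M t 0 u) (id_map M)"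
      by (rule homologous_trans[OF is_complex_inner_hom[OF M M] hc[OF M u(1,2)] Kunit_Cdg(1)[OF M] _ u(3) Kunit_Cdg(2)[OF M]])
        (use cycle_id_map[OF M] in \<open>simp add: cycle_def\<close>)
    show "homologous (inner_hom R N N) 0 (hcomp N u 0 t) (id_map N)"
      by (rule homologous_trans[OF is_complex_inner_hom[OF N N] hc[OF N u(2,1)] Kunit_Cdg(1)[OF N] _ u(4) Kunit_Cdg(2)[OF N]])
        (use cycle_id_map[OF N] in \<open>simp add: cycle_def\<close>)
  qed
qed

section \<open>Cycles and boundaries of the inner hom as chain maps and homotopies\<close>

lemma cycle_inner_hom_dif:
  assumes M: "is_complex R M" and N: "is_complex R N"
    and f: "cycle (inner_hom R M N) 0 f" and x: "x \<in> elts M i"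
  shows "dif N i (f i x) = f (i + 1) (dif M i x)"
proof -
  interpret kmod R "gr N (i + 1)" by (rule kmod[OF is_complexD(1)[OF N]])
  have f': "f \<in> elts (inner_hom R M N) 0" using f by (simp add: cycle_def)
  have c: "f (i + 1) (dif M i x) \<in> elts N (i + 1)" "dif N i (f i x) \<in> elts N (i + 1)"
    using inner_homD(2)[OF f' is_complexD(4)[OF M x]] is_complexD(4)[OF N inner_homD(2)[OF f' x]] by simp_all
  have "dif (inner_hom R M N) 0 f i x = \<zero>\<^bsub>gr N (i + 1)\<^esub>"
    using f x by (simp add: cycle_def gr_inner_hom_simps(2))
  then have "dif N i (f i x) \<ominus>\<^bsub>gr N (i + 1)\<^esub> f (i + 1) (dif M i x) = \<zero>\<^bsub>gr N (i + 1)\<^esub>"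
    using x by (simp add: dif_inner_hom)
  then show ?thesis
    using c uminus_unique[of "dif N i (f i x)" "\<ominus>\<^bsub>gr N (i + 1)\<^esub> f (i + 1) (dif M i x)"]
    by (simp add: a_minus_def)
qed

text \<open>In degree \<open>-1\<close> the sign in the differential of the inner hom turns the
  difference of its two terms into a sum, which is the usual homotopy formula.\<close>

lemma homologous_inner_homE:
  fixes M :: "('k, 'm) cpx" and N :: "('k, 'n) cpx"
  assumes M: "is_complex R M" and N: "is_complex R N" and fg: "homologous (inner_hom R M N) 0 f g"
    and f: "f \<in> elts (inner_hom R M N) 0" and g: "g \<in> elts (inner_hom R M N) 0"
  obtains h where "\<And>i. lin (gr M i) (gr N (i - 1)) (h i)"
    "\<And>i x. x \<in> elts M i \<Longrightarrow> f i x \<ominus>\<^bsub>gr N i\<^esub> g i x =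
       dif N (i - 1) (h i x) \<oplus>\<^bsub>gr N i\<^esub> h (i + 1) (dif M i x)"
proof -
  note m = is_complexD(1)[OF M] is_complexD(1)[OF N]
  obtain h where h: "h \<in> elts (inner_hom R M N) (0 - 1)"
    "f \<ominus>\<^bsub>gr (inner_hom R M N) 0\<^esub> g = dif (inner_hom R M N) (0 - 1) h"
    using fg by (auto simp: homologous_def)
  have lin: "lin (gr M i) (gr N (i - 1)) (h i)" for i
    using inner_homD(1)[OF h(1), of i] by simp
  have "f i x \<ominus>\<^bsub>gr N i\<^esub> g i x = dif N (i - 1) (h i x) \<oplus>\<^bsub>gr N i\<^esub> h (i + 1) (dif M i x)"
    if x: "x \<in> elts M i" for i x
  proof -
    have c: "h (i + 1) (dif M i x) \<in> elts N i"
      using linear_mapD(1)[OF lin is_complexD(4)[OF M x]] by simp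
    have "f i x \<ominus>\<^bsub>gr N i\<^esub> g i x = (f \<ominus>\<^bsub>gr (inner_hom R M N) 0\<^esub> g) i x"
      using inner_hom_pointwise(1)[OF m f x g] by simp
    also have "\<dots> = dif N (i - 1) (h i x) \<ominus>\<^bsub>gr N i\<^esub> sgm (gr N i) (-1) (h (i + 1) (dif M i x))"
      unfolding h(2) using x by (simp add: dif_inner_hom)
    finally show ?thesis
      using c m(2) by (simp add: sgm_odd a_minus_def)
  qed
  with lin show ?thesis by (rule that)
qed

text \<open>The two complexes live over different types and can be compared only after both are
  embedded in a third one. Relabelling is an isomorphism of complexes, so conjugation by it carries
  chain maps and homotopies back.\<close>

lemma K_iso_relabel:
  fixes M :: "('k, 'm) cpx" and N :: "('k, 'n) cpx" and \<delta> :: "'m \<Rightarrow> 'v" and \<epsilon> :: "'n \<Rightarrow> 'v"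
  assumes M: "is_complex R M" and N: "is_complex R N" and \<delta>: "inj \<delta>" and \<epsilon>: "inj \<epsilon>"
    and t: "K_invertible (kcat R (Cdg R)) (relabel_cpx \<delta> M) (relabel_cpx \<epsilon> N) t"
  shows "K_iso R M N (\<lambda>x. inv_into UNIV \<epsilon> (t (fst x) (\<delta> (snd x))))"
proof -
  let ?M = "relabel_cpx \<delta> M" and ?N = "relabel_cpx \<epsilon> N"
  let ?d = "inv_into UNIV \<delta>" and ?e = "inv_into UNIV \<epsilon>"
  have M': "is_complex R ?M" and N': "is_complex R ?N"
    using is_complex_relabel[OF M \<delta>] is_complex_relabel[OF N \<epsilon>] by auto
  obtain u where t: "cycle (inner_hom R ?M ?N) 0 t" and u: "cycle (inner_hom R ?N ?M) 0 u"
    and tu: "homologous (inner_hom R ?M ?M) 0 (hcomp ?M t 0 u) (id_map ?M)"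
    and ut: "homologous (inner_hom R ?N ?N) 0 (hcomp ?N u 0 t) (id_map ?N)"
    by (rule K_invertible_CdgE[OF M' N' t])
  have t': "t \<in> elts (inner_hom R ?M ?N) 0" and u': "u \<in> elts (inner_hom R ?N ?M) 0"
    using t u by (auto simp: cycle_def)
  \<comment> \<open>Stated for arbitrary complexes and injections, because it is needed for
    \<open>t\<close> and, with the roles exchanged, for \<open>u\<close>.\<close>
  have aux: "K_mor R [P] Q (\<lambda>xs. inv_into UNIV \<beta> (f (fst (xs ! 0)) (\<alpha> (snd (xs ! 0)))))"
    if P: "is_complex R P" and Q: "is_complex R Q" and \<alpha>: "inj \<alpha>" and \<beta>: "inj \<beta>"
      and f: "cycle (inner_hom R (relabel_cpx \<alpha> P) (relabel_cpx \<beta> Q)) 0 f"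
    for P :: "('k, 'a) cpx" and Q :: "('k, 'b) cpx" and \<alpha> :: "'a \<Rightarrow> 'v" and \<beta> :: "'b \<Rightarrow> 'v" and f
  proof -
    note P' = is_complex_relabel[OF P \<alpha>] and Q' = is_complex_relabel[OF Q \<beta>]
    have f': "f \<in> elts (inner_hom R (relabel_cpx \<alpha> P) (relabel_cpx \<beta> Q)) 0"
      using f by (simp add: cycle_def)
    have lf: "lin (gr (relabel_cpx \<alpha> P) i) (gr (relabel_cpx \<beta> Q) i) (f i)" for i
      using inner_homD(1)[OF f', of i] by simp
    have lin: "lin (gr P i) (gr Q i) (\<lambda>x. inv_into UNIV \<beta> (f i (\<alpha> x)))" for i
      by (rule linear_map_compose[OF linear_map_compose[OF relabel_linear(1)[OF \<alpha>] lf] relabel_linear(2)[OF \<beta>]])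
    have "dif Q i (inv_into UNIV \<beta> (f i (\<alpha> x))) = inv_into UNIV \<beta> (f (i + 1) (\<alpha> (dif P i x)))"
      if x: "x \<in> elts P i" for i x
    proof -
      have ax: "\<alpha> x \<in> elts (relabel_cpx \<alpha> P) i" using x relabel_linear(4)[OF \<alpha>] by simp
      show ?thesis
        using cycle_inner_hom_dif[OF P' Q' f ax] relabel_linear(5)[OF \<beta> linear_mapD(1)[OF lf ax]]
          relabel_linear(3)[OF \<alpha> x] by simp
    qed
    then show ?thesis
      unfolding K_mor1_iff[OF P Q] using lin by simp
  qed
  have aux2: "K_eq R [P] P (\<lambda>xs. inv_into UNIV \<alpha> (g (fst (xs ! 0)) (\<beta> (inv_into UNIV \<beta> (f (fst (xs ! 0)) (\<alpha> (snd (xs ! 0))))))))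
      (\<lambda>xs. snd (xs ! 0))"
    if P: "is_complex R P" and Q: "is_complex R Q" and \<alpha>: "inj \<alpha>" and \<beta>: "inj \<beta>"
      and f: "f \<in> elts (inner_hom R (relabel_cpx \<alpha> P) (relabel_cpx \<beta> Q)) 0"
      and g: "g \<in> elts (inner_hom R (relabel_cpx \<beta> Q) (relabel_cpx \<alpha> P)) 0"
      and gf: "homologous (inner_hom R (relabel_cpx \<alpha> P) (relabel_cpx \<alpha> P)) 0 (hcomp (relabel_cpx \<alpha> P) f 0 g)
        (id_map (relabel_cpx \<alpha> P))"
    for P :: "('k, 'a) cpx" and Q :: "('k, 'b) cpx" and \<alpha> :: "'a \<Rightarrow> 'v" and \<beta> :: "'b \<Rightarrow> 'v" and f g
  proof -
    let ?P = "relabel_cpx \<alpha> P" and ?a = "inv_into UNIV \<alpha>"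
    note P' = is_complex_relabel[OF P \<alpha>] and Q' = is_complex_relabel[OF Q \<beta>]
    note m = is_complexD(1)[OF P'] is_complexD(1)[OF P]
    have lgf: "lin (gr ?P i) (gr ?P (i + 0)) (\<lambda>x. g (i + 0) (f i x))" for i
      using linear_map_compose[OF inner_homD(1)[OF f, of i] inner_homD(1)[OF g, of "i + 0"]] by simp
    have c: "hcomp ?P f 0 g \<in> elts (inner_hom R ?P ?P) 0"
      unfolding hcomp_def by (rule inner_hom_memI[OF lgf m(1)])
    have i: "id_map ?P \<in> elts (inner_hom R ?P ?P) 0"
      using cycle_id_map[OF P'] by (simp add: cycle_def)
    obtain h where h: "\<And>i. lin (gr ?P i) (gr ?P (i - 1)) (h i)"
      "\<And>i x. x \<in> elts ?P i \<Longrightarrow> hcomp ?P f 0 g i x \<ominus>\<^bsub>gr ?P i\<^esub> id_map ?P i x =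
       dif ?P (i - 1) (h i x) \<oplus>\<^bsub>gr ?P i\<^esub> h (i + 1) (dif ?P i x)"
      by (rule homologous_inner_homE[OF P' P' gf c i]) blast
    have lin: "lin (gr P i) (gr P (i - 1)) (\<lambda>x. ?a (h i (\<alpha> x)))" for i
      by (rule linear_map_compose[OF linear_map_compose[OF relabel_linear(1)[OF \<alpha>] h(1)] relabel_linear(2)[OF \<alpha>]])
    have eq: "?a (g i (\<beta> (inv_into UNIV \<beta> (f i (\<alpha> x))))) \<ominus>\<^bsub>gr P i\<^esub> x =
      dif P (i - 1) (?a (h i (\<alpha> x))) \<oplus>\<^bsub>gr P i\<^esub> ?a (h (i + 1) (\<alpha> (dif P i x)))"
      if x: "x \<in> elts P i" for i x
    proof -
      have ax: "\<alpha> x \<in> elts ?P i" using x relabel_linear(4)[OF \<alpha>] by simp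
      have fx: "f i (\<alpha> x) \<in> elts (relabel_cpx \<beta> Q) i" using inner_homD(2)[OF f ax] by simp
      \<comment> \<open>\<open>inv_into\<close> is a right inverse only on the range of
        \<open>\<beta>\<close>; the values of \<open>f\<close> lie there since the target complex is
        relabelled.\<close>
      then have b: "\<beta> (inv_into UNIV \<beta> (f i (\<alpha> x))) = f i (\<alpha> x)"
        using \<beta> by (auto simp: relabel_linear(4)[OF \<beta>])
      have gx: "g i (f i (\<alpha> x)) \<in> elts ?P i" using inner_homD(2)[OF g fx] by simp
      have hx: "h i (\<alpha> x) \<in> elts ?P (i - 1)" using linear_mapD(1)[OF h(1) ax] .
      have hdx: "h (i + 1) (\<alpha> (dif P i x)) \<in> elts ?P i"
        using linear_mapD(1)[OF h(1)[of "i + 1"], of "\<alpha> (dif P i x)"] is_complexD(4)[OF P x] relabel_linear(4)[OF \<alpha>]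
        by simp
      have dhx: "dif ?P (i - 1) (h i (\<alpha> x)) \<in> elts ?P i"
        using is_complexD(5)[OF P' hx] .
      note la = relabel_linear(2)[OF \<alpha>, of P i]
      have "?a (g i (f i (\<alpha> x)) \<ominus>\<^bsub>gr ?P i\<^esub> \<alpha> x) = ?a (dif ?P (i - 1) (h i (\<alpha> x)) \<oplus>\<^bsub>gr ?P i\<^esub> h (i + 1) (\<alpha> (dif P i x)))"
        using h(2)[OF ax] ax relabel_linear(3)[OF \<alpha> x] by (simp add: hcomp_def id_map_def)
      then show ?thesis
        using linear_map_more(3)[OF la m gx ax] linear_mapD(2)[OF la dhx hdx] relabel_linear(5)[OF \<alpha> hx] \<alpha> b
        by simp
    qed
    show ?thesis
      by (rule iffD2[OF K_eq1_iff[OF P P] exI[of _ "\<lambda>i x. ?a (h i (\<alpha> x))"]]) (use lin eq in simp)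
  qed
  show ?thesis
    unfolding K_iso_def
  proof (intro conjI exI[of _ "\<lambda>y. ?d (u (fst y) (\<epsilon> (snd y)))"])
    show "K_mor R [M] N (\<lambda>xs. ?e (t (fst (xs ! 0)) (\<delta> (snd (xs ! 0)))))"
      by (rule aux[OF M N \<delta> \<epsilon> t])
    show "K_mor R [N] M (\<lambda>ys. ?d (u (fst (ys ! 0)) (\<epsilon> (snd (ys ! 0)))))"
      by (rule aux[OF N M \<epsilon> \<delta> u])
  qed (use aux2[OF M N \<delta> \<epsilon> t' u' tu] aux2[OF N M \<epsilon> \<delta> u' t' ut] in simp_all)
qed

lemma hcomp_closed:
  assumes M: "\<And>i. module R (gr M i)" and f: "f \<in> elts (inner_hom R M N) m"
    and g: "g \<in> elts (inner_hom R N P) n" and t: "t = m + n"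
  shows "hcomp M f m g \<in> elts (inner_hom R M P) t"
proof -
  have "lin (gr M i) (gr P (i + t)) (\<lambda>x. g (i + m) (f i x))" for i
    using linear_map_compose[OF inner_homD(1)[OF f, of i] inner_homD(1)[OF g, of "i + m"]] t
    by (simp add: add.assoc)
  then show ?thesis unfolding hcomp_def by (rule inner_hom_memI) (rule M)
qed

lemma inner_hom_eq_restrict:
  assumes "f \<in> elts (inner_hom R M N) n" and "\<And>i x. x \<in> elts M i \<Longrightarrow> f i x = g i x"
  shows "f = (\<lambda>i. \<lambda>x\<in>elts M i. g i x)"
proof
  fix i
  show "f i = (\<lambda>x\<in>elts M i. g i x)"
    by (rule extensionalityI[of _ "elts M i"]) (use assms in \<open>auto simp: gr_inner_hom_simps(1)\<close>)
qed

lemma (in kmod) Cdg_natural_identity: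
  assumes "u \<in> carrier M" "v \<in> carrier M" "w \<in> carrier M" "p \<in> carrier M" "q \<in> carrier M"
    and "\<ominus>\<^bsub>M\<^esub> u \<oplus>\<^bsub>M\<^esub> ((v \<ominus>\<^bsub>M\<^esub> w) \<oplus>\<^bsub>M\<^esub> (p \<oplus>\<^bsub>M\<^esub> q)) = \<zero>\<^bsub>M\<^esub>"
  shows "p \<ominus>\<^bsub>M\<^esub> u = \<ominus>\<^bsub>M\<^esub> v \<oplus>\<^bsub>M\<^esub> (w \<oplus>\<^bsub>M\<^esub> \<ominus>\<^bsub>M\<^esub> q)"
proof -
  have "p = \<ominus>\<^bsub>M\<^esub> (\<ominus>\<^bsub>M\<^esub> u \<oplus>\<^bsub>M\<^esub> ((v \<ominus>\<^bsub>M\<^esub> w) \<oplus>\<^bsub>M\<^esub> q))"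
    using assms by (intro uminus_unique) (simp_all add: a_ac)
  then show ?thesis
    using assms(1-5) by algebra
qed

text \<open>This is \<open>natural_square\<close> evaluated at an element \<open>y\<close>. Here
  \<open>n\<close> is a degree of maps of complexes, so paths contain \<open>n - 1\<close>. The
  shape of the hypotheses fits a letter in either of the two arguments of the functors.\<close>

lemma Cdg_natural_square:
  assumes r: "natural_transformation R As (Cdg R) f g r" and ws: "is_tuple As ws"
    and rh: "rhat R f g (-1) r ws = [(sg R (- (n - 1)), (F0, [(G0, -1, r0), (G1, n - 1, g1)])),
      (\<one>\<^bsub>R\<^esub>, (F0, [(G1, n - 1 - 1, rw)])), (\<one>\<^bsub>R\<^esub>, (F0, [(F1, n - 1, f1), (G1, -1, r1)]))]"
    and tb: "tbhat R As ws = [(\<one>\<^bsub>R\<^esub>, ws')]"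
    and rh': "rhat R f g (-1) r ws' = [(c, (F0, [l1, l2])), (\<one>\<^bsub>R\<^esub>, (F0, [(G1, n - 1, rw')])), (c', (F0, [l3, l4]))]"
    and cc: "c \<in> carrier R" "c' \<in> carrier R"
    and rw: "rw \<in> elts (inner_hom R F0 G1) (n - 1)" and y: "y \<in> elts F0 i"
  shows "r1 (i + n) (f1 i y) \<ominus>\<^bsub>gr G1 (i + n)\<^esub> g1 i (r0 i y) =
    \<ominus>\<^bsub>gr G1 (i + n)\<^esub> dif G1 (i + (n - 1)) (rw i y) \<oplus>\<^bsub>gr G1 (i + n)\<^esub>
    (sgm (gr G1 (i + n)) (n - 1) (rw (i + 1) (dif F0 i y)) \<oplus>\<^bsub>gr G1 (i + n)\<^esub> \<ominus>\<^bsub>gr G1 (i + n)\<^esub> rw' i y)"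
proof -
  note sq = natural_square[OF kquiver_Cdg r ws rh tb rh' cc, unfolded Cdg_simps, simplified]
  have o: "is_complex R F0" "is_complex R F1" "is_complex R G0" "is_complex R G1" using sq(1) by auto
  note m0 = is_complexD(1)[OF o(1)] and m1 = is_complexD(1)[OF o(4)]
  let ?H = "gr (inner_hom R F0 G1) n" and ?M = "gr G1 (i + n)"
  interpret H: kmod R ?H by (rule kmod[OF module_inner_hom[OF m0 m1]])
  interpret kmod R ?M by (rule kmod[OF m1])
  define u w where "u = hcomp F0 r0 0 g1" and "w = hcomp F0 f1 n r1"
  have u: "u \<in> carrier ?H" unfolding u_def by (rule hcomp_closed[OF m0]) (use sq(2) in auto)
  have w: "w \<in> carrier ?H" unfolding w_def by (rule hcomp_closed[OF m0]) (use sq(2) in auto)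
  define v where "v = dif (inner_hom R F0 G1) (n - 1) rw"
  have v: "v \<in> carrier ?H" and q: "rw' \<in> carrier ?H" using sq(3) by (auto simp: v_def)
  have "sgm ?H (n - 1) (sgm ?H n u) \<oplus>\<^bsub>?H\<^esub> (v \<oplus>\<^bsub>?H\<^esub> (w \<oplus>\<^bsub>?H\<^esub> rw')) = \<zero>\<^bsub>?H\<^esub>"
    using sq(4) by (simp add: u_def v_def w_def)
  \<comment> \<open>The sign \<open>n - 1\<close> of \<open>r\<close> passing the value of
    \<open>g\<close> and the sign \<open>n\<close> built into \<open>bmap (Cdg R)\<close> combine to
    \<open>-1\<close> for either parity.\<close>
  moreover have "sgm ?H (n - 1) (sgm ?H n u) = \<ominus>\<^bsub>?H\<^esub> u"
    using u by (auto simp: sgm_def)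
  ultimately have "(\<ominus>\<^bsub>?H\<^esub> u \<oplus>\<^bsub>?H\<^esub> (v \<oplus>\<^bsub>?H\<^esub> (w \<oplus>\<^bsub>?H\<^esub> rw'))) i y = \<zero>\<^bsub>?M\<^esub>"
    using y by (simp add: gr_inner_hom_simps(2))
  then have eq: "\<ominus>\<^bsub>?M\<^esub> u i y \<oplus>\<^bsub>?M\<^esub> (v i y \<oplus>\<^bsub>?M\<^esub> (w i y \<oplus>\<^bsub>?M\<^esub> rw' i y)) = \<zero>\<^bsub>?M\<^esub>"
    using y inner_hom_uminus[OF m0 m1 u y] by (simp add: gr_inner_hom_simps(3))
  have vy: "v i y = dif G1 (i + (n - 1)) (rw i y) \<ominus>\<^bsub>?M\<^esub> sgm ?M (n - 1) (rw (i + 1) (dif F0 i y))"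
    using y by (simp add: v_def dif_inner_hom)
  have c: "dif G1 (i + (n - 1)) (rw i y) \<in> carrier ?M"
    using is_complexD(4)[OF o(4) inner_homD(2)[OF rw y]] by simp
  have c': "rw (i + 1) (dif F0 i y) \<in> carrier ?M"
    using inner_homD(2)[OF rw is_complexD(4)[OF o(1) y]] by simp
  have "w i y \<ominus>\<^bsub>?M\<^esub> u i y = \<ominus>\<^bsub>?M\<^esub> dif G1 (i + (n - 1)) (rw i y) \<oplus>\<^bsub>?M\<^esub>
    (sgm ?M (n - 1) (rw (i + 1) (dif F0 i y)) \<oplus>\<^bsub>?M\<^esub> \<ominus>\<^bsub>?M\<^esub> rw' i y)"
    by (rule Cdg_natural_identity)
      (use inner_homD(2)[OF u y] inner_homD(2)[OF w y] inner_homD(2)[OF q y] c c' eq vy closed_facts(6) in auto)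
  then show ?thesis
    using y by (simp add: u_def w_def hcomp_def)
qed

section \<open>One-term composites evaluated at an element\<close>

lemma lsum_single_eval:
  assumes "module R (gr N (i + n))" and "x \<in> elts M i" and "h i x \<in> elts N (i + n)"
  shows "lsum (gr (inner_hom R M N) n) [\<one>\<^bsub>R\<^esub> \<odot>\<^bsub>gr (inner_hom R M N) n\<^esub> h] i x = h i x"
  using assms by (simp add: gr_inner_hom_simps(2,3,4))

text \<open>On arguments of total length one, \<open>fhat\<close> has a single summand. The
  composite is then a one-term sum, and relabelling acts by \<open>\<epsilon>\<close> on
  elements.\<close>

lemma relabel_functor_eval:
  fixes \<epsilon> :: "'v \<Rightarrow> 'w"
  assumes \<epsilon>: "inj \<epsilon>" and fh: "fhat R f ws = [(\<one>\<^bsub>R\<^esub>, (M, [(N, d, h)]))]"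
    and M: "fob f (map fst ws) = M" and N: "fob f (map ptgt ws) = N" and d: "tdeg ws = d"
    and Nc: "is_complex R N" and p: "p \<in> elts M i" and hp: "h i p \<in> elts N (i + (d + 1))"
  shows "fcomp (afun_comp R (Cdg R) f (relabel_functor R \<epsilon>)) ws i (\<epsilon> p) = \<epsilon> (h i p)"
proof -
  let ?M = "relabel_cpx \<epsilon> M"
  let ?N = "relabel_cpx \<epsilon> N"
  have ep: "\<epsilon> p \<in> elts (?M) i" "\<epsilon> (h i p) \<in> elts (?N) (i + (d + 1))"
    using p hp by (auto simp: relabel_linear(4)[OF \<epsilon>])
  let ?h = "\<lambda>i. \<lambda>y\<in>\<epsilon> ` elts M i. \<epsilon> (h i (inv_into UNIV \<epsilon> y))"
  have h: "?h i (\<epsilon> p) = \<epsilon> (h i p)" using p \<epsilon> by simp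
  have "fcomp (afun_comp R (Cdg R) f (relabel_functor R \<epsilon>)) ws =
      lsum (gr (inner_hom R (?M) (?N)) (d + 1))
        [\<one>\<^bsub>R\<^esub> \<odot>\<^bsub>gr (inner_hom R (?M) (?N)) (d + 1)\<^esub> ?h]"
    by (simp add: afun_comp_def Let_def fh M N d Cdg_simps relabel_functor_def)
  then show ?thesis
    using lsum_single_eval[of "?N" i "d + 1" "\<epsilon> p" "?M" ?h]
      is_complexD(1)[OF is_complex_relabel[OF Nc \<epsilon>]] ep h by simp
qed

text \<open>The map \<open>h\<close> goes from \<open>N\<close> to \<open>M\<close>, against the
  direction of the path, because \<open>f\<close> takes values in the opposite of the category of
  complexes. The sign is the one in the definition of \<open>D_1\<close>, with \<open>d + 1\<close>
  the degree of \<open>h\<close> outside the suspension.\<close>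

lemma D_functor_eval:
  fixes M N :: "('k, 'm) cpx"
  assumes fh: "fhat R f ws = [(\<one>\<^bsub>R\<^esub>, (M, [(N, d, h)]))]"
    and M: "fob f (map fst ws) = M" and N: "fob f (map ptgt ws) = N" and d: "tdeg ws = d"
    and Nc: "is_complex R N" and h: "h \<in> elts (inner_hom R N M) (d + 1)"
    and g: "g \<in> elts (dual R M) j"
  shows "fcomp (afun_comp R (Cdg R) f (D_functor R)) ws j g =
    (\<lambda>i. \<lambda>p\<in>elts N i. sg R ((d + 1) * j) \<otimes>\<^bsub>R\<^esub> g (i + (d + 1)) (h i p))" (is ?goal1)
    and "fcomp (afun_comp R (Cdg R) f (D_functor R)) ws j g \<in> elts (dual R N) (j + (d + 1))" (is ?goal2)
proof -
  note mN = is_complexD(1)[OF Nc] and mU = is_complexD(1)[OF is_complex_unit_cpx]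
  note mD = is_complexD(1)[OF is_complex_dual[OF Nc]]
  let ?s = "sgm (gr (dual R N) (j + (d + 1))) ((d + 1) * j)"
  let ?h = "\<lambda>j. \<lambda>g\<in>elts (dual R M) j. sgm (gr (dual R N) (j + (d + 1))) ((d + 1) * j) (hcomp N h (d + 1) g)"
  have hc: "hcomp N h (d + 1) g \<in> elts (dual R N) (j + (d + 1))"
    by (rule hcomp_closed[OF mN h g]) simp
  have "fcomp (afun_comp R (Cdg R) f (D_functor R)) ws =
      lsum (gr (inner_hom R (dual R M) (dual R N)) (d + 1))
        [\<one>\<^bsub>R\<^esub> \<odot>\<^bsub>gr (inner_hom R (dual R M) (dual R N)) (d + 1)\<^esub> ?h]"
    by (simp add: afun_comp_def Let_def fh M N d Cdg_simps D_functor_def)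
  then have eq: "fcomp (afun_comp R (Cdg R) f (D_functor R)) ws j g = ?s (hcomp N h (d + 1) g)"
    using lsum_single_eval[of "dual R N" j "d + 1" g "dual R M" ?h] mD hc g by simp
  then show mem: ?goal2
    using hc mD by simp
  show ?goal1
  proof (rule inner_hom_eq_restrict[OF mem])
    fix i p assume p: "p \<in> elts N i"
    have gp: "g (i + (d + 1)) (h i p) \<in> elts (unit_cpx R) (i + (j + (d + 1)))"
      using inner_homD(2)[OF hc p] p by (simp add: hcomp_def)
    show "fcomp (afun_comp R (Cdg R) f (D_functor R)) ws j g i p = sg R ((d + 1) * j) \<otimes>\<^bsub>R\<^esub> g (i + (d + 1)) (h i p)"
      unfolding eq inner_hom_pointwise(2)[OF mN mU hc p]
      using module_simps(8)[OF mU gp, of "(d + 1) * j"] p by (simp add: unit_cpx_simps hcomp_def)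
  qed
qed

end

section \<open>The Hom-functor\<close>

context ainf_cat
begin

text \<open>The shift contributes the sign \<open>n\<close>, exactly what turns \<open>b_2\<close>
  into \<open>m2\<close>, so right multiplication occurs without a sign.\<close>

lemma Hom_functor_right:
  assumes [simp]: "X \<in> obj A" "Z \<in> obj A" "W \<in> obj A" and z: "z \<in> el Z W n"
  shows "fcomp (Hom_functor R A) [(X, []), (Z, [(W, n - 1, z)])] =
    (\<lambda>i. \<lambda>p\<in>el X Z i. m2 A X Z W (i, p) (n, z))"
  by (simp add: Hom_functor_def rev_path_def gamma_exp_def m2_def)

lemma sgm_b2:
  assumes "X \<in> obj A" "Y \<in> obj A" "Z \<in> obj A" "x \<in> el X Y a" "y \<in> el Y Z b"
    and "t = a + b" and "even (e - (e' + b))"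
  shows "sgm (mor A X Z t) e (bmap A (X, [(Y, a - 1, x), (Z, b - 1, y)])) = sgm (mor A X Z t) e' (m2 A X Y Z (a, x) (b, y))"
proof -
  have "b2 X Y Z a x b y \<in> el X Z t" using assms by auto
  then show ?thesis
    using assms sgm_parity[OF assms(7)] by (simp add: m2_b2 flip: b2_def)
qed

lemma sgm_sgm_b2:
  assumes "X \<in> obj A" "Y \<in> obj A" "Z \<in> obj A" "x \<in> el X Y a" "y \<in> el Y Z b"
    and "t = a + b"
  shows "sgm (mor A X Z t) e (sgm (mor A X Z t) e' (bmap A (X, [(Y, a - 1, x), (Z, b - 1, y)]))) =
    sgm (mor A X Z t) (e + e') (bmap A (X, [(Y, a - 1, x), (Z, b - 1, y)]))"
proof -
  have "b2 X Y Z a x b y \<in> el X Z t" using assms by auto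
  then show ?thesis using assms by (simp flip: b2_def)
qed

text \<open>The shift gives \<open>n\<close>, the flip \<open>(i - 1) * (n - 1)\<close>, and
  \<open>\<gamma>\<close> gives \<open>1\<close>; the sum has the parity of
  \<open>i * n + i\<close>. The part \<open>i\<close> belongs to \<open>m2\<close>, and
  \<open>i * n\<close> is the Koszul sign for moving \<open>x\<close> past \<open>p\<close>.\<close>

lemma Hom_functor_left:
  assumes [simp]: "X \<in> obj A" "Y \<in> obj A" "Z \<in> obj A" and x: "x \<in> el Y X n"
  shows "fcomp (Hom_functor R A) [(X, [(Y, n - 1, x)]), (Z, [])] =
    (\<lambda>i. \<lambda>p\<in>el X Z i. sgm (mor A Y Z (i + n)) (i * n) (m2 A Y X Z (n, x) (i, p)))"
  apply (simp add: Hom_functor_def Let_def rev_path_def gamma_exp_def)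
  apply (intro ext)
  using x apply (simp add: algebra_simps)
  apply (intro impI sgm_b2)
        apply simp_all
  done

lemma mor_cpx_op: "mor_cpx (ainf_op A) X Y = mor_cpx A Y X"
  by (simp add: mor_cpx_def ainf_op_def rev_path_def gamma_exp_def sgm_even)

text \<open>Opposites exchange left and right multiplication. The sign \<open>i * n\<close> of left
  multiplication now stems from \<open>\<gamma>\<close> in the operations of
  \<open>ainf_op A\<close>. In the other variable, treated next, this reversal sign meets the flip
  and cancels.\<close>

lemma Hom_functor_op_right:
  assumes [simp]: "X \<in> obj A" "Z \<in> obj A" "W \<in> obj A" and z: "z \<in> el Z W n"
  shows "fcomp (Hom_functor R (ainf_op A)) [(X, []), (W, [(Z, n - 1, z)])] =
    (\<lambda>i. \<lambda>p\<in>el W X i. sgm (mor A Z X (i + n)) (i * n) (m2 A Z W X (n, z) (i, p)))"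
  apply (simp add: Hom_functor_def Let_def rev_path_def gamma_exp_def ainf_op_def)
  apply (intro ext)
  using z apply (simp add: algebra_simps sgm_sgm_b2)
  apply (intro impI sgm_b2)
        apply simp_all
  done

lemma Hom_functor_op_left:
  assumes [simp]: "X \<in> obj A" "X' \<in> obj A" "Y \<in> obj A" and x: "x \<in> el X' X n"
  shows "fcomp (Hom_functor R (ainf_op A)) [(X', [(X, n - 1, x)]), (Y, [])] =
    (\<lambda>i. \<lambda>p\<in>el Y X' i. m2 A Y X' X (i, p) (n, x))"
  apply (simp add: Hom_functor_def Let_def rev_path_def gamma_exp_def ainf_op_def)
  apply (intro ext)
  using x apply (simp add: algebra_simps sgm_sgm_b2)
  apply (intro impI)
  apply (subst sgm_b2[where e' = 0])
          apply simp_all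
  done

end

section \<open>Serre functors\<close>

text \<open>\<open>F\<close> and \<open>G\<close> are parameters with defining equations so that the
  two long composites stay folded in goals. \<open>r\<close> is an isomorphism between them, with
  its invertibility unpacked to pairs of objects.\<close>

locale right_serre = unital_ainf_cat R A + S: ainf_fun R A A S
  for R :: "'k ring" and A :: "('k, 'o, 'h) ainf" and S :: "('o, 'h, 'o, 'h) afun" +
  fixes F G :: "('o, 'h, ('k, 'h + (int \<Rightarrow> 'h \<Rightarrow> 'k)) cpx, int \<Rightarrow> 'h + (int \<Rightarrow> 'h \<Rightarrow> 'k) \<Rightarrow> 'h + (int \<Rightarrow> 'h \<Rightarrow> 'k)) afun"
    and r :: "('o, 'h) path list \<Rightarrow> int \<Rightarrow> 'h + (int \<Rightarrow> 'h \<Rightarrow> 'k) \<Rightarrow> 'h + (int \<Rightarrow> 'h \<Rightarrow> 'k)"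
  defines F_def: "F \<equiv> afun_comp R (Cdg R) (one_S_Hom R A S) (relabel_functor R Inl)"
    and G_def: "G \<equiv> afun_comp R (Cdg R) (Hom_op_D R A) (relabel_functor R Inr)"
  assumes natural: "natural_transformation R [ainf_op A, A] (Cdg R) F G r"
    and invertible: "X \<in> obj A \<Longrightarrow> Y \<in> obj A \<Longrightarrow>
      K_invertible (kcat R (Cdg R)) (fob F [X, Y]) (fob G [X, Y]) (r [(X, []), (Y, [])])"
begin

lemma fob_one_S_Hom: "fob (one_S_Hom R A S) [X, Y] = mor_cpx A X (S.fo Y)"
  by (simp add: one_S_Hom_def afun_tuple_comp_def Let_def Hom_functor_def)

lemma fob_Hom_op_D: "fob (Hom_op_D R A) [X, Y] = dual R (mor_cpx A Y X)"
  by (simp add: Hom_op_D_def D_functor_def afun_op_def Hom_functor_def mor_cpx_op)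

lemma fob_F: "fob F [X, Y] = relabel_cpx Inl (mor_cpx A X (S.fo Y))"
  by (simp add: F_def relabel_functor_def fob_one_S_Hom)

lemma fob_G: "fob G [X, Y] = relabel_cpx Inr (dual R (mor_cpx A Y X))"
  by (simp add: G_def relabel_functor_def fob_Hom_op_D)

text \<open>The identity functor contributes an empty path and \<open>S\<close> one path of length
  one. So the product of the two expansions has a single term, in which only \<open>S_1\<close>
  occurs.\<close>

lemma one_S_Hom_right:
  assumes [simp]: "X \<in> obj A" "Y \<in> obj A" "Z \<in> obj A"
    and z: "z \<in> el Y Z n" and p: "p \<in> el X (S.fo Y) i"
  shows "fcomp (one_S_Hom R A S) [(X, []), (Y, [(Z, n - 1, z)])] i p =
    m2 A X (S.fo Y) (S.fo Z) (i, p) (n, S.f1 Y Z n z)"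
proof -
  let ?h = "fcomp (Hom_functor R A) [(X, []), (S.fo Y, [(S.fo Z, n - 1, S.f1 Y Z n z)])]"
  let ?H = "gr (inner_hom R (mor_cpx A X (S.fo Y)) (mor_cpx A X (S.fo Z))) n"
  have m: "m2 A X (S.fo Y) (S.fo Z) (i, p) (n, S.f1 Y Z n z) \<in> el X (S.fo Z) (i + n)"
    using z p by (intro m2_linear) auto
  have "fcomp (one_S_Hom R A S) [(X, []), (Y, [(Z, n - 1, z)])] =
    lsum (?H)
     [\<one>\<^bsub>R\<^esub> \<odot>\<^bsub>?H\<^esub>
        ?h]"
    using fob_one_S_Hom
    by (simp add: one_S_Hom_def afun_tuple_comp_def Let_def fhat_simps(1) S.fhat_f(1)[of Y Z "n - 1"] Cdg_simps Hom_functor_def)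
  then show ?thesis
    using lsum_single_eval[of "mor_cpx A X (S.fo Z)" i n p "mor_cpx A X (S.fo Y)"
        "?h"] p z m
    by (simp add: Hom_functor_right)
qed

lemma one_S_Hom_left:
  assumes [simp]: "X \<in> obj A" "X' \<in> obj A" "Y \<in> obj A"
    and x: "x \<in> el X' X n" and p: "p \<in> el X (S.fo Y) i"
  shows "fcomp (one_S_Hom R A S) [(X, [(X', n - 1, x)]), (Y, [])] i p =
    sgm (mor A X' (S.fo Y) (i + n)) (i * n) (m2 A X' X (S.fo Y) (n, x) (i, p))"
proof -
  let ?h = "fcomp (Hom_functor R A) [(X, [(X', n - 1, x)]), (S.fo Y, [])]"
  let ?H = "gr (inner_hom R (mor_cpx A X (S.fo Y)) (mor_cpx A X' (S.fo Y))) n"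
  have m: "m2 A X' X (S.fo Y) (n, x) (i, p) \<in> el X' (S.fo Y) (i + n)"
    using x p by (intro m2_linear) auto
  have id: "fcomp (afun_id (ainf_op A)) [(X, [(X', n - 1, x)])] = x"
    by (simp add: afun_id_def)
  have "fcomp (one_S_Hom R A S) [(X, [(X', n - 1, x)]), (Y, [])] =
    lsum (?H)
     [\<one>\<^bsub>R\<^esub> \<odot>\<^bsub>?H\<^esub>
        ?h]"
    using id
    by (simp add: one_S_Hom_def afun_tuple_comp_def Let_def fhat_simps(1,2) Cdg_simps Hom_functor_def)
  then show ?thesis
    using lsum_single_eval[of "mor_cpx A X' (S.fo Y)" i n p "mor_cpx A X (S.fo Y)"
        "?h"] p x m
    by (simp add: Hom_functor_left)
qed

lemma F_right:
  assumes [simp]: "X \<in> obj A" "Y \<in> obj A" "Z \<in> obj A"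
    and z: "z \<in> el Y Z n" and p: "p \<in> el X (S.fo Y) i"
  shows "fcomp F [(X, []), (Y, [(Z, n - 1, z)])] i (Inl p) =
    Inl (m2 A X (S.fo Y) (S.fo Z) (i, p) (n, S.f1 Y Z n z))"
proof -
  have m: "m2 A X (S.fo Y) (S.fo Z) (i, p) (n, S.f1 Y Z n z) \<in> el X (S.fo Z) (i + n)"
    using z p by (intro m2_linear) auto
  show ?thesis
    unfolding F_def one_S_Hom_right[OF assms, symmetric]
    by (rule relabel_functor_eval[OF _ fhat_simps(6)])
      (use p m one_S_Hom_right[OF assms] in \<open>simp_all add: fob_one_S_Hom\<close>)
qed

lemma F_left:
  assumes [simp]: "X \<in> obj A" "X' \<in> obj A" "Y \<in> obj A"
    and x: "x \<in> el X' X n" and p: "p \<in> el X (S.fo Y) i"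
  shows "fcomp F [(X, [(X', n - 1, x)]), (Y, [])] i (Inl p) =
    Inl (sgm (mor A X' (S.fo Y) (i + n)) (i * n) (m2 A X' X (S.fo Y) (n, x) (i, p)))"
proof -
  have m: "m2 A X' X (S.fo Y) (n, x) (i, p) \<in> el X' (S.fo Y) (i + n)"
    using x p by (intro m2_linear) auto
  show ?thesis
    unfolding F_def one_S_Hom_left[OF assms, symmetric]
    by (rule relabel_functor_eval[OF _ fhat_simps(5)])
      (use p m one_S_Hom_left[OF assms] in \<open>simp_all add: fob_one_S_Hom\<close>)
qed

text \<open>The sign \<open>i * n\<close> of the Hom-functor, from \<open>z\<close> passing
  \<open>p\<close>, and the sign \<open>n * j\<close> of \<open>D_functor\<close>, from
  \<open>z\<close> passing \<open>\<phi>\<close>, add up to the exponent \<open>n * (i + j)\<close>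
  in \<open>dual_act_Y\<close>.\<close>

lemma G_right:
  assumes [simp]: "X \<in> obj A" "Y \<in> obj A" "Z \<in> obj A"
    and z: "z \<in> el Y Z n" and \<phi>: "\<phi> \<in> elts (dual R (mor_cpx A Y X)) j"
  shows "fcomp G [(X, []), (Y, [(Z, n - 1, z)])] j (Inr \<phi>) = Inr (dual_act_Y R (kcat R A) X Y Z (j, \<phi>) (n, z))"
    and "dual_act_Y R (kcat R A) X Y Z (j, \<phi>) (n, z) \<in> elts (dual R (mor_cpx A Z X)) (j + n)" (is ?goal1)
proof -
  let ?f = "afun_op (Cdg R) (Hom_functor R (ainf_op A))" and ?ws = "[(X, []), (Y, [(Z, n - 1, z)])]"
  let ?h = "\<lambda>i. \<lambda>p\<in>el Z X i. sgm (mor A Y X (i + n)) (i * n) (m2 A Y Z X (n, z) (i, p))"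
  have f: "fcomp ?f ?ws = ?h"
    using Hom_functor_op_right[OF assms(1,2,3) z]
    by (simp add: afun_op_def rev_path_def gamma_exp_def sgm_even)
  have fo: "fob ?f [X, Y] = mor_cpx A Y X" for X Y
    by (simp add: afun_op_def Hom_functor_def mor_cpx_op)
  have fh: "fhat R ?f ?ws = [(\<one>\<^bsub>R\<^esub>, (mor_cpx A Y X, [(mor_cpx A Z X, n - 1, ?h)]))]"
    by (simp add: fhat_simps fo f)
  have "lin (mor A Z X i) (mor A Y X (i + n)) (\<lambda>p. sgm (mor A Y X (i + n)) (i * n) (m2 A Y Z X (n, z) (i, p)))" for i
    using linear_map_sgm[OF m2_linear(2)[of Y Z X z n i], of "i * n"] z by (simp add: add.commute)
  then have h: "?h \<in> elts (inner_hom R (mor_cpx A Z X) (mor_cpx A Y X)) n"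
    using inner_hom_memI[of "mor_cpx A Z X" "mor_cpx A Y X" n
      "\<lambda>i p. sgm (mor A Y X (i + n)) (i * n) (m2 A Y Z X (n, z) (i, p))"] by simp
  note D = D_functor_eval[OF fh _ _ _ _ _ \<phi>]
  have "fcomp (Hom_op_D R A) ?ws j \<phi> =
    (\<lambda>i. \<lambda>p\<in>el Z X i. sg R (n * j) \<otimes>\<^bsub>R\<^esub> \<phi> (i + n) (?h i p))"
    unfolding Hom_op_D_def using D(1) h by (simp add: fo)
  also have "\<dots> = dual_act_Y R (kcat R A) X Y Z (j, \<phi>) (n, z)"
  proof -
    have "sg R (n * j) \<otimes>\<^bsub>R\<^esub> \<phi> (i + n) (sgm (mor A Y X (i + n)) (i * n) (m2 A Y Z X (n, z) (i, p))) =
      sg R (n * (i + j)) \<otimes>\<^bsub>R\<^esub> \<phi> (i + n) (m2 A Y Z X (n, z) (i, p))" if p: "p \<in> el Z X i" for i p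
    proof -
      let ?U = "gr (unit_cpx R) (i + n + j)"
      note mU = is_complexD(1)[OF is_complex_unit_cpx, of "i + n + j"]
      have q: "m2 A Y Z X (n, z) (i, p) \<in> el Y X (i + n)"
        using z p by (intro m2_linear) auto
      have l: "lin (mor A Y X (i + n)) ?U (\<phi> (i + n))"
        using inner_homD(1)[OF \<phi>, of "i + n"] by simp
      have pq: "\<phi> (i + n) (m2 A Y Z X (n, z) (i, p)) \<in> carrier ?U"
        using linear_mapD(1)[OF l q] .
      have "\<phi> (i + n) (sgm (mor A Y X (i + n)) (i * n) (m2 A Y Z X (n, z) (i, p))) =
        sg R (i * n) \<odot>\<^bsub>?U\<^esub> \<phi> (i + n) (m2 A Y Z X (n, z) (i, p))"
        using linear_map_more(4)[OF l _ mU q] module_simps(8)[OF mU pq] by simp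
      then show ?thesis
        using smult_distrib(3)[OF mU _ _ pq, of "sg R (n * j)" "sg R (i * n)"]
        by (simp add: unit_cpx_simps algebra_simps)
    qed
    then show ?thesis
      by (auto simp: dual_act_Y_def fun_eq_iff restrict_def)
  qed
  finally have eq: "fcomp (Hom_op_D R A) ?ws j \<phi> = dual_act_Y R (kcat R A) X Y Z (j, \<phi>) (n, z)" .
  show mem: ?goal1
    unfolding eq[symmetric] unfolding Hom_op_D_def using D(2) h by (simp add: fo)
  show "fcomp G ?ws j (Inr \<phi>) = Inr (dual_act_Y R (kcat R A) X Y Z (j, \<phi>) (n, z))"
    unfolding G_def eq[symmetric]
    by (rule relabel_functor_eval[OF _ fhat_simps(6)])
      (use \<phi> mem eq in \<open>simp_all add: fob_Hom_op_D is_complex_dual\<close>)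
qed

text \<open>In this variable the Hom-functor gives no sign, and \<open>j * n\<close> is the sign of
  \<open>D_functor\<close> alone. \<open>F_left\<close> carries the same one, as the component of
  \<open>r\<close> at objects preserves degrees; \<open>left_square_identity\<close> removes it from
  the square.\<close>

lemma G_left:
  assumes [simp]: "X \<in> obj A" "X' \<in> obj A" "Y \<in> obj A"
    and x: "x \<in> el X' X n" and \<phi>: "\<phi> \<in> elts (dual R (mor_cpx A Y X)) j"
  shows "fcomp G [(X, [(X', n - 1, x)]), (Y, [])] j (Inr \<phi>) =
      Inr (sgm (gr (dual R (mor_cpx A Y X')) (j + n)) (j * n) (dual_act_X (kcat R A) Y X' X (n, x) (j, \<phi>)))"
    and "dual_act_X (kcat R A) Y X' X (n, x) (j, \<phi>) \<in> elts (dual R (mor_cpx A Y X')) (j + n)"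
proof -
  let ?f = "afun_op (Cdg R) (Hom_functor R (ainf_op A))" and ?ws = "[(X, [(X', n - 1, x)]), (Y, [])]"
  let ?h = "\<lambda>i. \<lambda>p\<in>el Y X' i. m2 A Y X' X (i, p) (n, x)"
  have f: "fcomp ?f ?ws = ?h"
    using Hom_functor_op_left[OF assms(1,2,3) x]
    by (simp add: afun_op_def rev_path_def gamma_exp_def sgm_even)
  have fo: "fob ?f [X, Y] = mor_cpx A Y X" for X Y
    by (simp add: afun_op_def Hom_functor_def mor_cpx_op)
  have fh: "fhat R ?f ?ws = [(\<one>\<^bsub>R\<^esub>, (mor_cpx A Y X, [(mor_cpx A Y X', n - 1, ?h)]))]"
    by (simp add: fhat_simps fo f)
  have h: "?h \<in> elts (inner_hom R (mor_cpx A Y X') (mor_cpx A Y X)) n"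
    using inner_hom_memI[of "mor_cpx A Y X'" "mor_cpx A Y X" n "\<lambda>i p. m2 A Y X' X (i, p) (n, x)"] m2_linear(1) x
    by simp
  note D = D_functor_eval[OF fh _ _ _ _ _ \<phi>]
  let ?D = "gr (dual R (mor_cpx A Y X')) (j + n)"
  note mU = is_complexD(1)[OF is_complex_unit_cpx]
  have mD: "module R ?D" by (intro is_complexD(1) is_complex_dual) simp
  have act: "dual_act_X (kcat R A) Y X' X (n, x) (j, \<phi>) = hcomp (mor_cpx A Y X') ?h n \<phi>"
    by (auto simp: dual_act_X_def hcomp_def fun_eq_iff restrict_def)
  show mem: "dual_act_X (kcat R A) Y X' X (n, x) (j, \<phi>) \<in> carrier ?D"
    unfolding act by (rule hcomp_closed[OF _ h \<phi>]) (auto intro: is_complexD(1))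
  have "fcomp (Hom_op_D R A) ?ws j \<phi> =
    (\<lambda>i. \<lambda>p\<in>el Y X' i. sg R (n * j) \<otimes>\<^bsub>R\<^esub> \<phi> (i + n) (?h i p))"
    unfolding Hom_op_D_def using D(1) h by (simp add: fo)
  also have "\<dots> = sg R (n * j) \<odot>\<^bsub>?D\<^esub> dual_act_X (kcat R A) Y X' X (n, x) (j, \<phi>)"
    by (auto simp: gr_inner_hom_simps(4) dual_act_X_def fun_eq_iff restrict_def unit_cpx_simps)
  also have "\<dots> = sgm ?D (j * n) (dual_act_X (kcat R A) Y X' X (n, x) (j, \<phi>))"
    using module_simps(8)[OF mD mem] by (simp add: mult.commute)
  finally have eq: "fcomp (Hom_op_D R A) ?ws j \<phi> = sgm ?D (j * n) (dual_act_X (kcat R A) Y X' X (n, x) (j, \<phi>))" .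
  show "fcomp G ?ws j (Inr \<phi>) = Inr (sgm ?D (j * n) (dual_act_X (kcat R A) Y X' X (n, x) (j, \<phi>)))"
    unfolding G_def eq[symmetric]
    by (rule relabel_functor_eval[OF _ fhat_simps(5)])
      (use \<phi> mem mD eq in \<open>simp_all add: fob_Hom_op_D is_complex_dual\<close>)
qed

end

section \<open>Homotopy equivalences on homology, and naturality squares without labels\<close>

context ground
begin

text \<open>A homotopy inverse recovers the class of a cycle from the class of its image, so
  homotopy equivalences are injective on homology.\<close>

lemma K_iso_reflects:
  assumes M: "is_complex R M" and N: "is_complex R N" and iso: "K_iso R M N \<Psi>"
    and x: "cycle M a x" and y: "cycle M a y" and xy: "homologous N a (\<Psi> (a, x)) (\<Psi> (a, y))"
  shows "homologous M a x y"
proof -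
  obtain \<Phi> where \<Psi>: "K_mor R [M] N (\<lambda>xs. \<Psi> (xs ! 0))" and \<Phi>: "K_mor R [N] M (\<lambda>ys. \<Phi> (ys ! 0))"
    and inv: "K_eq R [M] M (\<lambda>xs. \<Phi> (fst (xs ! 0), \<Psi> (xs ! 0))) (\<lambda>xs. snd (xs ! 0))"
    using iso by (auto simp: K_iso_def)
  have c: "cycle N a (\<Psi> (a, z))" "cycle M a (\<Phi> (a, \<Psi> (a, z)))" "homologous M a (\<Phi> (a, \<Psi> (a, z))) z"
    if z: "cycle M a z" for z
  proof -
    show "cycle N a (\<Psi> (a, z))" using K_mor1_cycle[OF M N \<Psi> z] by simp
    then show "cycle M a (\<Phi> (a, \<Psi> (a, z)))" using K_mor1_cycle[OF N M \<Phi>] by simp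
    show "homologous M a (\<Phi> (a, \<Psi> (a, z))) z" using K_eq_cycles[OF M _ inv, of "[(a, z)]"] z M by simp
  qed
  have mem: "z \<in> elts L a" if "cycle L a z" for L z using that by (simp add: cycle_def)
  have "homologous M a (\<Phi> (a, \<Psi> (a, x))) (\<Phi> (a, \<Psi> (a, y)))"
    using K_mor1_homologous[OF N M \<Phi> mem[OF c(1)[OF x]] mem[OF c(1)[OF y]] xy] by simp
  then have "homologous M a (\<Phi> (a, \<Psi> (a, x))) y"
    by (rule homologous_trans[OF M mem[OF c(2)[OF x]] mem[OF c(2)[OF y]] mem[OF y] _ c(3)[OF y]])
  then show ?thesis
    by (rule homologous_trans[OF M mem[OF x] mem[OF c(2)[OF x]] mem[OF y]
          homologous_sym[OF M mem[OF c(2)[OF x]] mem[OF x] c(3)[OF x]]])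
qed

text \<open>The equation is multiplied by the sign \<open>i * n\<close>. Modulo two,
  \<open>i * n = i + i * (n + 1)\<close> and \<open>n + i * n = (i + 1) * n\<close>. This
  distributes the sign so that every homotopy term carries the product of the degrees of its own two
  arguments, as in \<open>psi_natural_left\<close>.\<close>

lemma (in kmod) left_square_identity:
  assumes "u \<in> carrier M" "v \<in> carrier M" "a \<in> carrier M" "b \<in> carrier M" "c \<in> carrier M"
    and eq: "sgm M (i * n) u \<ominus>\<^bsub>M\<^esub> sgm M (i * n) v = a \<oplus>\<^bsub>M\<^esub> (sgm M n b \<oplus>\<^bsub>M\<^esub> c)"
  shows "u \<ominus>\<^bsub>M\<^esub> v = sgm M (i * n) a \<oplus>\<^bsub>M\<^esub> (sgm M i (sgm M (i * (n + 1)) c) \<oplus>\<^bsub>M\<^esub> sgm M ((i + 1) * n) b)"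
proof -
  have "u \<ominus>\<^bsub>M\<^esub> v = sgm M (i * n) (sgm M (i * n) u \<ominus>\<^bsub>M\<^esub> sgm M (i * n) v)"
    using assms(1,2) by (cases "even (i * n)"; simp only: sgm_def if_True if_False; algebra)
  also have "\<dots> = sgm M (i * n) a \<oplus>\<^bsub>M\<^esub> (sgm M i (sgm M (i * (n + 1)) c) \<oplus>\<^bsub>M\<^esub> sgm M ((i + 1) * n) b)"
    unfolding eq using assms(3-5) by (cases "even i"; cases "even n"; simp add: sgm_def del: minus_add; algebra?)
  finally show ?thesis .
qed

text \<open>Passing to the negatives of the relabelled \<open>h\<close> and \<open>h'\<close>
  absorbs the minus signs of \<open>eq\<close> and changes the sign \<open>n - 1\<close> to
  \<open>n\<close>, which gives the form required of a homotopy in two variables.\<close>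

lemma relabelled_square:
  fixes M :: "('k, 'm) cpx" and N :: "('k, 'n) cpx" and \<delta> :: "'m \<Rightarrow> 'v" and \<epsilon> :: "'n \<Rightarrow> 'v"
  assumes M: "is_complex R M" and N: "is_complex R N" and \<delta>: "inj \<delta>" and \<epsilon>: "inj \<epsilon>"
  defines "M' \<equiv> relabel_cpx \<delta> M" and "N' \<equiv> relabel_cpx \<epsilon> N" and "e \<equiv> inv_into UNIV \<epsilon>"
  assumes h: "h \<in> elts (inner_hom R M' N') (n - 1)" and h': "h' \<in> elts (inner_hom R M' N') n"
    and p: "p \<in> elts M i" and u: "u \<in> elts N' (i + n)" and v: "v \<in> elts N' (i + n)"
    and eq: "u \<ominus>\<^bsub>gr N' (i + n)\<^esub> v = \<ominus>\<^bsub>gr N' (i + n)\<^esub> dif N' (i + (n - 1)) (h i (\<delta> p)) \<oplus>\<^bsub>gr N' (i + n)\<^esub>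
      (sgm (gr N' (i + n)) (n - 1) (h (i + 1) (dif M' i (\<delta> p))) \<oplus>\<^bsub>gr N' (i + n)\<^esub> \<ominus>\<^bsub>gr N' (i + n)\<^esub> h' i (\<delta> p))"
  shows "e u \<ominus>\<^bsub>gr N (i + n)\<^esub> e v = dif N (i + n - 1) (\<ominus>\<^bsub>gr N (i + n - 1)\<^esub> e (h i (\<delta> p))) \<oplus>\<^bsub>gr N (i + n)\<^esub>
      (sgm (gr N (i + n)) n (\<ominus>\<^bsub>gr N (i + n)\<^esub> e (h (i + 1) (\<delta> (dif M i p)))) \<oplus>\<^bsub>gr N (i + n)\<^esub>
       \<ominus>\<^bsub>gr N (i + n)\<^esub> e (h' i (\<delta> p)))"
proof -
  have M': "is_complex R M'" and N': "is_complex R N'"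
    using is_complex_relabel[OF M \<delta>] is_complex_relabel[OF N \<epsilon>] by (auto simp: M'_def N'_def)
  note m = is_complexD(1)[OF N'] is_complexD(1)[OF N]
  have l: "lin (gr N' t) (gr N t) e" for t
    unfolding N'_def e_def by (rule relabel_linear(2)[OF \<epsilon>])
  have dp: "\<delta> p \<in> elts M' i" "dif M' i (\<delta> p) = \<delta> (dif M i p)"
    using p relabel_linear(3,4)[OF \<delta>] by (auto simp: M'_def)
  have hp: "h i (\<delta> p) \<in> elts N' (i + n - 1)" using inner_homD(2)[OF h dp(1)] by (simp add: algebra_simps)
  have hdp: "h (i + 1) (\<delta> (dif M i p)) \<in> elts N' (i + n)"
    using inner_homD(2)[OF h is_complexD(4)[OF M' dp(1)]] dp(2) by (simp add: algebra_simps)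
  have hp': "h' i (\<delta> p) \<in> elts N' (i + n)" using inner_homD(2)[OF h' dp(1)] .
  have d: "i + (n - 1) = i + n - 1" by simp
  have dh: "dif N' (i + n - 1) (h i (\<delta> p)) \<in> elts N' (i + n)" using is_complexD(5)[OF N' hp] .
  have edh: "e (dif N' (i + n - 1) (h i (\<delta> p))) = dif N (i + n - 1) (e (h i (\<delta> p)))"
    unfolding e_def N'_def by (rule relabel_linear(5)[OF \<epsilon>]) (use hp in \<open>simp add: N'_def\<close>)
  have "e u \<ominus>\<^bsub>gr N (i + n)\<^esub> e v = \<ominus>\<^bsub>gr N (i + n)\<^esub> dif N (i + n - 1) (e (h i (\<delta> p))) \<oplus>\<^bsub>gr N (i + n)\<^esub>
      (sgm (gr N (i + n)) (n - 1) (e (h (i + 1) (\<delta> (dif M i p)))) \<oplus>\<^bsub>gr N (i + n)\<^esub> \<ominus>\<^bsub>gr N (i + n)\<^esub> e (h' i (\<delta> p)))"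
    using arg_cong[OF eq, of e] hp hdp hp' dh u v m
    by (simp add: linear_map_more[OF l m] linear_mapD(2)[OF l] dp(2) d edh)
  moreover have "\<ominus>\<^bsub>gr N (i + n)\<^esub> dif N (i + n - 1) (e (h i (\<delta> p))) = dif N (i + n - 1) (\<ominus>\<^bsub>gr N (i + n - 1)\<^esub> e (h i (\<delta> p)))"
    using linear_map_more(2)[OF is_complexD(6)[OF N] m(2) m(2) linear_mapD(1)[OF l hp]] by simp
  moreover have "sgm (gr N (i + n)) (n - 1) (e (h (i + 1) (\<delta> (dif M i p)))) =
      sgm (gr N (i + n)) n (\<ominus>\<^bsub>gr N (i + n)\<^esub> e (h (i + 1) (\<delta> (dif M i p))))"
    using linear_mapD(1)[OF l hdp] m by (simp add: sgm_def)
  ultimately show ?thesis by simp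
qed

end

section \<open>The duality isomorphism and its naturality\<close>

context right_serre
begin

abbreviation homS :: "'o \<Rightarrow> 'o \<Rightarrow> ('k, 'h) cpx" where
  "homS X Y \<equiv> mor_cpx A X (S.fo Y)"

abbreviation dhom :: "'o \<Rightarrow> 'o \<Rightarrow> ('k, int \<Rightarrow> 'h \<Rightarrow> 'k) cpx" where
  "dhom X Y \<equiv> dual R (mor_cpx A X Y)"

text \<open>Given by \<open>inv_into\<close> because this is how \<open>relabel_cpx\<close> inverts
  its injection and how \<open>K_iso_relabel\<close> describes the transported map.\<close>

definition unInr :: "'h + (int \<Rightarrow> 'h \<Rightarrow> 'k) \<Rightarrow> int \<Rightarrow> 'h \<Rightarrow> 'k" where
  "unInr = inv_into UNIV Inr"

lemma unInr_Inr [simp]: "unInr (Inr \<phi>) = \<phi>"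
  by (simp add: unInr_def)

definition psi :: "'o \<Rightarrow> 'o \<Rightarrow> 'h hel \<Rightarrow> int \<Rightarrow> 'h \<Rightarrow> 'k" where
  "psi X Y x = unInr (r [(X, []), (Y, [])] (fst x) (Inl (snd x)))"

lemma is_complex_dhom [simp, intro]: "X \<in> obj A \<Longrightarrow> Y \<in> obj A \<Longrightarrow> is_complex R (dhom X Y)"
  by (simp add: is_complex_dual)

lemma K_iso_psi:
  assumes [simp]: "X \<in> obj A" "Y \<in> obj A"
  shows "K_iso R (homS X Y) (dhom Y X) (psi X Y)"
  using K_iso_relabel[OF _ _ inj_Inl inj_Inr, of "homS X Y" "dhom Y X" "r [(X, []), (Y, [])]"]
    invertible[of X Y]
  by (simp add: fob_F fob_G psi_def[abs_def] unInr_def)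

lemma psi_linear:
  assumes [simp]: "X \<in> obj A" "Y \<in> obj A"
  shows "lin (mor A X (S.fo Y) i) (gr (dhom Y X) i) (\<lambda>p. psi X Y (i, p))"
proof -
  have "K_mor R [homS X Y] (dhom Y X) (\<lambda>xs. psi X Y (xs ! 0))"
    using K_iso_psi[OF assms] unfolding K_iso_def by blast
  then show ?thesis by (simp add: K_mor1_iff)
qed

text \<open>\<open>unInr\<close> inverts \<open>Inr\<close> only on its range. That the values of
  \<open>r\<close> lie there is the second claim, from which the first follows.\<close>

lemma r_psi:
  assumes [simp]: "X \<in> obj A" "Y \<in> obj A" and p: "p \<in> el X (S.fo Y) i"
  shows "r [(X, []), (Y, [])] i (Inl p) = Inr (psi X Y (i, p))"
    and "r [(X, []), (Y, [])] i (Inl p) \<in> elts (relabel_cpx Inr (dhom Y X)) i"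
proof -
  have "r [(X, []), (Y, [])] \<in> elts (inner_hom R (fob F [X, Y]) (fob G [X, Y])) 0"
    using invertible[of X Y] by (simp add: K_invertible_def kcat_def mor_cpx_Cdg cycle_def)
  then have "r [(X, []), (Y, [])] i (Inl p) \<in> elts (fob G [X, Y]) (i + 0)"
    by (rule inner_homD(2)) (use p in \<open>simp add: fob_F relabel_linear(4)[OF inj_Inl]\<close>)
  then show mem: "r [(X, []), (Y, [])] i (Inl p) \<in> elts (relabel_cpx Inr (dhom Y X)) i"
    by (simp add: fob_G)
  then show "r [(X, []), (Y, [])] i (Inl p) = Inr (psi X Y (i, p))"
    by (auto simp: relabel_linear(4)[OF inj_Inr] psi_def)
qed

lemma components_r: "components R [ainf_op A, A] (Cdg R) (fob F) (fob G) (-1) r"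
  using natural by (simp add: natural_transformation_def)

lemma op_simps [simp]: "obj (ainf_op A) = obj A" "mor (ainf_op A) X Y = mor A Y X"
  by (simp_all add: ainf_op_def)

lemma r_linear_right:
  assumes [simp]: "X \<in> obj A" "Y \<in> obj A" "Z \<in> obj A"
  shows "lin (mor A Y Z n) (gr (inner_hom R (relabel_cpx Inl (homS X Y)) (relabel_cpx Inr (dhom Z X))) (n - 1))
    (\<lambda>z. r [(X, []), (Y, [(Z, n - 1, z)])])"
  using components_linear[OF components_r, of "[(X, []), (Y, [(Z, n - 1, \<zero>\<^bsub>mor A Y Z n\<^esub>)])]" 1 Y "[]" Z "n - 1" _ "[]" "n - 1"]
  by (simp add: is_tuple_def Cdg_simps fob_F fob_G)

lemma r_linear_left:
  assumes [simp]: "X \<in> obj A" "X' \<in> obj A" "Y \<in> obj A"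
  shows "lin (mor A X' X n) (gr (inner_hom R (relabel_cpx Inl (homS X Y)) (relabel_cpx Inr (dhom Y X'))) (n - 1))
    (\<lambda>x. r [(X, [(X', n - 1, x)]), (Y, [])])"
  using components_linear[OF components_r, of "[(X, [(X', n - 1, \<zero>\<^bsub>mor A X' X n\<^esub>)]), (Y, [])]" 0 X "[]" X' "n - 1" _ "[]" "n - 1"]
  by (simp add: is_tuple_def Cdg_simps fob_F fob_G)

lemma inner_hom_eval_linear:
  assumes "lin M (gr (inner_hom R P Q) n) f" and "y \<in> elts P i"
  shows "lin M (gr Q (i + n)) (\<lambda>x. f x i y)"
  using linear_mapD(2,3)[OF assms(1)] assms(2) inner_homD(2)[OF linear_mapD(1)[OF assms(1)] assms(2)]
  by (intro linear_mapI) (auto simp: gr_inner_hom_simps(3,4))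

lemma unInr_linear: "lin (gr (relabel_cpx Inr N) n) (gr N n) unInr"
  unfolding unInr_def by (rule relabel_linear(2)[OF inj_Inr])

text \<open>This serves both naturality homotopies: \<open>f\<close> stands for the component of
  \<open>r\<close> with one letter in the first or in the second variable.\<close>

lemma r_linear_homotopy:
  fixes P :: "('k, 'h) cpx" and Q :: "('k, int \<Rightarrow> 'h \<Rightarrow> 'k) cpx"
  assumes P: "is_complex R P" and Q: "is_complex R Q"
    and f: "lin L (gr (inner_hom R (relabel_cpx Inl P) (relabel_cpx Inr Q)) (n - 1)) f"
  shows "x \<in> carrier L \<Longrightarrow> lin (gr P i) (gr Q (i + n - 1)) (\<lambda>p. \<ominus>\<^bsub>gr Q (i + n - 1)\<^esub> unInr (f x i (Inl p)))"
    and "p \<in> elts P i \<Longrightarrow>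
      lin L (gr Q (i + n - 1)) (\<lambda>x. \<ominus>\<^bsub>gr Q (i + n - 1)\<^esub> unInr (f x i (Inl p)))"
proof -
  have d: "i + (n - 1) = i + n - 1" by simp
  note m = is_complexD(1)[OF Q]
  show "lin (gr P i) (gr Q (i + n - 1)) (\<lambda>p. \<ominus>\<^bsub>gr Q (i + n - 1)\<^esub> unInr (f x i (Inl p)))"
    if "x \<in> carrier L"
  proof -
    note l = inner_homD(1)[OF linear_mapD(1)[OF f that], of i, unfolded d]
    show ?thesis
      by (rule linear_map_uminus[OF linear_map_compose[OF linear_map_compose[OF relabel_linear(1)[OF inj_Inl] l] unInr_linear] m])
  qed
  show "lin L (gr Q (i + n - 1)) (\<lambda>x. \<ominus>\<^bsub>gr Q (i + n - 1)\<^esub> unInr (f x i (Inl p)))"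
    if "p \<in> elts P i"
  proof -
    have "Inl p \<in> elts (relabel_cpx Inl P) i" using that by (simp add: relabel_linear(4)[OF inj_Inl])
    note l = inner_hom_eval_linear[OF f this, unfolded d]
    show ?thesis
      by (rule linear_map_uminus[OF linear_map_compose[OF l unInr_linear] m])
  qed
qed

lemma psi_natural_right:
  assumes [simp]: "X \<in> obj A" "Y \<in> obj A" "Z \<in> obj A"
  shows "K_eq R [homS X Y, mor_cpx A Y Z] (dhom Z X)
    (\<lambda>xs. psi X Z (fst (xs ! 0) + fst (xs ! 1), m2 A X (S.fo Y) (S.fo Z) (xs ! 0) (fst (xs ! 1), Kmap (kfun S) Y Z (xs ! 1))))
    (\<lambda>xs. dual_act_Y R (kcat R A) X Y Z (fst (xs ! 0), psi X Y (xs ! 0)) (xs ! 1))"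
proof -
  let ?D = "gr (dhom Z X)"
  let ?M = "mor A X (S.fo Y)"
  let ?r = "\<lambda>n z. r [(X, []), (Y, [(Z, n - 1, z)])]"
  \<comment> \<open>The minus sign is that of \<open>relabelled_square\<close>. No further sign is
    needed: \<open>z\<close> acts on \<open>p\<close> from the right without a sign, and the sign on
    the dual side is part of \<open>dual_act_Y\<close>.\<close>
  let ?H = "\<lambda>i p n z. \<ominus>\<^bsub>?D (i + n - 1)\<^esub> unInr (?r n z i (Inl p))"
  let ?F0 = "relabel_cpx Inl (homS X Y) :: ('k, 'h + (int \<Rightarrow> 'h \<Rightarrow> 'k)) cpx"
  let ?G1 = "relabel_cpx Inr (dhom Z X) :: ('k, 'h + (int \<Rightarrow> 'h \<Rightarrow> 'k)) cpx"
  have mD: "module R (?D t)" for t by (rule is_complexD(1)) simp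
  have Inl: "Inl p \<in> elts ?F0 i" if "p \<in> carrier (?M i)" for p i
    using that by (simp add: relabel_linear(4)[OF inj_Inl])
  have rc: "?r n z \<in> elts (inner_hom R ?F0 ?G1) (n - 1)" if "z \<in> el Y Z n" for z n
    using linear_mapD(1)[OF r_linear_right[of X Y Z n] that] by simp
  note lin = r_linear_homotopy[OF _ _ r_linear_right[OF assms]]
  have main: "psi X Z (i + n, m2 A X (S.fo Y) (S.fo Z) (i, p) (n, S.f1 Y Z n z)) \<ominus>\<^bsub>?D (i + n)\<^esub>
      dual_act_Y R (kcat R A) X Y Z (i, psi X Y (i, p)) (n, z) =
    dif (dhom Z X) (i + n - 1) (?H i p n z) \<oplus>\<^bsub>?D (i + n)\<^esub>
    (sgm (?D (i + n)) n (?H (i + 1) (b1 X (S.fo Y) i p) n z) \<oplus>\<^bsub>?D (i + n)\<^esub> ?H i p (n + 1) (b1 Y Z n z))"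
    if p: "p \<in> carrier (?M i)" and z: "z \<in> el Y Z n" for i p n z
  proof -
    have tb: "tbhat R [ainf_op A, A] [(X, []), (Y, [(Z, n - 1, z)])] = [(\<one>\<^bsub>R\<^esub>, [(X, []), (Y, [(Z, n, b1 Y Z n z)])])]"
      using bhat_b(1)[of Y Z "n - 1" z] by (simp add: tbhat_simps bhat_simps)
    have ws: "is_tuple [ainf_op A, A] [(X, []), (Y, [(Z, n - 1, z)])]" using z by (simp add: is_tuple_def)
    have m: "m2 A X (S.fo Y) (S.fo Z) (i, p) (n, S.f1 Y Z n z) \<in> el X (S.fo Z) (i + n)"
      using z p by (intro m2_linear) auto
    have pp: "psi X Y (i, p) \<in> elts (dhom Y X) i" using linear_mapD(1)[OF psi_linear p] by simp
    note sq = Cdg_natural_square[OF natural ws rhat_simps(3) tb rhat_simps(3) sg_closed one_closed,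
        unfolded map_append fob_F fob_G, OF rc[OF z] Inl[OF p]]
    have sq': "Inr (psi X Z (i + n, m2 A X (S.fo Y) (S.fo Z) (i, p) (n, S.f1 Y Z n z))) \<ominus>\<^bsub>gr ?G1 (i + n)\<^esub>
        Inr (dual_act_Y R (kcat R A) X Y Z (i, psi X Y (i, p)) (n, z)) =
      \<ominus>\<^bsub>gr ?G1 (i + n)\<^esub> dif ?G1 (i + (n - 1)) (?r n z i (Inl p)) \<oplus>\<^bsub>gr ?G1 (i + n)\<^esub>
      (sgm (gr ?G1 (i + n)) (n - 1) (?r n z (i + 1) (dif ?F0 i (Inl p))) \<oplus>\<^bsub>gr ?G1 (i + n)\<^esub>
       \<ominus>\<^bsub>gr ?G1 (i + n)\<^esub> ?r (n + 1) (b1 Y Z n z) i (Inl p))"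
      using sq by (simp add: F_right z p r_psi G_right pp m)
    have rc': "?r (n + 1) (b1 Y Z n z) \<in> elts (inner_hom R ?F0 ?G1) n"
      using rc[of "b1 Y Z n z" "n + 1"] z by simp
    have "unInr (Inr (psi X Z (i + n, m2 A X (S.fo Y) (S.fo Z) (i, p) (n, S.f1 Y Z n z)))) \<ominus>\<^bsub>?D (i + n)\<^esub>
       unInr (Inr (dual_act_Y R (kcat R A) X Y Z (i, psi X Y (i, p)) (n, z))) =
      dif (dhom Z X) (i + n - 1) (?H i p n z) \<oplus>\<^bsub>?D (i + n)\<^esub>
      (sgm (?D (i + n)) n (\<ominus>\<^bsub>?D (i + n)\<^esub> unInr (?r n z (i + 1) (Inl (dif (homS X Y) i p))))
       \<oplus>\<^bsub>?D (i + n)\<^esub> \<ominus>\<^bsub>?D (i + n)\<^esub> unInr (?r (n + 1) (b1 Y Z n z) i (Inl p)))"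
      unfolding unInr_def
      by (rule relabelled_square[OF _ _ inj_Inl inj_Inr rc[OF z] rc' _ _ _ sq'])
        (use p linear_mapD(1)[OF psi_linear m] G_right(2)[OF assms z pp] in
          \<open>simp_all add: relabel_linear(4)[OF inj_Inr]\<close>)
    moreover have "i + 1 + n - 1 = i + n" "i + (n + 1) - 1 = i + n" by auto
    ultimately show ?thesis by (simp add: dif_mor_cpx)
  qed
  show ?thesis
    by (rule iffD2[OF K_eq2_iff exI[of _ ?H]]) (use lin main in \<open>simp_all add: dif_mor_cpx\<close>)
qed

lemma psi_natural_left:
  assumes [simp]: "X' \<in> obj A" "X \<in> obj A" "Y \<in> obj A"
  shows "K_eq R [mor_cpx A X' X, homS X Y] (dhom Y X')
    (\<lambda>xs. psi X' Y (fst (xs ! 0) + fst (xs ! 1), m2 A X' X (S.fo Y) (xs ! 0) (xs ! 1)))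
    (\<lambda>xs. dual_act_X (kcat R A) Y X' X (xs ! 0) (fst (xs ! 1), psi X Y (xs ! 1)))"
proof -
  let ?D = "gr (dhom Y X')"
  let ?M = "mor A X (S.fo Y)"
  let ?r = "\<lambda>n x. r [(X, [(X', n - 1, x)]), (Y, [])]"
  let ?h = "\<lambda>n x i p. \<ominus>\<^bsub>?D (n + i - 1)\<^esub> unInr (?r n x i (Inl p))"
  let ?H = "\<lambda>n x i p. sgm (?D (n + i - 1)) (i * n) (?h n x i p)"
  \<comment> \<open>The sign occurs because \<open>(1,S) \<cdot> Hom\<close> lets \<open>x\<close> act by \<open>p \<mapsto> \<plusminus> x p\<close>.\<close>
  let ?F0 = "relabel_cpx Inl (homS X Y) :: ('k, 'h + (int \<Rightarrow> 'h \<Rightarrow> 'k)) cpx"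
  let ?G1 = "relabel_cpx Inr (dhom Y X') :: ('k, 'h + (int \<Rightarrow> 'h \<Rightarrow> 'k)) cpx"
  have mD: "module R (?D t)" for t by (rule is_complexD(1)) simp
  have Inl: "Inl p \<in> elts ?F0 i" if "p \<in> carrier (?M i)" for p i
    using that by (simp add: relabel_linear(4)[OF inj_Inl])
  have rc: "?r n x \<in> elts (inner_hom R ?F0 ?G1) (n - 1)" if "x \<in> el X' X n" for x n
    using linear_mapD(1)[OF r_linear_left[of X X' Y n] that] by simp
  note lin = r_linear_homotopy[OF _ _ r_linear_left[OF assms(2,1,3)]]
  have lin2: "lin (?M i) (?D (n + i - 1)) (\<lambda>p. ?h n x i p)" if "x \<in> el X' X n" for i n x
    using lin(1)[of x n i] that by (simp add: add.commute)
  have lin1: "lin (mor A X' X n) (?D (n + i - 1)) (\<lambda>x. ?h n x i p)" if "p \<in> carrier (?M i)" for i n p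
    using lin(2)[of p i n] that by (simp add: add.commute)
  have main: "psi X' Y (n + i, m2 A X' X (S.fo Y) (n, x) (i, p)) \<ominus>\<^bsub>?D (n + i)\<^esub>
      dual_act_X (kcat R A) Y X' X (n, x) (i, psi X Y (i, p)) =
    dif (dhom Y X') (n + i - 1) (?H n x i p) \<oplus>\<^bsub>?D (n + i)\<^esub>
    (sgm (?D (n + i)) i (?H (n + 1) (b1 X' X n x) i p) \<oplus>\<^bsub>?D (n + i)\<^esub>
     ?H n x (i + 1) (b1 X (S.fo Y) i p))"
    if x: "x \<in> el X' X n" and p: "p \<in> carrier (?M i)" for i p n x
  proof -
    let ?P = "?D (n + i)"
    interpret P: kmod R ?P by (rule kmod[OF mD])
    have ni: "i + n = n + i" by simp
    \<comment> \<open>On tensors of length one the two signs of \<open>\<gamma>\<close> cancel, so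
      the opposite category has the same \<open>b_1\<close>.\<close>
    have tb: "tbhat R [ainf_op A, A] [(X, [(X', n - 1, x)]), (Y, [])] = [(\<one>\<^bsub>R\<^esub>, [(X, [(X', n, b1 X' X n x)]), (Y, [])])]"
      by (simp add: tbhat_simps bhat_simps ainf_op_def rev_path_def gamma_exp_def b1_def sgm_even)
    have ws: "is_tuple [ainf_op A, A] [(X, [(X', n - 1, x)]), (Y, [])]" using x by (simp add: is_tuple_def)
    define q a where "q = m2 A X' X (S.fo Y) (n, x) (i, p)"
      and "a = dual_act_X (kcat R A) Y X' X (n, x) (i, psi X Y (i, p))"
    have q: "q \<in> el X' (S.fo Y) (i + n)"
      unfolding q_def using x p by (intro m2_linear) auto
    have pp: "psi X Y (i, p) \<in> elts (dhom Y X) i" using linear_mapD(1)[OF psi_linear p] by simp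
    have a: "a \<in> carrier (?D (i + n))"
      unfolding a_def using G_left(2)[OF assms(2,1,3) x pp] .
    have pq: "psi X' Y (i + n, q) \<in> carrier (?D (i + n))"
      using linear_mapD(1)[OF psi_linear q] by simp
    have psg: "psi X' Y (i + n, sgm (mor A X' (S.fo Y) (i + n)) (i * n) q) =
        sgm (?D (i + n)) (i * n) (psi X' Y (i + n, q))"
      using linear_map_more(4)[OF psi_linear _ mD q] by simp
    note sq = Cdg_natural_square[OF natural ws rhat_simps(2) tb rhat_simps(2) sg_closed one_closed,
        unfolded map_append fob_F fob_G, OF rc[OF x] Inl[OF p]]
    have sq': "Inr (sgm (?D (i + n)) (i * n) (psi X' Y (i + n, q))) \<ominus>\<^bsub>gr ?G1 (i + n)\<^esub>
        Inr (sgm (?D (i + n)) (i * n) a) =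
      \<ominus>\<^bsub>gr ?G1 (i + n)\<^esub> dif ?G1 (i + (n - 1)) (?r n x i (Inl p)) \<oplus>\<^bsub>gr ?G1 (i + n)\<^esub>
      (sgm (gr ?G1 (i + n)) (n - 1) (?r n x (i + 1) (dif ?F0 i (Inl p))) \<oplus>\<^bsub>gr ?G1 (i + n)\<^esub>
       \<ominus>\<^bsub>gr ?G1 (i + n)\<^esub> ?r (n + 1) (b1 X' X n x) i (Inl p))"
      using sq q by (simp add: F_left x p r_psi G_left pp psg flip: q_def a_def)
    have rc': "?r (n + 1) (b1 X' X n x) \<in> elts (inner_hom R ?F0 ?G1) n"
      using rc[of "b1 X' X n x" "n + 1"] x by simp
    define u v w where "u = ?h n x i p" and "v = \<ominus>\<^bsub>?P\<^esub> unInr (?r n x (i + 1) (Inl (b1 X (S.fo Y) i p)))"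
      and "w = \<ominus>\<^bsub>?P\<^esub> unInr (?r (n + 1) (b1 X' X n x) i (Inl p))"
    have d: "n + (i + 1) - 1 = n + i" "n + 1 + i - 1 = n + i" by auto
    have uc: "u \<in> carrier (?D (n + i - 1))"
      unfolding u_def using linear_mapD(1)[OF lin2[OF x] p] .
    have vc: "v \<in> carrier ?P"
      using linear_mapD(1)[OF lin2[OF x], of "b1 X (S.fo Y) i p" "i + 1"] p by (simp only: d v_def) auto
    have wc: "w \<in> carrier ?P"
      using linear_mapD(1)[OF lin2[of "b1 X' X n x" "n + 1" i] p] x by (simp only: d w_def) auto
    have "unInr (Inr (sgm (?D (i + n)) (i * n) (psi X' Y (i + n, q)))) \<ominus>\<^bsub>?D (i + n)\<^esub>
       unInr (Inr (sgm (?D (i + n)) (i * n) a)) =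
      dif (dhom Y X') (i + n - 1) (\<ominus>\<^bsub>?D (i + n - 1)\<^esub> unInr (?r n x i (Inl p))) \<oplus>\<^bsub>?D (i + n)\<^esub>
      (sgm (?D (i + n)) n (\<ominus>\<^bsub>?D (i + n)\<^esub> unInr (?r n x (i + 1) (Inl (dif (homS X Y) i p))))
       \<oplus>\<^bsub>?D (i + n)\<^esub> \<ominus>\<^bsub>?D (i + n)\<^esub> unInr (?r (n + 1) (b1 X' X n x) i (Inl p)))"
      unfolding unInr_def
      by (rule relabelled_square[OF _ _ inj_Inl inj_Inr rc[OF x] rc' _ _ _ sq'])
        (use p pq a mD in \<open>simp_all add: relabel_linear(4)[OF inj_Inr]\<close>)
    then have "sgm ?P (i * n) (psi X' Y (n + i, q)) \<ominus>\<^bsub>?P\<^esub> sgm ?P (i * n) a =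
        dif (dhom Y X') (n + i - 1) u \<oplus>\<^bsub>?P\<^esub> (sgm ?P n v \<oplus>\<^bsub>?P\<^esub> w)"
      by (simp only: ni unInr_Inr dif_mor_cpx u_def v_def w_def)
    then have "psi X' Y (n + i, q) \<ominus>\<^bsub>?P\<^esub> a = sgm ?P (i * n) (dif (dhom Y X') (n + i - 1) u) \<oplus>\<^bsub>?P\<^esub>
        (sgm ?P i (sgm ?P (i * (n + 1)) w) \<oplus>\<^bsub>?P\<^esub> sgm ?P ((i + 1) * n) v)"
      by (rule P.left_square_identity[rotated -1])
        (use pq a vc wc is_complexD(5)[OF is_complex_dhom uc] in \<open>simp_all add: ni\<close>)
    moreover have "sgm ?P (i * n) (dif (dhom Y X') (n + i - 1) u) =
        dif (dhom Y X') (n + i - 1) (sgm (?D (n + i - 1)) (i * n) u)"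
      using linear_map_more(4)[OF is_complexD(6)[OF is_complex_dhom] mD mD uc] by simp
    ultimately show ?thesis
      by (simp only: q_def a_def u_def v_def w_def d)
  qed
  show ?thesis
    by (rule iffD2[OF K_eq2_iff exI[of _ ?H]])
      (use linear_map_sgm[OF lin1 mD] linear_map_sgm[OF lin2 mD] main in \<open>simp_all add: dif_mor_cpx\<close>)
qed

text \<open>The left unit law of the category gives a homotopy \<open>H\<close> from multiplication
  by the unit to the identity. Followed by the cycle \<open>\<phi>\<close>, it becomes an element of
  the dual whose boundary is the required difference.\<close>

lemma dual_act_unit:
  assumes [simp]: "X \<in> obj A" "Y \<in> obj A" and \<phi>: "cycle (dhom Y X) 0 \<phi>"
  shows "homologous (dhom Y X) 0 (dual_act_Y R (kcat R A) X Y Y (0, \<phi>) (0, uni Y)) \<phi>"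
proof -
  let ?M = "mor A Y X"
  let ?D = "gr (dhom Y X)"
  let ?U = "unit_cpx R" and ?C = "mor_cpx A Y X"
  note cU = is_complex_unit_cpx
  note mU = is_complexD(1)[OF cU]
  have \<phi>': "\<phi> \<in> carrier (?D 0)" using \<phi> by (simp add: cycle_def)
  have l\<phi>: "lin (?M i) (gr ?U i) (\<phi> i)" for i
    using inner_homD(1)[OF \<phi>', of i] by simp
  \<comment> \<open>A cycle of degree zero in the dual is a chain map into a complex with zero
    differential, so it vanishes on boundaries. This removes the term in which the differential
    follows \<open>H\<close>.\<close>
  have \<phi>d: "\<phi> (i + 1) (b1 Y X i p) = \<zero>\<^bsub>R\<^esub>" if "p \<in> carrier (?M i)" for i p
    using cycle_inner_hom_dif[OF _ cU \<phi>, of p i] that by (simp add: dif_mor_cpx unit_cpx_simps)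
  from K_eq_uni(1)[OF assms(2,1)]
  obtain H where H: "\<And>a. lin (?M a) (?M (a - 1)) (H a)"
    "\<And>a p. p \<in> carrier (?M a) \<Longrightarrow> m2 A Y Y X (0, uni Y) (a, p) \<ominus>\<^bsub>?M a\<^esub> p =
         b1 Y X (a - 1) (H a p) \<oplus>\<^bsub>?M a\<^esub> H (a + 1) (b1 Y X a p)"
    by (simp add: K_eq1_iff dif_mor_cpx) metis
  \<comment> \<open>The transpose of \<open>H\<close> applied to \<open>\<phi>\<close>. Its degree
    is \<open>-1\<close>, so the sign in the inner hom differential makes the remaining term
    positive.\<close>
  let ?z = "\<lambda>i. \<lambda>p\<in>elts ?C i. \<phi> (i - 1) (H i p)"
  have z: "?z \<in> carrier (?D (-1))"
    by (rule inner_hom_memI) (use linear_map_compose[OF H(1) l\<phi>] in simp_all)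
  let ?act = "dual_act_Y R (kcat R A) X Y Y (0, \<phi>) (0, uni Y)"
  have act: "?act \<in> carrier (?D 0)"
    using G_right(2)[of X Y Y "uni Y" 0 \<phi> 0] \<phi>' by simp
  note C = is_complex_dhom[OF assms(2,1)]
  have "?act \<ominus>\<^bsub>?D 0\<^esub> \<phi> = dif (dhom Y X) (-1) ?z"
  proof (rule inner_hom_eqI[where n = 0])
    show "?act \<ominus>\<^bsub>?D 0\<^esub> \<phi> \<in> carrier (?D 0)"
      using act \<phi>' is_complexD(1)[OF C] by simp
    show "dif (dhom Y X) (-1) ?z \<in> carrier (?D 0)"
      using is_complexD(4)[OF C z] by simp
    fix i p assume "p \<in> elts ?C i"
    then have p: "p \<in> carrier (?M i)" by simp
    interpret kmod R "gr ?U i" by (rule kmod[OF mU])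
    have m: "m2 A Y Y X (0, uni Y) (i, p) \<in> carrier (?M i)" using p by (intro m2_linear) auto
    have Hp: "H i p \<in> carrier (?M (i - 1))" using linear_mapD(1)[OF H(1) p] .
    have Hdp: "H (i + 1) (b1 Y X i p) \<in> carrier (?M i)"
      using linear_mapD(1)[OF H(1)[of "i + 1"], of "b1 Y X i p"] p by simp
    have bH: "b1 Y X (i - 1) (H i p) \<in> carrier (?M i)" using Hp by auto
    have c: "\<phi> i p \<in> elts ?U i" "\<phi> i (m2 A Y Y X (0, uni Y) (i, p)) \<in> elts ?U i"
      "\<phi> i (H (i + 1) (b1 Y X i p)) \<in> elts ?U i"
      using linear_mapD(1)[OF l\<phi>] p m Hdp by blast+
    have a: "?act i p = \<phi> i (m2 A Y Y X (0, uni Y) (i, p))"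
      using p module_simps(5)[OF mU c(2)] by (simp add: dual_act_Y_def unit_cpx_simps)
    have "(?act \<ominus>\<^bsub>?D 0\<^esub> \<phi>) i p = \<phi> i (m2 A Y Y X (0, uni Y) (i, p)) \<ominus>\<^bsub>gr ?U i\<^esub> \<phi> i p"
      using inner_hom_pointwise(1)[OF _ mU act _ \<phi>', of p i] p a by simp
    also have "\<dots> = \<phi> i (b1 Y X (i - 1) (H i p) \<oplus>\<^bsub>?M i\<^esub> H (i + 1) (b1 Y X i p))"
      using linear_map_more(3)[OF l\<phi> _ mU m p] H(2)[OF p] by simp
    also have "\<dots> = \<phi> i (H (i + 1) (b1 Y X i p))"
      using linear_mapD(2)[OF l\<phi> bH Hdp] \<phi>d[OF Hp] c mU[of i] by (simp add: unit_cpx_simps(2)[symmetric, of i])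
    also have "\<dots> = dif (dhom Y X) (-1) ?z i p"
      using p c mU[of i] by (simp add: dif_inner_hom dif_mor_cpx unit_cpx_simps(1) sgm_odd a_minus_def
          flip: unit_cpx_simps(2)[of i])
    finally show "(?act \<ominus>\<^bsub>?D 0\<^esub> \<phi>) i p = dif (dhom Y X) (-1) ?z i p" .
  qed
  then show ?thesis
    using z by (auto simp: homologous_def)
qed

text \<open>The choice \<open>X = ?Y\<close> makes the unit of \<open>?Y\<close> an argument of
  \<open>psi\<close>. Naturality expresses the image of its product with \<open>S 1\<close> as an
  action of the unit of \<open>Y\<close>, which is homologically trivial by
  \<open>dual_act_unit\<close>; \<open>psi\<close> then reflects the equality of classes.\<close>

lemma S_unital:
  assumes [simp]: "Y \<in> obj A"
  shows "hml (S.fo Y) (S.fo Y) (Kmap (kfun S) Y Y (0, uni Y)) (uni (S.fo Y))"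
proof -
  let ?Y = "S.fo Y"
  have s: "cyc ?Y ?Y (S.f1 Y Y 0 (uni Y))" and u: "cyc ?Y ?Y (uni ?Y)"
    using S.f1_cycle[of Y Y 0 "uni Y"] by (simp_all add: cycle_uni)
  have p: "cycle (dhom Y ?Y) 0 (psi ?Y Y (0, x))" if "cyc ?Y ?Y x" for x
  proof -
    have "K_mor R [homS ?Y Y] (dhom Y ?Y) (\<lambda>xs. psi ?Y Y (xs ! 0))"
      using K_iso_psi[of ?Y Y] unfolding K_iso_def by simp
    from K_mor1_cycle[OF _ _ this that] show ?thesis by simp
  qed
  have "homologous (dhom Y ?Y) 0 (psi ?Y Y (0, mu ?Y ?Y ?Y (uni ?Y) (S.f1 Y Y 0 (uni Y))))
    (dual_act_Y R (kcat R A) ?Y Y Y (0, psi ?Y Y (0, uni ?Y)) (0, uni Y))"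
    using K_eq_cycles[OF _ _ psi_natural_right[of ?Y Y Y], of "[(0, uni ?Y), (0, uni Y)]"] by (simp add: cycle_uni)
  then have "homologous (dhom Y ?Y) 0 (psi ?Y Y (0, mu ?Y ?Y ?Y (uni ?Y) (S.f1 Y Y 0 (uni Y)))) (psi ?Y Y (0, uni ?Y))"
    by (rule homologous_trans[OF _ _ _ _ _ dual_act_unit, rotated 4])
      (use p u s mu_cyc G_right(2)[of ?Y Y Y "uni Y" 0 "psi ?Y Y (0, uni ?Y)" 0] in \<open>simp_all add: cycle_def\<close>)
  then have "hml ?Y ?Y (mu ?Y ?Y ?Y (uni ?Y) (S.f1 Y Y 0 (uni Y))) (uni ?Y)"
    by (rule K_iso_reflects[OF _ _ K_iso_psi, rotated -1]) (use u s mu_cyc in simp_all)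
  then have "hml ?Y ?Y (S.f1 Y Y 0 (uni Y)) (uni ?Y)"
    by (rule hml_trans[OF _ _ s mu_cyc[OF _ _ _ u s] u hml_sym[OF _ _ mu_cyc[OF _ _ _ u s] s mu_uni(1)[OF _ _ s]], rotated -1]) simp_all
  then show ?thesis by simp
qed

theorem right_Serre_K_functor_kfun: "right_Serre_K_functor R (kcat R A) (kfun S)"
  unfolding right_Serre_K_functor_def
proof (intro conjI exI[of _ psi] ballI)
  show "K_functor R (kcat R A) (kcat R A) (kfun S)"
    using K_functor_kfun[OF S.ainf_functor] S_unital by simp
qed (use K_iso_psi psi_natural_left psi_natural_right in \<open>simp_all del: One_nat_def\<close>)

end

theorem proposition6p2:
  fixes R :: "'k ring"
    and A :: "('k, 'o, 'h) ainf"
    and S :: "('o, 'h, 'o, 'h) afun"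
  assumes "cring R" and "unital R A"
  shows "(right_Serre_ainf_functor R A S \<longrightarrow> right_Serre_K_functor R (kcat R A) (kfun S)) \<and>
         (Serre_ainf_functor R A S \<longrightarrow> Serre_K_functor R (kcat R A) (kfun S))"
proof -
  interpret unital_ainf_cat R A
    by (intro unital_ainf_cat.intro ainf_cat.intro ground.intro ainf_cat_axioms.intro
        unital_ainf_cat_axioms.intro) (use assms in \<open>simp_all add: unital_def\<close>)
  have right: "right_Serre_K_functor R (kcat R A) (kfun S)" if S: "right_Serre_ainf_functor R A S"
  proof -
    \<comment> \<open>The annotations fix the common target type of \<open>Inl\<close> and
      \<open>Inr\<close>, the sum used in \<open>right_Serre_ainf_functor_def\<close>.\<close>
    let ?F = "afun_comp R (Cdg R) (one_S_Hom R A S) (relabel_functor R Inl)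
        :: ('o, 'h, ('k, 'h + (int \<Rightarrow> 'h \<Rightarrow> 'k)) cpx, int \<Rightarrow> 'h + (int \<Rightarrow> 'h \<Rightarrow> 'k) \<Rightarrow> 'h + (int \<Rightarrow> 'h \<Rightarrow> 'k)) afun"
    let ?G = "afun_comp R (Cdg R) (Hom_op_D R A) (relabel_functor R Inr)
        :: ('o, 'h, ('k, 'h + (int \<Rightarrow> 'h \<Rightarrow> 'k)) cpx, int \<Rightarrow> 'h + (int \<Rightarrow> 'h \<Rightarrow> 'k) \<Rightarrow> 'h + (int \<Rightarrow> 'h \<Rightarrow> 'k)) afun"
    have f: "ainf_functor R [A] A S" and iso: "isomorphic R [ainf_op A, A] (Cdg R) ?F ?G"
      using S by (simp_all add: right_Serre_ainf_functor_def)
    from iso[unfolded isomorphic_def]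
    obtain r where nat: "natural_transformation R [ainf_op A, A] (Cdg R) ?F ?G r"
      and inv: "\<forall>Xs. is_objs [ainf_op A, A] Xs \<longrightarrow>
           K_invertible (kcat R (Cdg R)) (fob ?F Xs) (fob ?G Xs) (r (map (\<lambda>X. (X, [])) Xs))"
      by (elim exE conjE)
    interpret right_serre R A S ?F ?G r
    proof unfold_locales
      show "ainf_functor R [A] A S" by fact
      show "natural_transformation R [ainf_op A, A] (Cdg R) ?F ?G r" by fact
      show "K_invertible (kcat R (Cdg R)) (fob ?F [X, Y]) (fob ?G [X, Y]) (r [(X, []), (Y, [])])"
        if "X \<in> obj A" "Y \<in> obj A" for X Y
        using inv[rule_format, of "[X, Y]"] that by (simp add: is_objs_def ainf_op_def)
    qed
    show ?thesis by (rule right_Serre_K_functor_kfun)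
  qed
  \<comment> \<open>The equivalence half concerns the homotopy category alone and is added to the
    right Serre half.\<close>
  then show ?thesis
    using K_equivalence_kfun by (auto simp: Serre_ainf_functor_def Serre_K_functor_def)
qed

end
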